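(* Let $\nu\in[2,2.1]$ and let $f\colon\mathbb{R}\to\mathbb{R}$ be any function of the form $$f(x)=1.6\cos(2x)-2\sin(3x)+\sum_{k=1}^{3}\bigl(\beta_k\sin(kx)+\gamma_k\cos(kx)\bigr),\qquad \beta_k,\gamma_k\in[-0.03,0.03]\ (k=1,2,3).$$ Then there exists a $2\pi$-periodic steady state solution $\bar u$ of $$u_t+u\,u_x-\nu u_{xx}=f(x)$$ with $\int_0^{2\pi}\bar u(x)\,dx=\pi$, which is unique (among $2\pi$-periodic steady states with integral $\pi$ over $[0,2\pi]$) and attracts globally every $2\pi$-periodic initial datum $u_0\colon\mathbb{R}\to\mathbb{R}$ satisfying $u_0\in C^4$ and $\int_0^{2\pi}u_0(x)\,dx=\pi$. That is, for every such $u_0$ the solution $u$ of the initial value problem with periodic boundary conditions and $u(\cdot,0)=u_0$ exists for all $t\ge 0$ and converges to $\bar u$ as $t\to\infty$.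
   Context: The viscous Burgers equation with periodic boundary conditions and forcing constant in time is the problem $$u_t+u\,u_x-\nu u_{xx}=f(x),\quad u(x,t)=u(x+2k\pi,t)\ (k\in\mathbb{Z}),\quad u(x,0)=u_0(x),$$ for $u\colon\mathbb{R}\times[0,\mathcal{T})\to\mathbb{R}$, with $\nu>0$ the viscosity constant and $f$ a $2\pi$-periodic function. A steady state solution is a solution that does not depend on $t$. Solutions are classical. The Fourier modes of a $2\pi$-periodic function $v$ are $a_k=\frac{1}{2\pi}\int_0^{2\pi}v(x)e^{-ikx}\,dx$, $k\in\mathbb{Z}$. Convergence $u(\cdot,t)\to\bar u$ is understood in terms of Fourier modes: if $a_k(t)$ and $\bar a_k$ are the Fourier modes of $u(\cdot,t)$ and $\bar u$, then $\sup_{k\in\mathbb{Z}}|a_k(t)-\bar a_k|\to 0$ as $t\to\infty$. Since $\int_0^{2\pi} f=0$, the integral $\int_0^{2\pi}u(x,t)\,dx$ is constant in time. *)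

theory Defs
  imports "HOL-Analysis.Analysis"
begin

definition C_k :: "nat \<Rightarrow> (real \<Rightarrow> real) \<Rightarrow> bool" where
  "C_k n g \<longleftrightarrow>
     (\<forall>j<n. \<forall>x. (deriv ^^ j) g field_differentiable (at x)) \<and>
     continuous_on UNIV ((deriv ^^ n) g)"

definition periodic_2pi :: "(real \<Rightarrow> real) \<Rightarrow> bool" where
  "periodic_2pi v \<longleftrightarrow> (\<forall>x. \<forall>k::int. v (x + 2 * of_int k * pi) = v x)"

text \<open>
  A classical solution \<open>u x t\<close> on \<open>\<real> \<times> [0, T)\<close>, where \<open>T = \<infinity>\<close> is allowed: the derivatives
  \<open>u\<^sub>t\<close>, \<open>u\<^sub>x\<close>, \<open>u\<^sub>x\<^sub>x\<close> exist and are continuous on \<open>\<real> \<times> [0, T)\<close>, and the equation holds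
  there, including at \<open>t = 0\<close>, where \<open>u\<^sub>t\<close> is the one-sided derivative. Continuity of \<open>u\<close>
  itself follows from that of \<open>u\<^sub>t\<close> and \<open>u\<^sub>x\<close>. The values of \<open>u x t\<close> for \<open>t\<close> outside
  \<open>[0, T)\<close> are irrelevant.
\<close>

definition burgers_solution ::
    "real \<Rightarrow> (real \<Rightarrow> real) \<Rightarrow> ereal \<Rightarrow> (real \<Rightarrow> real \<Rightarrow> real) \<Rightarrow> bool" where
  "burgers_solution \<nu> f T u \<longleftrightarrow>
     (let I = {t. 0 \<le> t \<and> ereal t < T} in
       (\<forall>t\<in>I. periodic_2pi (\<lambda>x. u x t)) \<and>
       (\<exists>u_t u_x u_xx :: real \<Rightarrow> real \<Rightarrow> real.
          continuous_on (UNIV \<times> I) (\<lambda>(x, t). u_t x t) \<and>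
          continuous_on (UNIV \<times> I) (\<lambda>(x, t). u_x x t) \<and>
          continuous_on (UNIV \<times> I) (\<lambda>(x, t). u_xx x t) \<and>
          (\<forall>x. \<forall>t\<in>I.
             ((\<lambda>s. u x s) has_real_derivative u_t x t) (at t within I) \<and>
             ((\<lambda>y. u y t) has_real_derivative u_x x t) (at x) \<and>
             ((\<lambda>y. u_x y t) has_real_derivative u_xx x t) (at x) \<and>
             u_t x t + u x t * u_x x t - \<nu> * u_xx x t = f x)))"

definition burgers_ivp_solution ::
    "real \<Rightarrow> (real \<Rightarrow> real) \<Rightarrow> (real \<Rightarrow> real) \<Rightarrow> ereal \<Rightarrow> (real \<Rightarrow> real \<Rightarrow> real) \<Rightarrow> bool" where
  "burgers_ivp_solution \<nu> f u0 T u \<longleftrightarrow> burgers_solution \<nu> f T u \<and> (\<forall>x. u x 0 = u0 x)"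

definition burgers_steady_state :: "real \<Rightarrow> (real \<Rightarrow> real) \<Rightarrow> (real \<Rightarrow> real) \<Rightarrow> bool" where
  "burgers_steady_state \<nu> f v \<longleftrightarrow> burgers_solution \<nu> f \<infinity> (\<lambda>x t. v x)"

definition fourier_mode :: "(real \<Rightarrow> real) \<Rightarrow> int \<Rightarrow> complex" where
  "fourier_mode v k =
     1 / (2 * complex_of_real pi) *
     integral {0..2 * pi}
       (\<lambda>x. complex_of_real (v x) * exp (- \<i> * of_int k * complex_of_real x))"

text \<open>
  The supremum is taken in \<open>real\<close>, hence is meaningful only for bounded families; for
  continuous \<open>u(\<cdot>, t)\<close> and \<open>v\<close> the differences of modes are bounded by the maximum of
  \<open>\<bar>u(x, t) - v(x)\<bar>\<close> over \<open>[0, 2\<pi>]\<close>.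
\<close>

definition converges_in_modes :: "(real \<Rightarrow> real \<Rightarrow> real) \<Rightarrow> (real \<Rightarrow> real) \<Rightarrow> bool" where
  "converges_in_modes u v \<longleftrightarrow>
     ((\<lambda>t. SUP k. cmod (fourier_mode (\<lambda>x. u x t) k - fourier_mode v k)) \<longlongrightarrow> 0) at_top"

text \<open>
  ``The solution of the initial value problem exists for all times and converges to \<open>v\<close>'': there
  is a solution on \<open>[0, \<infinity>)\<close>, every solution on any \<open>[0, T)\<close> is a restriction of it, and it
  converges.
\<close>

definition attracts :: "real \<Rightarrow> (real \<Rightarrow> real) \<Rightarrow> (real \<Rightarrow> real) \<Rightarrow> (real \<Rightarrow> real) \<Rightarrow> bool" where
  "attracts \<nu> f v u0 \<longleftrightarrow>
     (\<exists>u. burgers_ivp_solution \<nu> f u0 \<infinity> u \<and>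
          (\<forall>T w. 0 < T \<longrightarrow> burgers_ivp_solution \<nu> f u0 T w \<longrightarrow>
             (\<forall>x t. 0 \<le> t \<longrightarrow> ereal t < T \<longrightarrow> w x t = u x t)) \<and>
          converges_in_modes u v)"

end

theory Submission
  imports Defs
begin

text \<open>
  Write \<open>c\<close> for the mean and \<open>u = c - 2 \<nu> \<phi>\<^sub>x / \<phi>\<close> (Cole-Hopf). Burgers' equation becomes the linear equation
  \<open>\<phi>\<^sub>t = \<nu> \<phi>\<^sub>x\<^sub>x - c \<phi>\<^sub>x + V \<phi>\<close>, where \<open>-2 \<nu> V\<close> is a primitive of the forcing, and for the Fourier modes an
  infinite linear system whose coupling is a convolution of width 3. Its solutions exist for all times, and
  stay positive by the maximum principle. Uniqueness for Burgers' equation is the same maximum principle applied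
  to the difference of two solutions.

  Since \<open>\<phi> > 0\<close>, each mode of \<open>\<phi>\<close> is bounded by the mode of index 0, so the quotients
  \<open>y\<^sub>k = \<phi>\<^sub>k / \<phi>\<^sub>0\<close> lie in the unit disc. They satisfy
  \<open>y\<^sub>k' = - (\<nu> k\<^sup>2 + i c k) y\<^sub>k + (V * y)\<^sub>k - (V * y)\<^sub>0 y\<^sub>k\<close>. On the unit ball the nonlinearity has Lipschitz
  constant \<open>3 \<Sum>\<bar>V\<^sub>j\<bar> \<le> 6/5\<close> for the supremum norm, less than the dissipation rate \<open>\<nu> \<ge> 2\<close>. Hence there is exactly one
  stationary point, and it attracts all \<open>y\<close>; the steady state \<open>ubar\<close> is its Cole-Hopf transform.
\<close>

section \<open>Series of trigonometric functions\<close>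

lemma tendsto_infsum_dominated:
  fixes a :: "'k \<Rightarrow> 't \<Rightarrow> 'c :: banach"
  assumes lim: "\<And>k. (a k \<longlongrightarrow> b k) G"
    and bound: "\<forall>\<^sub>F t in G. \<forall>k. norm (a k t) \<le> M k"
    and M: "M summable_on UNIV"
  shows "((\<lambda>t. \<Sum>\<^sub>\<infinity>k. a k t) \<longlongrightarrow> (\<Sum>\<^sub>\<infinity>k. b k)) G"
proof (cases "G = bot")
  case False
  have b: "norm (b k) \<le> M k" for k
  proof (rule tendsto_upperbound[OF tendsto_norm[OF lim]])
    show "\<forall>\<^sub>F t in G. norm (a k t) \<le> M k" using bound by eventually_elim auto
  qed (use False in simp)
  have "(\<lambda>k. norm (b k)) summable_on UNIV"
    by (rule Infinite_Sum.abs_summable_on_comparison_test'[OF M b])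
  then have b_sum: "b summable_on UNIV" by (rule abs_summable_summable)
  show ?thesis
  proof (rule swap_uniform_limit')
    show "\<forall>\<^sub>F X in finite_subsets_at_top UNIV. ((\<lambda>t. \<Sum>k\<in>X. a k t) \<longlongrightarrow> (\<Sum>k\<in>X. b k)) G"
      by (intro always_eventually allI tendsto_sum lim)
    show "((\<lambda>X. \<Sum>k\<in>X. b k) \<longlongrightarrow> (\<Sum>\<^sub>\<infinity>k. b k)) (finite_subsets_at_top UNIV)"
      by (rule infsum_tendsto[OF b_sum])
    show "uniform_limit {t. \<forall>k. norm (a k t) \<le> M k} (\<lambda>X t. \<Sum>k\<in>X. a k t)
        (\<lambda>t. \<Sum>\<^sub>\<infinity>k. a k t) (finite_subsets_at_top UNIV)"
      by (rule Weierstrass_m_test_general[OF _ M]) auto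
    show "\<forall>\<^sub>F t in G. t \<in> {t. \<forall>k. norm (a k t) \<le> M k}" using bound by simp
  qed simp
qed simp

lemma continuous_on_infsum_dominated:
  fixes a :: "'k \<Rightarrow> 't::topological_space \<Rightarrow> 'c :: banach"
  assumes "\<And>k. continuous_on S (a k)" and "\<And>k t. t \<in> S \<Longrightarrow> norm (a k t) \<le> M k"
    and "M summable_on UNIV"
  shows "continuous_on S (\<lambda>t. \<Sum>\<^sub>\<infinity>k. a k t)"
  unfolding continuous_on_def
proof
  fix t assume "t \<in> S"
  show "((\<lambda>t. \<Sum>\<^sub>\<infinity>k. a k t) \<longlongrightarrow> (\<Sum>\<^sub>\<infinity>k. a k t)) (at t within S)"
  proof (rule tendsto_infsum_dominated[OF _ _ assms(3)])
    show "(a k \<longlongrightarrow> a k t) (at t within S)" for k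
      using assms(1)[of k] \<open>t \<in> S\<close> by (auto simp: continuous_on_def)
    show "\<forall>\<^sub>F t in at t within S. \<forall>k. norm (a k t) \<le> M k"
      using assms(2) by (auto simp: eventually_at_filter intro!: always_eventually)
  qed
qed

lemma has_sum_minus:
  fixes f g :: "'k \<Rightarrow> 'c::real_normed_vector"
  assumes "(f has_sum a) A" "(g has_sum b) A"
  shows "((\<lambda>k. f k - g k) has_sum (a - b)) A"
  using has_sum_add[OF assms(1), of "\<lambda>k. - g k" "- b"] assms(2) by (simp add: has_sum_uminus)

lemma has_sum_finite_sum:
  fixes f :: "'i \<Rightarrow> 'k \<Rightarrow> 'c::real_normed_vector"
  assumes "finite J" "\<And>j. j \<in> J \<Longrightarrow> (f j has_sum s j) A"
  shows "((\<lambda>k. \<Sum>j\<in>J. f j k) has_sum (\<Sum>j\<in>J. s j)) A"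
  using assms by (induction J rule: finite_induct) (auto intro!: has_sum_add)

lemma has_vector_derivative_infsum_dominated:
  fixes a a' :: "'k \<Rightarrow> real \<Rightarrow> 'c :: banach"
  assumes S: "convex S"
    and a': "\<And>k t. t \<in> S \<Longrightarrow> (a k has_vector_derivative a' k t) (at t within S)"
    and bound': "\<And>k t. t \<in> S \<Longrightarrow> norm (a' k t) \<le> M k"
    and M: "M summable_on UNIV"
    and sa: "\<And>t. t \<in> S \<Longrightarrow> (\<lambda>k. a k t) summable_on UNIV"
    and t: "t \<in> S"
  shows "((\<lambda>t. \<Sum>\<^sub>\<infinity>k. a k t) has_vector_derivative (\<Sum>\<^sub>\<infinity>k. a' k t)) (at t within S)"
proof -
  have *: "(f has_vector_derivative D) (at t within S) \<longleftrightarrow>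
      ((\<lambda>s. (f s - f t) /\<^sub>R (s - t)) \<longlongrightarrow> D) (at t within S)" for f :: "real \<Rightarrow> 'c" and D
  proof -
    have "((\<lambda>s. ((f s - f t) - (s - t) *\<^sub>R D) /\<^sub>R norm (s - t)) \<longlongrightarrow> 0) (at t within S)
      \<longleftrightarrow> ((\<lambda>s. (f s - f t) /\<^sub>R (s - t) - D) \<longlongrightarrow> 0) (at t within S)"
      (is "(?L \<longlongrightarrow> 0) _ \<longleftrightarrow> (?R \<longlongrightarrow> 0) _")
    proof -
      have "norm (?L s) = norm (?R s)" if "s \<noteq> t" for s
      proof -
        have "?R s = ((f s - f t) - (s - t) *\<^sub>R D) /\<^sub>R (s - t)"
          using that by (simp add: scaleR_diff_right)
        then show ?thesis by simp
      qed
      then have "((\<lambda>s. norm (?L s)) \<longlongrightarrow> 0) (at t within S) \<longleftrightarrow> ((\<lambda>s. norm (?R s)) \<longlongrightarrow> 0) (at t within S)"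
        by (intro filterlim_cong) (auto simp: eventually_at_filter)
      then show ?thesis by (simp only: tendsto_norm_zero_iff)
    qed
    then show ?thesis
      by (simp add: has_vector_derivative_def has_derivative_at_within bounded_linear_scaleR_left
          LIM_zero_iff diff_diff_eq add.commute)
  qed
  have quot: "norm ((a k s - a k t) /\<^sub>R (s - t)) \<le> M k" if "s \<in> S" for s k
  proof (cases "s = t")
    case True
    then show ?thesis using order_trans[OF norm_ge_zero bound'[OF t]] by simp
  next
    case False
    have "norm (a k s - a k t) \<le> M k * norm (s - t)"
    proof (rule differentiable_bound[OF S _ _ that t])
      show "(a k has_derivative (\<lambda>h. h *\<^sub>R a' k u)) (at u within S)" if "u \<in> S" for u
        using a'[OF that] by (simp add: has_vector_derivative_def)
      show "onorm (\<lambda>h. h *\<^sub>R a' k u) \<le> M k" if "u \<in> S" for u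
        using bound'[OF that, of k] onorm_scaleR_left[OF bounded_linear_ident, of "a' k u"]
        by (simp add: onorm_id)
    qed
    then show ?thesis using False
      by (simp only: norm_scaleR norm_inverse) (simp add: field_simps real_norm_def)
  qed
  have "((\<lambda>s. \<Sum>\<^sub>\<infinity>k. (a k s - a k t) /\<^sub>R (s - t)) \<longlongrightarrow> (\<Sum>\<^sub>\<infinity>k. a' k t)) (at t within S)"
  proof (rule tendsto_infsum_dominated[OF _ _ M])
    show "((\<lambda>s. (a k s - a k t) /\<^sub>R (s - t)) \<longlongrightarrow> a' k t) (at t within S)" for k
      using a'[OF t, of k] by (simp only: *)
    show "\<forall>\<^sub>F s in at t within S. \<forall>k. norm ((a k s - a k t) /\<^sub>R (s - t)) \<le> M k"
      using quot by (auto simp only: eventually_at_filter intro!: always_eventually)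
  qed
  moreover have "(\<Sum>\<^sub>\<infinity>k. (a k s - a k t) /\<^sub>R (s - t)) = ((\<Sum>\<^sub>\<infinity>k. a k s) - (\<Sum>\<^sub>\<infinity>k. a k t)) /\<^sub>R (s - t)"
    if "s \<in> S" for s
  proof -
    have "((\<lambda>k. a k s - a k t) has_sum (\<Sum>\<^sub>\<infinity>k. a k s) - (\<Sum>\<^sub>\<infinity>k. a k t)) UNIV"
      by (intro has_sum_minus has_sum_infsum sa t that)
    from has_sum_scaleR[OF this, of "inverse (s - t)"] show ?thesis by (rule infsumI)
  qed
  ultimately have "((\<lambda>s. ((\<Sum>\<^sub>\<infinity>k. a k s) - (\<Sum>\<^sub>\<infinity>k. a k t)) /\<^sub>R (s - t)) \<longlongrightarrow> (\<Sum>\<^sub>\<infinity>k. a' k t)) (at t within S)"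
    using t by (elim Lim_transform_within[of _ _ _ _ 1]) auto
  then show ?thesis by (simp only: *)
qed

lemma summable_on_int_weight: "(\<lambda>k::int. 1 / (1 + \<bar>real_of_int k\<bar>) ^ 2) summable_on UNIV"
proof -
  have s: "(\<lambda>n. 1 / (1 + real n) ^ 2) summable_on UNIV"
  proof (rule summable_nonneg_imp_summable_on)
    have "summable (\<lambda>n. inverse (real (Suc n) ^ 2))"
      using inverse_power_summable[of 2, where ?'a = real] summable_Suc_iff[of "\<lambda>n. inverse (real n ^ 2)"]
      by simp
    then show "summable (\<lambda>n. 1 / (1 + real n) ^ 2)" by (simp add: field_simps)
  qed simp
  have 1: "(\<lambda>k::int. 1 / (1 + \<bar>real_of_int k\<bar>) ^ 2) summable_on range int"
    using s by (subst summable_on_reindex) (auto simp: o_def)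
  have 2: "(\<lambda>k::int. 1 / (1 + \<bar>real_of_int k\<bar>) ^ 2) summable_on range (\<lambda>n. - int n)"
    using s by (subst summable_on_reindex) (auto simp: o_def inj_on_def)
  have eq: "range int \<union> (range (\<lambda>n. - int n) - range int) = (UNIV :: int set)"
  proof -
    have "k \<in> range int \<union> range (\<lambda>n. - int n)" for k :: int
      by (cases k rule: int_cases2) auto
    then show ?thesis by auto
  qed
  have "(\<lambda>k::int. 1 / (1 + \<bar>real_of_int k\<bar>) ^ 2) summable_on (range (\<lambda>n. - int n) - range int)"
    by (rule summable_on_subset_banach[OF 2]) auto
  from summable_on_Un_disjoint[OF 1 this] show ?thesis by (simp only: eq Diff_disjoint)
qed

text \<open>\<open>trig_series c\<close> is only meaningful for absolutely summable \<open>c\<close>; the polynomial weights below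
  control how often it may be differentiated.\<close>

definition trig_series :: "(int \<Rightarrow> complex) \<Rightarrow> real \<Rightarrow> complex" where
  "trig_series c x = (\<Sum>\<^sub>\<infinity>k. c k * cis (of_int k * x))"

definition decays :: "nat \<Rightarrow> real \<Rightarrow> (int \<Rightarrow> complex) \<Rightarrow> bool" where
  "decays p B c \<longleftrightarrow> (\<forall>k. cmod (c k) * (1 + \<bar>real_of_int k\<bar>) ^ p \<le> B)"

lemma decaysD: "decays p B c \<Longrightarrow> cmod (c k) * (1 + \<bar>real_of_int k\<bar>) ^ p \<le> B"
  by (simp add: decays_def)

lemma decays_nonneg: "decays p B c \<Longrightarrow> 0 \<le> B"
  using order_trans[OF norm_ge_zero[of "c 0"], of B] decaysD[of p B c 0] by simp

lemma decays_mono: "decays p B c \<Longrightarrow> q \<le> p \<Longrightarrow> decays q B c"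
  unfolding decays_def
proof
  fix k assume *: "\<forall>k. cmod (c k) * (1 + \<bar>real_of_int k\<bar>) ^ p \<le> B" and "q \<le> p"
  have "cmod (c k) * (1 + \<bar>real_of_int k\<bar>) ^ q \<le> cmod (c k) * (1 + \<bar>real_of_int k\<bar>) ^ p"
    by (intro mult_left_mono power_increasing \<open>q \<le> p\<close>) auto
  then show "cmod (c k) * (1 + \<bar>real_of_int k\<bar>) ^ q \<le> B" using * by (meson order_trans)
qed

lemma decays_add:
  assumes "decays p B c" "decays p D d"
  shows "decays p (B + D) (\<lambda>k. c k + d k)"
  unfolding decays_def
proof
  fix k
  have "cmod (c k + d k) * (1 + \<bar>real_of_int k\<bar>) ^ p \<le> (cmod (c k) + cmod (d k)) * (1 + \<bar>real_of_int k\<bar>) ^ p"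
    by (intro mult_right_mono norm_triangle_ineq) simp
  also have "\<dots> \<le> B + D"
    unfolding distrib_right by (intro add_mono decaysD assms)
  finally show "cmod (c k + d k) * (1 + \<bar>real_of_int k\<bar>) ^ p \<le> B + D" .
qed

lemma decays_abs_summable:
  assumes "decays 2 B c"
  shows "cmod (c k) \<le> B * (1 / (1 + \<bar>real_of_int k\<bar>) ^ 2)"
    and "(\<lambda>k. B * (1 / (1 + \<bar>real_of_int k\<bar>) ^ 2)) summable_on UNIV"
    and "(\<lambda>k. cmod (c k)) summable_on UNIV"
proof -
  show 1: "cmod (c k) \<le> B * (1 / (1 + \<bar>real_of_int k\<bar>) ^ 2)" for k
    using decaysD[OF assms, of k] by (simp add: pos_le_divide_eq)
  show 2: "(\<lambda>k. B * (1 / (1 + \<bar>real_of_int k\<bar>) ^ 2)) summable_on UNIV"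
    by (intro summable_on_cmult_right summable_on_int_weight)
  show "(\<lambda>k. cmod (c k)) summable_on UNIV"
    by (rule Infinite_Sum.abs_summable_on_comparison_test'[OF 2 1])
qed

lemma trig_series_has_sum:
  assumes "(\<lambda>k. cmod (c k)) summable_on UNIV"
  shows "((\<lambda>k. c k * cis (of_int k * x)) has_sum trig_series c x) UNIV"
  unfolding trig_series_def
  by (rule has_sum_infsum, rule abs_summable_summable) (use assms in \<open>simp add: norm_mult\<close>)

lemma norm_trig_series_le:
  assumes "(\<lambda>k. cmod (c k)) summable_on UNIV"
  shows "cmod (trig_series c x) \<le> (\<Sum>\<^sub>\<infinity>k. cmod (c k))"
  by (rule norm_infsum_le[OF trig_series_has_sum[OF assms] has_sum_infsum[OF assms]])
     (simp add: norm_mult)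

lemma trig_series_diff:
  assumes "(\<lambda>k. cmod (c k)) summable_on UNIV" "(\<lambda>k. cmod (d k)) summable_on UNIV"
  shows "trig_series (\<lambda>k. c k - d k) x = trig_series c x - trig_series d x"
  using infsumI[OF has_sum_minus[OF trig_series_has_sum[OF assms(1)] trig_series_has_sum[OF assms(2)], of x x]]
  by (simp add: trig_series_def left_diff_distrib)

lemma trig_series_add:
  assumes "(\<lambda>k. cmod (c k)) summable_on UNIV" "(\<lambda>k. cmod (d k)) summable_on UNIV"
  shows "trig_series (\<lambda>k. c k + d k) x = trig_series c x + trig_series d x"
  using infsumI[OF has_sum_add[OF trig_series_has_sum[OF assms(1)] trig_series_has_sum[OF assms(2)], of x x]]
  by (simp add: trig_series_def distrib_right)

lemma trig_series_mult: "trig_series (\<lambda>k. a * c k) x = a * trig_series c x"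
  by (simp add: trig_series_def mult.assoc infsum_cmult_right')

lemma continuous_on_trig_series:
  assumes "\<And>k. continuous_on I (\<lambda>t. c t k)" and "\<And>t. t \<in> I \<Longrightarrow> decays 2 B (c t)"
  shows "continuous_on (UNIV \<times> I) (\<lambda>(x, t). trig_series (c t) x)"
  unfolding trig_series_def case_prod_unfold
proof (rule continuous_on_infsum_dominated)
  show "continuous_on (UNIV \<times> I) (\<lambda>p. c (snd p) k * cis (of_int k * fst p))" for k
    by (intro continuous_intros continuous_on_compose2[OF assms(1)[of k] continuous_on_snd]) auto
  show "cmod (c (snd p) k * cis (of_int k * fst p)) \<le> B * (1 / (1 + \<bar>real_of_int k\<bar>) ^ 2)"
    if "p \<in> UNIV \<times> I" for k p
    using decays_abs_summable(1)[OF assms(2)] that by (auto simp: norm_mult)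
  show "(\<lambda>k. B * (1 / (1 + \<bar>real_of_int k\<bar>) ^ 2)) summable_on UNIV"
    by (intro summable_on_cmult_right summable_on_int_weight)
qed

lemma decays_deriv:
  assumes "decays (Suc p) B c"
  shows "decays p B (\<lambda>k. \<i> * of_int k * c k)"
  unfolding decays_def
proof
  fix k :: int
  have "cmod (\<i> * of_int k * c k) * (1 + \<bar>real_of_int k\<bar>) ^ p
      = cmod (c k) * (\<bar>real_of_int k\<bar> * (1 + \<bar>real_of_int k\<bar>) ^ p)"
    by (simp add: norm_mult)
  also have "\<dots> \<le> cmod (c k) * ((1 + \<bar>real_of_int k\<bar>) * (1 + \<bar>real_of_int k\<bar>) ^ p)"
    by (intro mult_left_mono mult_right_mono) auto
  also have "\<dots> \<le> B" using decaysD[OF assms, of k] by simp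
  finally show "cmod (\<i> * of_int k * c k) * (1 + \<bar>real_of_int k\<bar>) ^ p \<le> B" .
qed

lemma cis_has_vector_derivative:
  "((\<lambda>x. cis (a * x)) has_vector_derivative \<i> * of_real a * cis (a * x)) (at x within S)"
proof -
  have "((\<lambda>z. exp (\<i> * of_real a * z)) has_field_derivative \<i> * of_real a * exp (\<i> * of_real a * of_real x))
      (at (of_real x))"
    by (auto intro!: derivative_eq_intros)
  from has_vector_derivative_real_field[OF this, of S] show ?thesis
    by (simp add: cis_conv_exp mult.assoc)
qed

lemma trig_series_has_vector_derivative:
  assumes "decays 3 B c"
  shows "(trig_series c has_vector_derivative trig_series (\<lambda>k. \<i> * of_int k * c k) x) (at x)"
proof -
  have d: "decays 2 B (\<lambda>k. \<i> * of_int k * c k)" using decays_deriv[of 2] assms by (simp add: eval_nat_numeral)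
  have "((\<lambda>x. \<Sum>\<^sub>\<infinity>k. c k * cis (of_int k * x)) has_vector_derivative
      (\<Sum>\<^sub>\<infinity>k. \<i> * of_int k * c k * cis (of_int k * x))) (at x within UNIV)"
  proof (rule has_vector_derivative_infsum_dominated)
    show "((\<lambda>x. c k * cis (of_int k * x)) has_vector_derivative \<i> * of_int k * c k * cis (of_int k * t)) (at t)"
      for k t
      using has_vector_derivative_mult_right[OF cis_has_vector_derivative[of "of_int k" t UNIV], of "c k"]
      by (simp add: mult_ac)
    show "cmod (\<i> * of_int k * c k * cis (of_int k * t)) \<le> B * (1 / (1 + \<bar>real_of_int k\<bar>) ^ 2)" for k t
      using decays_abs_summable(1)[OF d, of k] by (simp add: norm_mult)
    show "(\<lambda>k. c k * cis (of_int k * t)) summable_on UNIV" for t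
      using trig_series_has_sum[OF decays_abs_summable(3)[OF decays_mono[OF assms]]]
      by (auto dest: has_sum_imp_summable)
  qed (use decays_abs_summable(2)[OF d] in auto)
  then show ?thesis by (simp add: trig_series_def[abs_def])
qed

lemma trig_series_has_time_derivative:
  assumes "convex I" "t \<in> I"
    and "\<And>k t. t \<in> I \<Longrightarrow> ((\<lambda>s. c s k) has_vector_derivative c' t k) (at t within I)"
    and "\<And>t. t \<in> I \<Longrightarrow> decays 2 B (c t)" "\<And>t. t \<in> I \<Longrightarrow> decays 2 B' (c' t)"
  shows "((\<lambda>s. trig_series (c s) x) has_vector_derivative trig_series (c' t) x) (at t within I)"
  unfolding trig_series_def
proof (rule has_vector_derivative_infsum_dominated[OF assms(1)])
  show "((\<lambda>s. c s k * cis (of_int k * x)) has_vector_derivative c' t k * cis (of_int k * x)) (at t within I)"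
    if "t \<in> I" for t k
    using has_vector_derivative_mult_left[OF assms(3)[OF that]] by simp
  show "cmod (c' t k * cis (of_int k * x)) \<le> B' * (1 / (1 + \<bar>real_of_int k\<bar>) ^ 2)" if "t \<in> I" for t k
    using decays_abs_summable(1)[OF assms(5)[OF that]] by (simp add: norm_mult)
  show "(\<lambda>k. B' * (1 / (1 + \<bar>real_of_int k\<bar>) ^ 2)) summable_on UNIV"
    by (intro summable_on_cmult_right summable_on_int_weight)
  show "(\<lambda>k. c t k * cis (of_int k * x)) summable_on UNIV" if "t \<in> I" for t
    using trig_series_has_sum[OF decays_abs_summable(3)[OF assms(4)[OF that]]]
    by (auto dest: has_sum_imp_summable)
qed (use assms in auto)

lemma trig_series_shift:
  assumes "(\<lambda>k. cmod (c k)) summable_on UNIV"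
  shows "(\<lambda>k. cmod (c (k - j))) summable_on UNIV"
    and "trig_series (\<lambda>k. c (k - j)) x = cis (of_int j * x) * trig_series c x"
proof -
  have bij: "bij_betw (\<lambda>k. k - j) UNIV (UNIV :: int set)"
    by (rule bij_betw_byWitness[where f' = "\<lambda>k. k + j"]) auto
  show "(\<lambda>k. cmod (c (k - j))) summable_on UNIV"
    using summable_on_reindex_bij_betw[OF bij, of "\<lambda>k. cmod (c k)"] assms by simp
  have "(\<Sum>\<^sub>\<infinity>k. c k * cis (of_int k * x)) = (\<Sum>\<^sub>\<infinity>k. c (k - j) * cis (of_int (k - j) * x))"
    by (rule infsum_reindex_bij_betw[OF bij, symmetric])
  then have "cis (of_int j * x) * trig_series c x
      = (\<Sum>\<^sub>\<infinity>k. cis (of_int j * x) * (c (k - j) * cis (of_int (k - j) * x)))"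
    by (simp add: trig_series_def infsum_cmult_right')
  also have "\<dots> = trig_series (\<lambda>k. c (k - j)) x"
    unfolding trig_series_def
    by (intro infsum_cong) (simp add: cis_mult algebra_simps)
  finally show "trig_series (\<lambda>k. c (k - j)) x = cis (of_int j * x) * trig_series c x" ..
qed

lemma trig_series_convolution:
  assumes "finite J" "(\<lambda>k. cmod (c k)) summable_on UNIV"
  shows "(\<lambda>k. cmod (\<Sum>j\<in>J. V j * c (k - j))) summable_on UNIV"
    and "trig_series (\<lambda>k. \<Sum>j\<in>J. V j * c (k - j)) x = (\<Sum>j\<in>J. V j * cis (of_int j * x)) * trig_series c x"
proof -
  have "(\<lambda>k. cmod (\<Sum>j\<in>J. V j * c (k - j))) summable_on UNIV \<and>
    trig_series (\<lambda>k. \<Sum>j\<in>J. V j * c (k - j)) x = (\<Sum>j\<in>J. V j * cis (of_int j * x)) * trig_series c x"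
    using assms(1)
  proof induction
    case empty
    then show ?case by (simp add: trig_series_def)
  next
    case (insert i J)
    have s: "(\<lambda>k. cmod (V i * c (k - i))) summable_on UNIV"
      using summable_on_cmult_right[OF trig_series_shift(1)[OF assms(2)], of "cmod (V i)"]
      by (simp add: norm_mult)
    have "(\<lambda>k. cmod (V i * c (k - i) + (\<Sum>j\<in>J. V j * c (k - j)))) summable_on UNIV"
      by (rule Infinite_Sum.abs_summable_on_comparison_test'[OF summable_on_add[OF s conjunct1[OF insert.IH]]])
        (rule norm_triangle_ineq)
    moreover have "trig_series (\<lambda>k. V i * c (k - i) + (\<Sum>j\<in>J. V j * c (k - j))) x
      = (V i * cis (of_int i * x) + (\<Sum>j\<in>J. V j * cis (of_int j * x))) * trig_series c x"
      using insert.IH trig_series_add[OF s conjunct1[OF insert.IH], of x]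
      by (simp add: trig_series_mult trig_series_shift(2)[OF assms(2)] algebra_simps)
    ultimately show ?case using insert.hyps by simp
  qed
  then show "(\<lambda>k. cmod (\<Sum>j\<in>J. V j * c (k - j))) summable_on UNIV"
    and "trig_series (\<lambda>k. \<Sum>j\<in>J. V j * c (k - j)) x = (\<Sum>j\<in>J. V j * cis (of_int j * x)) * trig_series c x"
    by auto
qed

lemma trig_series_cnj:
  assumes "\<And>k. c (- k) = cnj (c k)"
  shows "cnj (trig_series c x) = trig_series c x"
proof -
  have bij: "bij_betw uminus UNIV (UNIV :: int set)"
    by (rule bij_betw_byWitness[where f' = uminus]) auto
  have "cnj (trig_series c x) = (\<Sum>\<^sub>\<infinity>k. c (- k) * cis (of_int (- k) * x))"
    unfolding trig_series_def infsum_cnj[symmetric] by (intro infsum_cong) (simp add: assms cis_cnj)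
  also have "\<dots> = trig_series c x"
    unfolding trig_series_def by (rule infsum_reindex_bij_betw[OF bij])
  finally show ?thesis .
qed

section \<open>Fourier modes\<close>

lemma fourier_mode_cis:
  "fourier_mode v k = of_real (1 / (2*pi)) * integral {0..2*pi} (\<lambda>x. of_real (v x) * cis (- (of_int k * x)))"
  unfolding fourier_mode_def
  by (simp add: cis_conv_exp mult.assoc)

lemma fourier_mode_integrable:
  assumes "continuous_on {0..2*pi} v"
  shows "(\<lambda>x. of_real (v x) * cis (- (of_int k * x))) integrable_on {0..2*pi}"
  by (intro integrable_continuous_interval continuous_intros assms)

lemma fourier_mode_linear:
  assumes "continuous_on {0..2*pi} v" "continuous_on {0..2*pi} w"
  shows "fourier_mode (\<lambda>x. a * v x + b * w x) k = of_real a * fourier_mode v k + of_real b * fourier_mode w k"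
proof -
  have "integral {0..2*pi} (\<lambda>x. of_real (a * v x + b * w x) * cis (- (of_int k * x)))
      = integral {0..2*pi} (\<lambda>x. of_real a * (of_real (v x) * cis (- (of_int k * x)))
          + of_real b * (of_real (w x) * cis (- (of_int k * x))))"
    by (simp add: algebra_simps)
  also have "\<dots> = of_real a * integral {0..2*pi} (\<lambda>x. of_real (v x) * cis (- (of_int k * x)))
      + of_real b * integral {0..2*pi} (\<lambda>x. of_real (w x) * cis (- (of_int k * x)))"
    by (subst integral_add) (auto intro!: integrable_on_mult_right fourier_mode_integrable assms)
  finally show ?thesis by (simp add: fourier_mode_cis distrib_left mult_ac)
qed

lemma fourier_mode_diff:
  assumes "continuous_on {0..2*pi} v" "continuous_on {0..2*pi} w"
  shows "fourier_mode (\<lambda>x. v x - w x) k = fourier_mode v k - fourier_mode w k"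
  using fourier_mode_linear[OF assms, of 1 "-1" k] by simp

lemma norm_fourier_mode_le:
  assumes "continuous_on {0..2*pi} v" "\<And>x. x \<in> {0..2*pi} \<Longrightarrow> \<bar>v x\<bar> \<le> M"
  shows "cmod (fourier_mode v k) \<le> M"
proof -
  have "cmod (integral {0..2*pi} (\<lambda>x. of_real (v x) * cis (- (of_int k * x)))) \<le> M * (2*pi - 0)"
    by (rule integral_bound) (use assms in \<open>auto intro!: continuous_intros simp: norm_mult\<close>)
  then show ?thesis by (simp add: fourier_mode_cis norm_mult norm_divide field_simps)
qed

lemma fourier_mode_0:
  assumes "continuous_on {0..2*pi} v"
  shows "fourier_mode v 0 = of_real (integral {0..2*pi} v / (2*pi))"
  using integral_linear[OF integrable_continuous_interval[OF assms] bounded_linear_of_real[where 'a = complex]]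
  by (simp add: fourier_mode_cis o_def)

lemma norm_fourier_mode_le_mode_0:
  assumes "continuous_on {0..2*pi} v" "\<And>x. x \<in> {0..2*pi} \<Longrightarrow> 0 \<le> v x"
  shows "cmod (fourier_mode v k) \<le> Re (fourier_mode v 0)"
proof -
  have "cmod (integral {0..2*pi} (\<lambda>x. of_real (v x) * cis (- (of_int k * x)))) \<le> integral {0..2*pi} v"
    by (rule Henstock_Kurzweil_Integration.integral_norm_bound_integral)
      (use assms in \<open>auto intro!: integrable_continuous_interval continuous_intros simp: norm_mult\<close>)
  then show ?thesis
    unfolding fourier_mode_0[OF assms(1)] by (simp add: fourier_mode_cis norm_mult norm_divide field_simps)
qed

lemma integral_cis:
  "integral {0..2*pi} (\<lambda>x. cis (of_int k * x)) = (if k = 0 then of_real (2*pi) else 0)"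
proof (cases "k = 0")
  case False
  have "((\<lambda>x. \<i> * of_int k * cis (of_int k * x)) has_integral cis (of_int k * (2*pi)) - cis (of_int k * 0)) {0..2*pi}"
    by (rule fundamental_theorem_of_calculus)
      (use cis_has_vector_derivative[of "of_int k"] in auto)
  moreover have "cis (of_int k * (2*pi)) = 1" by (metis cis_multiple_2pi Ints_of_int mult.commute)
  ultimately have "integral {0..2*pi} (\<lambda>x. \<i> * of_int k * cis (of_int k * x)) = 0"
    by (auto simp: has_integral_iff)
  then show ?thesis using False by simp
qed (simp add: scaleR_conv_of_real)

lemma fourier_mode_trig_series:
  assumes c: "(\<lambda>k. cmod (c k)) summable_on UNIV"
    and v: "\<And>x. complex_of_real (v x) = trig_series c x"
  shows "fourier_mode v k = c k"
proof -
  let ?F = "finite_subsets_at_top (UNIV :: int set)"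
  let ?f = "\<lambda>j x. c j * cis (of_int j * x) * cis (- (of_int k * x))"
  have u: "uniform_limit {0..2*pi} (\<lambda>X x. \<Sum>j\<in>X. ?f j x) (\<lambda>x. \<Sum>\<^sub>\<infinity>j. ?f j x) ?F"
    by (rule Weierstrass_m_test_general[OF _ c]) (simp add: norm_mult)
  have lim: "(\<Sum>\<^sub>\<infinity>j. ?f j x) = of_real (v x) * cis (- (of_int k * x))" for x
    by (simp only: infsum_cmult_left' v trig_series_def)
  have cont: "continuous_on {0..2*pi} (\<lambda>x. \<Sum>j\<in>X. ?f j x)" for X
    by (intro continuous_intros)
  obtain I J where IJ: "\<And>X. ((\<lambda>x. \<Sum>j\<in>X. ?f j x) has_integral I X) {0..2*pi}"
    "((\<lambda>x. \<Sum>\<^sub>\<infinity>j. ?f j x) has_integral J) {0..2*pi}" "(I \<longlongrightarrow> J) ?F"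
    using uniform_limit_integral[OF u cont] by auto
  have fI: "integral {0..2*pi} (?f j) = (if j = k then of_real (2*pi) * c k else 0)" for j
  proof -
    have "?f j = (\<lambda>x. c j * cis (of_int (j - k) * x))" by (auto simp: cis_mult algebra_simps)
    then show ?thesis using integral_cis[of "j - k"] by simp
  qed
  have "I X = of_real (2*pi) * c k" if "finite X" "k \<in> X" for X
  proof -
    have "I X = integral {0..2*pi} (\<lambda>x. \<Sum>j\<in>X. ?f j x)" by (rule integral_unique[OF IJ(1), symmetric])
    also have "\<dots> = (\<Sum>j\<in>X. integral {0..2*pi} (?f j))"
      by (rule integral_sum[OF \<open>finite X\<close>]) (intro integrable_continuous_interval continuous_intros)
    also have "\<dots> = of_real (2*pi) * c k" using that by (simp only: fI sum.delta) simp
    finally show ?thesis .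
  qed
  then have "\<forall>\<^sub>F X in ?F. I X = of_real (2*pi) * c k"
    by (auto simp: eventually_finite_subsets_at_top intro!: exI[of _ "{k}"])
  then have "(I \<longlongrightarrow> of_real (2*pi) * c k) ?F" by (rule tendsto_eventually)
  then have "J = of_real (2*pi) * c k" using tendsto_unique[OF _ IJ(3)] by simp
  then have "integral {0..2*pi} (\<lambda>x. of_real (v x) * cis (- (of_int k * x))) = of_real (2*pi) * c k"
    using IJ(2) by (simp only: lim has_integral_iff)
  then show ?thesis by (simp add: fourier_mode_cis)
qed

lemma fourier_mode_mult_trig_zero:
  assumes "continuous_on {0..2*pi} g" "\<And>k. fourier_mode g k = 0"
  shows "fourier_mode (\<lambda>x. cos x * g x) k = 0" "fourier_mode (\<lambda>x. sin x * g x) k = 0"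
proof -
  let ?g = "\<lambda>k x. of_real (g x) * cis (- (of_int k * x))"
  have 0: "integral {0..2*pi} (?g k) = 0" for k
    using assms(2)[of k] by (simp add: fourier_mode_cis)
  have "(\<lambda>x. of_real (cos x * g x) * cis (- (of_int k * x))) = (\<lambda>x. (1/2) * ?g (k - 1) x + (1/2) * ?g (k + 1) x)"
    by (rule ext) (simp add: complex_eq_iff cos_add sin_add cos_diff sin_diff field_simps)
  moreover have "(\<lambda>x. of_real (sin x * g x) * cis (- (of_int k * x)))
      = (\<lambda>x. (- \<i> / 2) * ?g (k - 1) x + (\<i> / 2) * ?g (k + 1) x)"
    by (rule ext) (simp add: complex_eq_iff cos_add sin_add cos_diff sin_diff field_simps)
  moreover have "integral {0..2*pi} (\<lambda>x. a * ?g (k - 1) x + b * ?g (k + 1) x) = 0" for a b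
    by (subst integral_add)
      (auto intro!: integrable_on_mult_right fourier_mode_integrable[OF assms(1)] simp: 0 simp del: of_int_diff of_int_add of_int_1)
  ultimately show "fourier_mode (\<lambda>x. cos x * g x) k = 0" "fourier_mode (\<lambda>x. sin x * g x) k = 0"
    by (simp_all only: fourier_mode_cis mult_zero_right)
qed

lemma fourier_mode_mult_polynomial_zero:
  assumes "real_polynomial_function p" "continuous_on {0..2*pi} g" "\<And>k. fourier_mode g k = 0"
  shows "fourier_mode (\<lambda>x. p (cis x) * g x) k = 0"
  using assms
proof (induction p arbitrary: g k rule: real_polynomial_function.induct)
  case (linear f)
  then interpret bounded_linear f by simp
  have "f (cis x) = f 1 * cos x + f \<i> * sin x" for x
  proof -
    have "cis x = cos x *\<^sub>R 1 + sin x *\<^sub>R \<i>" by (simp add: complex_eq_iff)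
    then show ?thesis by (simp only: add scaleR) simp
  qed
  then have "(\<lambda>x. f (cis x) * g x) = (\<lambda>x. f 1 * (cos x * g x) + f \<i> * (sin x * g x))"
    by (simp add: algebra_simps)
  then show ?case
    using fourier_mode_linear[of "\<lambda>x. cos x * g x" "\<lambda>x. sin x * g x" "f 1" "f \<i>" k]
      fourier_mode_mult_trig_zero[OF linear.prems] linear.prems(1)
    by (simp add: continuous_intros)
next
  case (const c)
  then show ?case using fourier_mode_linear[of g g c 0 k] by simp
next
  case (add p q)
  have c: "continuous_on {0..2*pi} (\<lambda>x. r (cis x) * g x)" if "real_polynomial_function r" for r :: "complex \<Rightarrow> real"
    using add.prems that
    by (intro continuous_intros continuous_on_compose2[OF continuous_on_polymonial_function[of r UNIV]])
      (auto simp: real_polynomial_function_eq)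
  show ?case
    using fourier_mode_linear[OF c[OF add.hyps(1)] c[OF add.hyps(2)], of 1 1 k]
      add.IH(1)[OF add.prems] add.IH(2)[OF add.prems]
    by (simp add: distrib_right)
next
  case (mult p q)
  have "continuous_on {0..2*pi} (\<lambda>x. q (cis x) * g x)"
    using mult.prems mult.hyps
    by (intro continuous_intros continuous_on_compose2[OF continuous_on_polymonial_function[of q UNIV]])
      (auto simp: real_polynomial_function_eq)
  from mult.IH(1)[OF this mult.IH(2)[OF mult.prems]] show ?case by (simp add: mult.assoc)
qed

lemma periodic_2pi_reduce:
  assumes "periodic_2pi v"
  obtains y where "y \<in> {0..2*pi}" "v y = v x"
proof -
  define k where "k = \<lfloor>x / (2*pi)\<rfloor>"
  have "of_int k \<le> x / (2*pi)" "x / (2*pi) \<le> of_int k + 1" unfolding k_def by linarith+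
  then have "x - 2 * of_int k * pi \<in> {0..2*pi}" by (auto simp: field_simps)
  moreover have "v (x - 2 * of_int k * pi) = v x"
    using assms[unfolded periodic_2pi_def, rule_format, of x "-k"] by simp
  ultimately show ?thesis using that by blast
qed

lemma periodic_2piD: "periodic_2pi g \<Longrightarrow> g (x + 2 * of_int k * pi) = g x"
  by (simp add: periodic_2pi_def)

text \<open>Needed to apply Stone-Weierstrass on the circle. \<open>Arg\<close> is discontinuous on the negative axis, where
  \<open>Arg (-z) + pi\<close> is used instead.\<close>

lemma periodic_factors_through_circle:
  assumes "continuous_on UNIV g" "periodic_2pi g"
  obtains G :: "complex \<Rightarrow> real" where "continuous_on (sphere 0 1) G" "\<And>x. G (cis x) = g x"
proof
  have eq: "g x = g y" if "cis x = cis y" for x y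
  proof -
    have "sin x = sin y \<and> cos x = cos y" using that by (simp add: complex_eq_iff)
    then obtain n :: int where "x = y + 2 * pi * n" using sin_cos_eq_iff by blast
    then show ?thesis using periodic_2piD[OF assms(2), of y n] by (simp add: mult_ac)
  qed
  define G where "G z = g (Arg z)" for z
  show "G (cis x) = g x" for x unfolding G_def by (rule eq) (simp add: cis_Arg)
  have G2: "G z = g (Arg (- z) + pi)" if "z \<noteq> 0" for z
    unfolding G_def
    by (rule eq) (use that in \<open>simp add: cis_mult[symmetric] cis_Arg sgn_minus\<close>)
  have g: "continuous (at x) g" for x using assms(1) by (simp add: continuous_on_eq_continuous_at)
  show "continuous_on (sphere 0 1) G"
  proof (intro continuous_at_imp_continuous_on ballI)
    fix z :: complex assume "z \<in> sphere 0 1"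
    then have z: "z \<noteq> 0" by auto
    show "isCont G z"
    proof (cases "z \<in> \<real>\<^sub>\<le>\<^sub>0")
      case False
      show ?thesis unfolding G_def
        by (rule continuous_within_compose3[OF g continuous_at_Arg[OF False]])
    next
      case True
      then have "- z \<notin> \<real>\<^sub>\<le>\<^sub>0" using z by (auto simp: complex_nonpos_Reals_iff complex_eq_iff)
      then have "isCont (\<lambda>z. Arg (- z)) z"
        by (intro continuous_within_compose3[OF continuous_at_Arg]) (auto intro!: continuous_intros)
      then have "isCont (\<lambda>z. g (Arg (- z) + pi)) z"
        by (intro continuous_within_compose3[OF g] continuous_intros)
      moreover have "\<forall>\<^sub>F w in nhds z. g (Arg (- w) + pi) = G w"
        using t1_space_nhds[OF z] by eventually_elim (simp add: G2)
      ultimately show ?thesis by (simp add: isCont_cong)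
    qed
  qed
qed

lemma fourier_mode_unique:
  assumes g: "continuous_on UNIV g" and per: "periodic_2pi g" and z: "\<And>k. fourier_mode g k = 0"
  shows "g x = 0"
proof -
  obtain G :: "complex \<Rightarrow> real" where G: "continuous_on (sphere 0 1) G" "\<And>x. G (cis x) = g x"
    using periodic_factors_through_circle[OF g per] by metis
  have gc: "continuous_on {0..2*pi} g" using g continuous_on_subset by blast
  have gg: "continuous_on {0..2*pi} (\<lambda>x. g x * g x)" by (intro continuous_on_mult gc)
  obtain B where "\<forall>y \<in> g ` {0..2*pi}. \<bar>y\<bar> \<le> B"
    using compact_continuous_image[OF gc compact_Icc, THEN compact_imp_bounded] unfolding bounded_real by blast
  then have B: "\<bar>g x\<bar> \<le> B" if "x \<in> {0..2*pi}" for x using that by blast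
  have B0: "0 \<le> B" using order_trans[OF abs_ge_zero B[of 0]] by simp
  have "Re (fourier_mode (\<lambda>x. g x * g x) 0) \<le> 0"
  proof (rule field_le_epsilon)
    fix e :: real assume e: "0 < e"
    define d where "d = e / (B + 1)"
    have d: "0 < d" "d * B \<le> e" using e B0 by (auto simp: d_def field_simps)
    obtain p where p: "real_polynomial_function p" "\<And>z. z \<in> sphere 0 1 \<Longrightarrow> \<bar>G z - p z\<bar> < d"
      using Stone_Weierstrass_real_polynomial_function[OF compact_sphere G(1) d(1)] by metis
    have pc: "continuous_on {0..2*pi} (\<lambda>x. p (cis x) * g x)"
      using p(1) gc
      by (intro continuous_intros continuous_on_compose2[OF continuous_on_polymonial_function[of p UNIV]])
        (auto simp: real_polynomial_function_eq)
    have "fourier_mode (\<lambda>x. g x * g x) 0 = fourier_mode (\<lambda>x. g x * g x - p (cis x) * g x) 0"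
      using fourier_mode_diff[OF _ pc, of "\<lambda>x. g x * g x" 0] gc
        fourier_mode_mult_polynomial_zero[OF p(1) gc z] by (simp add: continuous_intros)
    also have "cmod \<dots> \<le> d * B"
    proof (rule norm_fourier_mode_le)
      show "continuous_on {0..2*pi} (\<lambda>x. g x * g x - p (cis x) * g x)"
        using gc by (intro continuous_on_diff pc continuous_on_mult)
      show "\<bar>g x * g x - p (cis x) * g x\<bar> \<le> d * B" if "x \<in> {0..2*pi}" for x
      proof -
        have "\<bar>g x * g x - p (cis x) * g x\<bar> = \<bar>G (cis x) - p (cis x)\<bar> * \<bar>g x\<bar>"
          by (subst abs_mult[symmetric]) (simp add: G(2) left_diff_distrib)
        also have "\<dots> \<le> d * B" using p(2)[of "cis x"] B[OF that] d by (intro mult_mono) auto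
        finally show ?thesis .
      qed
    qed
    finally have "cmod (fourier_mode (\<lambda>x. g x * g x) 0) \<le> e" using d by simp
    then show "Re (fourier_mode (\<lambda>x. g x * g x) 0) \<le> 0 + e"
      using complex_Re_le_cmod[of "fourier_mode (\<lambda>x. g x * g x) 0"] by linarith
  qed
  then have "integral {0..2*pi} (\<lambda>x. g x * g x) \<le> 0"
    using gg pi_gt_zero by (simp add: fourier_mode_0 divide_le_0_iff)
  moreover have "0 \<le> integral {0..2*pi} (\<lambda>x. g x * g x)"
    by (rule Henstock_Kurzweil_Integration.integral_nonneg) (use gg in \<open>auto intro: integrable_continuous_interval\<close>)
  ultimately have "integral {0..2*pi} (\<lambda>x. g x * g x) = 0" by simp
  then have "\<forall>x\<in>{0..2*pi}. g x * g x = 0"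
    using integral_eq_0_iff[OF gg] by simp
  moreover obtain y where "y \<in> {0..2*pi}" "g y = g x" using periodic_2pi_reduce[OF per] by metis
  ultimately show ?thesis by auto
qed

lemma fourier_mode_deriv:
  assumes g': "\<And>x. (g has_real_derivative g' x) (at x)" and "continuous_on UNIV g'" and per: "periodic_2pi g"
  shows "fourier_mode g' k = \<i> * of_int k * fourier_mode g k"
proof -
  have gc: "continuous_on {0..2*pi} g" using g' by (meson DERIV_isCont continuous_at_imp_continuous_on)
  have gc': "continuous_on {0..2*pi} g'" using assms(2) continuous_on_subset by blast
  have "((\<lambda>x. of_real (g x) * (\<i> * of_real (- of_int k) * cis (- (of_int k * x))) + of_real (g' x) * cis (- (of_int k * x)))
      has_integral of_real (g (2*pi)) * cis (- (of_int k * (2*pi))) - of_real (g 0) * cis (- (of_int k * 0))) {0..2*pi}"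
  proof (rule fundamental_theorem_of_calculus[where f = "\<lambda>x. of_real (g x) * cis (- (of_int k * x))"])
    fix x
    have "((\<lambda>x. complex_of_real (g x)) has_vector_derivative of_real (g' x)) (at x within {0..2*pi})"
      using g'[of x] unfolding has_real_derivative_iff_has_vector_derivative
      by (rule bounded_linear.has_vector_derivative[OF bounded_linear_of_real has_vector_derivative_at_within])
    from has_vector_derivative_mult[OF this cis_has_vector_derivative[of "- of_int k" x]]
    show "((\<lambda>x. of_real (g x) * cis (- (of_int k * x))) has_vector_derivative
        of_real (g x) * (\<i> * of_real (- of_int k) * cis (- (of_int k * x))) + of_real (g' x) * cis (- (of_int k * x)))
        (at x within {0..2*pi})" by simp
  qed simp
  moreover have "cis (- (of_int k * (2*pi))) = 1"
    using cis_multiple_2pi[of "- of_int k"] by (simp add: mult.commute)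
  moreover have "g (2*pi) = g 0" using periodic_2piD[OF per, of 0 1] by simp
  ultimately have "integral {0..2*pi} (\<lambda>x. (- \<i> * of_int k) * (of_real (g x) * cis (- (of_int k * x)))
      + of_real (g' x) * cis (- (of_int k * x))) = 0"
    by (simp add: has_integral_iff mult_ac)
  moreover have "integral {0..2*pi} (\<lambda>x. (- \<i> * of_int k) * (of_real (g x) * cis (- (of_int k * x)))
      + of_real (g' x) * cis (- (of_int k * x))) = (- \<i> * of_int k) * integral {0..2*pi} (\<lambda>x. of_real (g x) * cis (- (of_int k * x)))
      + integral {0..2*pi} (\<lambda>x. of_real (g' x) * cis (- (of_int k * x)))"
    by (subst integral_add)
      (intro integrable_on_mult_right fourier_mode_integrable gc gc', rule fourier_mode_integrable[OF gc'], simp)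
  ultimately show ?thesis by (simp add: fourier_mode_cis mult_ac)
qed

primrec times_differentiable :: "nat \<Rightarrow> (real \<Rightarrow> real) \<Rightarrow> bool" where
  "times_differentiable 0 g \<longleftrightarrow> continuous_on UNIV g"
| "times_differentiable (Suc n) g \<longleftrightarrow>
     (\<exists>g'. (\<forall>x. (g has_real_derivative g' x) (at x)) \<and> times_differentiable n g')"

lemma has_real_derivative_continuous_on:
  assumes "\<And>x. (g has_real_derivative g' x) (at x)"
  shows "continuous_on S g"
  using assms by (meson DERIV_isCont continuous_at_imp_continuous_on)

lemma times_differentiable_SucD: "times_differentiable (Suc n) g \<Longrightarrow> times_differentiable n g"
proof (induction n arbitrary: g)
  case 0
  then show ?case using has_real_derivative_continuous_on by auto
next
  case (Suc n)
  from Suc.prems obtain g' where g': "\<forall>x. (g has_real_derivative g' x) (at x)" "times_differentiable (Suc n) g'"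
    unfolding times_differentiable.simps(2)[of "Suc n"] by blast
  from g'(1) Suc.IH[OF g'(2)] show ?case unfolding times_differentiable.simps(2)[of n] by blast
qed

lemma times_differentiable_mono:
  assumes "times_differentiable n g" "m \<le> n"
  shows "times_differentiable m g"
  using assms(2,1) by (induction rule: inc_induct) (blast dest: times_differentiable_SucD)+

lemma times_differentiable_add:
  "times_differentiable n f \<Longrightarrow> times_differentiable n g \<Longrightarrow> times_differentiable n (\<lambda>x. f x + g x)"
proof (induction n arbitrary: f g)
  case 0
  then show ?case by (simp add: continuous_on_add)
next
  case (Suc n)
  then obtain f' g' where "\<forall>x. (f has_real_derivative f' x) (at x)" "times_differentiable n f'"
    "\<forall>x. (g has_real_derivative g' x) (at x)" "times_differentiable n g'" by auto
  then show ?case using Suc.IH by (auto intro!: exI[of _ "\<lambda>x. f' x + g' x"] DERIV_add)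
qed

lemma times_differentiable_mult:
  "times_differentiable n f \<Longrightarrow> times_differentiable n g \<Longrightarrow> times_differentiable n (\<lambda>x. f x * g x)"
proof (induction n arbitrary: f g)
  case 0
  then show ?case by (simp add: continuous_on_mult)
next
  case (Suc n)
  then obtain f' g' where *: "\<forall>x. (f has_real_derivative f' x) (at x)" "times_differentiable n f'"
    "\<forall>x. (g has_real_derivative g' x) (at x)" "times_differentiable n g'" by auto
  have "times_differentiable n (\<lambda>x. f' x * g x + g' x * f x)"
    using Suc.IH * Suc.prems[THEN times_differentiable_SucD] times_differentiable_add by blast
  moreover have "\<forall>x. ((\<lambda>x. f x * g x) has_real_derivative f' x * g x + g' x * f x) (at x)"
    using * by (auto intro: DERIV_mult)
  ultimately show ?case by auto
qed

lemma times_differentiable_const: "times_differentiable n (\<lambda>x. c)"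
proof (induction n arbitrary: c)
  case (Suc n)
  then show ?case by (auto intro!: exI[of _ "\<lambda>x. 0"])
qed simp

lemma times_differentiable_linear_ode:
  assumes \<phi>: "\<And>x. (\<phi> has_real_derivative w x * \<phi> x) (at x)" and "times_differentiable n w"
  shows "times_differentiable (Suc n) \<phi>"
  using assms(2)
proof (induction n)
  case 0
  have "continuous_on UNIV (\<lambda>x. w x * \<phi> x)"
    using 0 has_real_derivative_continuous_on[OF \<phi>] by (simp add: continuous_on_mult)
  then show ?case using \<phi> by (auto intro!: exI[of _ "\<lambda>x. w x * \<phi> x"])
next
  case (Suc n)
  have "times_differentiable (Suc n) (\<lambda>x. w x * \<phi> x)"
    by (rule times_differentiable_mult[OF Suc.prems Suc.IH[OF times_differentiable_SucD[OF Suc.prems]]])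
  then show ?case unfolding times_differentiable.simps(2)[of "Suc n"]
    by (intro exI[of _ "\<lambda>x. w x * \<phi> x"] conjI allI \<phi>)
qed

lemma C_k_iff_times_differentiable: "C_k n g \<longleftrightarrow> times_differentiable n g"
proof (induction n arbitrary: g)
  case 0
  show ?case by (simp add: C_k_def)
next
  case (Suc n)
  have *: "C_k (Suc n) g \<longleftrightarrow> (\<forall>x. g field_differentiable (at x)) \<and> C_k n (deriv g)"
  proof -
    have "(\<forall>j<Suc n. \<forall>x. (deriv ^^ j) g field_differentiable (at x)) \<longleftrightarrow>
      (\<forall>x. g field_differentiable (at x)) \<and> (\<forall>j<n. \<forall>x. (deriv ^^ j) (deriv g) field_differentiable (at x))"
      by (simp only: All_less_Suc2 funpow_0 funpow_Suc_right o_apply)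
    then show ?thesis by (simp only: C_k_def funpow_Suc_right o_apply) blast
  qed
  show ?case unfolding * Suc.IH times_differentiable.simps
  proof safe
    assume "\<forall>x. g field_differentiable (at x)" "times_differentiable n (deriv g)"
    then show "\<exists>g'. (\<forall>x. (g has_real_derivative g' x) (at x)) \<and> times_differentiable n g'"
      using field_differentiable_derivI by blast
  next
    fix g' assume g': "\<forall>x. (g has_real_derivative g' x) (at x)" "times_differentiable n g'"
    then show "times_differentiable n (deriv g)"
      using DERIV_imp_deriv by (metis ext)
    show "g field_differentiable (at x)" for x using g' field_differentiable_def by blast
  qed
qed

lemma periodic_2pi_deriv:
  assumes g': "\<And>x. (g has_real_derivative g' x) (at x)" and per: "periodic_2pi g"
  shows "periodic_2pi g'"
  unfolding periodic_2pi_def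
proof (intro allI)
  fix x and k :: int
  have "((\<lambda>x. g (x + 2 * of_int k * pi)) has_real_derivative g' (x + 2 * of_int k * pi)) (at x)"
    using g'[of "x + 2 * of_int k * pi"] by (subst (asm) DERIV_shift)
  then have "(g has_real_derivative g' (x + 2 * of_int k * pi)) (at x)"
    by (simp add: periodic_2piD[OF per])
  then show "g' (x + 2 * of_int k * pi) = g' x" using g'[of x] by (rule DERIV_unique)
qed

lemma continuous_periodic_bounded:
  assumes "continuous_on UNIV g" "periodic_2pi g"
  obtains B where "\<And>x. \<bar>g x\<bar> \<le> B"
proof -
  have "continuous_on {0..2*pi} g" using assms(1) continuous_on_subset by blast
  then obtain B where "\<forall>y \<in> g ` {0..2*pi}. \<bar>y\<bar> \<le> B"
    using compact_continuous_image[OF _ compact_Icc, of 0 "2*pi" g, THEN compact_imp_bounded]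
    unfolding bounded_real by blast
  then have "\<bar>g x\<bar> \<le> B" for x
    using periodic_2pi_reduce[OF assms(2), of x] by (metis imageI)
  then show ?thesis by (rule that)
qed

lemma continuous_periodic_attains_inf:
  assumes "continuous_on UNIV g" "periodic_2pi g"
  obtains x0 :: real where "\<And>x. (g x0 :: real) \<le> g x"
proof -
  have "continuous_on {0..2*pi} g" using assms(1) continuous_on_subset by blast
  then have "\<exists>x0\<in>{0..2*pi}. \<forall>x\<in>{0..2*pi}. g x0 \<le> g x"
    by (intro continuous_attains_inf) auto
  then obtain x0 where "\<forall>x\<in>{0..2*pi}. g x0 \<le> g x" by blast
  then have "g x0 \<le> g x" for x
    using periodic_2pi_reduce[OF assms(2), of x] by metis
  then show ?thesis by (rule that)
qed

lemma times_differentiable_fourier_mode_bound: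
  assumes "times_differentiable p g" "periodic_2pi g"
  shows "\<exists>B. \<forall>k. cmod (fourier_mode g k) * \<bar>real_of_int k\<bar> ^ p \<le> B"
  using assms
proof (induction p arbitrary: g)
  case 0
  then obtain B where B: "\<And>x. \<bar>g x\<bar> \<le> B" using continuous_periodic_bounded by auto
  have "continuous_on {0..2*pi} g" using 0 continuous_on_subset[of UNIV g] by simp
  from norm_fourier_mode_le[OF this B] show ?case by auto
next
  case (Suc p)
  then obtain g' where g': "\<And>x. (g has_real_derivative g' x) (at x)" "times_differentiable p g'" by auto
  have "continuous_on UNIV g'" using times_differentiable_mono[OF g'(2), of 0] by simp
  then have *: "cmod (fourier_mode g k) * \<bar>real_of_int k\<bar> ^ Suc p = cmod (fourier_mode g' k) * \<bar>real_of_int k\<bar> ^ p" for k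
    using fourier_mode_deriv[OF g'(1) _ Suc.prems(2), of k] by (simp add: norm_mult)
  show ?case unfolding * by (rule Suc.IH[OF g'(2) periodic_2pi_deriv[OF g'(1) Suc.prems(2)]])
qed

lemma times_differentiable_decays:
  assumes "times_differentiable p g" "periodic_2pi g"
  obtains B where "decays p B (fourier_mode g)"
proof -
  obtain B where B: "\<And>k. cmod (fourier_mode g k) * \<bar>real_of_int k\<bar> ^ p \<le> B"
    using times_differentiable_fourier_mode_bound[OF assms] by auto
  have B0: "0 \<le> B" using order_trans[OF _ B[of 0]] by simp
  have "decays p (cmod (fourier_mode g 0) + 2 ^ p * B) (fourier_mode g)"
    unfolding decays_def
  proof
    fix k
    show "cmod (fourier_mode g k) * (1 + \<bar>real_of_int k\<bar>) ^ p \<le> cmod (fourier_mode g 0) + 2 ^ p * B"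
    proof (cases "k = 0")
      case False
      then have "1 \<le> \<bar>k\<bar>" by simp
      then have "1 \<le> \<bar>real_of_int k\<bar>" by linarith
      then have "(1 + \<bar>real_of_int k\<bar>) ^ p \<le> (2 * \<bar>real_of_int k\<bar>) ^ p" by (intro power_mono) auto
      then have "cmod (fourier_mode g k) * (1 + \<bar>real_of_int k\<bar>) ^ p
          \<le> cmod (fourier_mode g k) * (2 * \<bar>real_of_int k\<bar>) ^ p" by (rule mult_left_mono) simp
      also have "\<dots> = 2 ^ p * (cmod (fourier_mode g k) * \<bar>real_of_int k\<bar> ^ p)" by (simp add: power_mult_distrib)
      also have "\<dots> \<le> 2 ^ p * B" by (rule mult_left_mono[OF B]) simp
      finally show ?thesis by (simp add: add_increasing)
    qed (use B0 in simp)
  qed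
  then show ?thesis by (rule that)
qed

lemma fourier_mode_uminus: 
  assumes "continuous_on {0..2*pi} v"
  shows "fourier_mode v (- k) = cnj (fourier_mode v k)"
proof -
  have "integral {0..2*pi} (cnj \<circ> (\<lambda>x. of_real (v x) * cis (- (of_int k * x))))
      = cnj (integral {0..2*pi} (\<lambda>x. of_real (v x) * cis (- (of_int k * x))))"
    by (rule integral_linear[OF fourier_mode_integrable[OF assms] bounded_linear_cnj])
  then show ?thesis by (simp add: fourier_mode_cis o_def cis_cnj)
qed

lemma periodic_trig_series: "trig_series c (x + 2 * of_int m * pi) = trig_series c x"
proof -
  have "cis (of_int k * (x + 2 * of_int m * pi)) = cis (of_int k * x)" for k
  proof -
    have "cis (of_int k * (x + 2 * of_int m * pi)) = cis (of_int k * x) * cis (2 * pi * of_int (k * m))"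
      by (simp add: cis_mult algebra_simps)
    then show ?thesis using cis_multiple_2pi[of "of_int (k * m)"] by simp
  qed
  then show ?thesis by (simp add: trig_series_def)
qed

lemma continuous_on_trig_series_space:
  assumes "decays 2 B c"
  shows "continuous_on UNIV (trig_series c)"
proof -
  have "continuous_on (UNIV \<times> {0::real}) (\<lambda>(x, t). trig_series c x)"
    by (rule continuous_on_trig_series) (use assms in auto)
  then have "continuous_on UNIV ((\<lambda>(x, t). trig_series c x) \<circ> (\<lambda>x. (x, 0::real)))"
    by (intro continuous_on_compose continuous_intros) (auto elim: continuous_on_subset)
  then show ?thesis by (simp add: o_def)
qed

lemma fourier_expansion:
  assumes g: "times_differentiable 2 g" and per: "periodic_2pi g"
  shows "complex_of_real (g x) = trig_series (fourier_mode g) x"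
proof -
  obtain B where B: "decays 2 B (fourier_mode g)" using times_differentiable_decays[OF assms] .
  have gc: "continuous_on UNIV g" using times_differentiable_mono[OF g, of 0] by simp
  then have gc': "continuous_on {0..2*pi} g" using continuous_on_subset by blast
  define h where "h x = Re (trig_series (fourier_mode g) x)" for x
  have h: "complex_of_real (h x) = trig_series (fourier_mode g) x" for x
    using trig_series_cnj[of "fourier_mode g" x] fourier_mode_uminus[OF gc']
    by (simp add: h_def complex_eq_iff)
  have hc: "continuous_on UNIV h"
    unfolding h_def by (intro continuous_intros continuous_on_trig_series_space[OF B])
  then have hc': "continuous_on {0..2*pi} h" using continuous_on_subset by blast
  have "g x - h x = 0"
  proof (rule fourier_mode_unique[where g = "\<lambda>x. g x - h x"])
    show "continuous_on UNIV (\<lambda>x. g x - h x)" by (intro continuous_on_diff gc hc)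
    show "periodic_2pi (\<lambda>x. g x - h x)"
      using periodic_2piD[OF per] by (simp add: periodic_2pi_def h_def periodic_trig_series)
    show "fourier_mode (\<lambda>x. g x - h x) k = 0" for k
      using fourier_mode_trig_series[OF decays_abs_summable(3)[OF B] h] by (simp add: fourier_mode_diff[OF gc' hc'])
  qed
  then show ?thesis using h by simp
qed

section \<open>Damped equations and the maximum principle\<close>

lemma exp_has_vector_derivative:
  "((\<lambda>t. exp (\<mu> * of_real (t - a))) has_vector_derivative \<mu> * exp (\<mu> * of_real (t - a)))
     (at t within S)" for \<mu> :: complex
proof -
  have "((\<lambda>z. exp (\<mu> * (z - of_real a))) has_field_derivative \<mu> * exp (\<mu> * (of_real t - of_real a)))
      (at (of_real t))"
    by (auto intro!: derivative_eq_intros)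
  from has_vector_derivative_real_field[OF this] show ?thesis by simp
qed

lemma damped_ode_bound:
  fixes z g :: "real \<Rightarrow> complex"
  assumes ab: "a \<le> b" and mu: "0 < Re \<mu>"
    and z': "\<And>t. t \<in> {a..b} \<Longrightarrow> (z has_vector_derivative g t - \<mu> * z t) (at t within {a..b})"
    and g: "\<And>t. t \<in> {a..b} \<Longrightarrow> cmod (g t) \<le> G"
  shows "cmod (z b) \<le> exp (- Re \<mu> * (b - a)) * cmod (z a) + G / Re \<mu>"
proof (cases "a = b")
  case True
  have "0 \<le> G" using order_trans[OF norm_ge_zero g[of a]] ab by simp
  then show ?thesis using True mu by simp
next
  case False
  with ab have ab: "a < b" by simp
  have G0: "0 \<le> G" using order_trans[OF norm_ge_zero g[of a]] ab by simp
  define w where "w t = exp (\<mu> * of_real (t - a)) * z t" for t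
  have w': "(w has_vector_derivative exp (\<mu> * of_real (t - a)) * g t) (at t within {a..b})"
    if "t \<in> {a..b}" for t
  proof -
    have "((\<lambda>t. exp (\<mu> * of_real (t - a))) has_vector_derivative \<mu> * exp (\<mu> * of_real (t - a)))
            (at t within {a..b})"
      by (rule exp_has_vector_derivative)
    from has_vector_derivative_mult[OF this z'[OF that]]
    show ?thesis unfolding w_def by (simp add: algebra_simps)
  qed
  have "norm (w b - w a) \<le> G / Re \<mu> * exp (Re \<mu> * (b - a)) - G / Re \<mu> * exp (Re \<mu> * (a - a))"
  proof (rule differentiable_bound_general[OF ab, where f' = "\<lambda>t. exp (\<mu> * of_real (t - a)) * g t"
        and \<phi>' = "\<lambda>t. G * exp (Re \<mu> * (t - a))"])
    show "continuous_on {a..b} w"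
      using w' by (meson continuous_on_eq_continuous_within has_vector_derivative_continuous)
    show "continuous_on {a..b} (\<lambda>t. G / Re \<mu> * exp (Re \<mu> * (t - a)))"
      by (intro continuous_intros)
    show "(w has_vector_derivative exp (\<mu> * of_real (t - a)) * g t) (at t)" if "a < t" "t < b" for t
      using w'[of t] that by (simp add: at_within_Icc_at)
    show "((\<lambda>t. G / Re \<mu> * exp (Re \<mu> * (t - a))) has_vector_derivative G * exp (Re \<mu> * (t - a))) (at t)"
      for t
      using mu by (auto intro!: derivative_eq_intros
          simp: has_real_derivative_iff_has_vector_derivative[symmetric])
    show "norm (exp (\<mu> * of_real (t - a)) * g t) \<le> G * exp (Re \<mu> * (t - a))" if "a < t" "t < b" for t
      using g[of t] that by (simp add: norm_mult mult.commute)
  qed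
  also have "\<dots> \<le> G / Re \<mu> * exp (Re \<mu> * (b - a))" using G0 mu by simp
  finally have "norm (w b) \<le> norm (w a) + G / Re \<mu> * exp (Re \<mu> * (b - a))"
    using norm_triangle_ineq2[of "w b" "w a"] by linarith
  then have "exp (Re \<mu> * (b - a)) * cmod (z b) \<le> cmod (z a) + G / Re \<mu> * exp (Re \<mu> * (b - a))"
    by (simp add: w_def norm_mult)
  then have "exp (- Re \<mu> * (b - a)) * (exp (Re \<mu> * (b - a)) * cmod (z b))
      \<le> exp (- Re \<mu> * (b - a)) * (cmod (z a) + G / Re \<mu> * exp (Re \<mu> * (b - a)))"
    by (intro mult_left_mono) auto
  then show ?thesis by (simp add: distrib_left field_simps mult_exp_exp)
qed

lemma second_derivative_at_max:
  fixes h h' :: "real \<Rightarrow> real"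
  assumes h: "\<And>y. (h has_real_derivative h' y) (at y)"
    and h2: "(h' has_real_derivative D) (at x)"
    and max: "\<And>y. h y \<le> h x"
  shows "h' x = 0" "D \<le> 0"
proof -
  show 0: "h' x = 0"
    using DERIV_local_max[OF h[of x], of 1] max by auto
  show "D \<le> 0"
  proof (rule ccontr)
    assume "\<not> D \<le> 0"
    then obtain d where d: "d > 0" "\<And>e. 0 < e \<Longrightarrow> e < d \<Longrightarrow> h' x < h' (x + e)"
      using DERIV_pos_inc_right[OF h2] by auto
    have "h x < h (x + d/2)"
    proof (rule DERIV_pos_imp_increasing_open[where f = h])
      show "x < x + d/2" using d by simp
      show "\<exists>y. (h has_real_derivative y) (at u) \<and> 0 < y" if "x < u" "u < x + d/2" for u
        using d(2)[of "u - x"] d(1) that h[of u] 0 by (intro exI[of _ "h' u"]) simp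
      show "continuous_on {x..x + d/2} h"
        using h by (meson DERIV_isCont continuous_at_imp_continuous_on)
    qed
    then show False using max[of "x + d/2"] by simp
  qed
qed

text \<open>The factor \<open>exp (-(Q + 1) t)\<close> turns the zeroth-order coefficient negative, so that a positive
  maximum contradicts the differential inequality.\<close>

lemma periodic_max_principle:
  fixes z zt zx zxx b q :: "real \<Rightarrow> real \<Rightarrow> real"
  assumes T: "0 \<le> T"
    and cont: "continuous_on (UNIV \<times> {0..T}) (\<lambda>(x, t). z x t)"
    and per: "\<And>t. t \<in> {0..T} \<Longrightarrow> periodic_2pi (\<lambda>x. z x t)"
    and zt: "\<And>x t. t \<in> {0..T} \<Longrightarrow> ((\<lambda>s. z x s) has_real_derivative zt x t) (at t within {0..T})"
    and zx: "\<And>x t. t \<in> {0..T} \<Longrightarrow> ((\<lambda>y. z y t) has_real_derivative zx x t) (at x)"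
    and zxx: "\<And>x t. t \<in> {0..T} \<Longrightarrow> ((\<lambda>y. zx y t) has_real_derivative zxx x t) (at x)"
    and nu: "0 \<le> \<nu>"
    and ineq: "\<And>x t. x \<in> {0..2*pi} \<Longrightarrow> t \<in> {0..T} \<Longrightarrow>
                  zt x t \<le> \<nu> * zxx x t + b x t * zx x t + q x t * z x t"
    and q: "\<And>x t. x \<in> {0..2*pi} \<Longrightarrow> t \<in> {0..T} \<Longrightarrow> q x t \<le> Q"
    and init: "\<And>x. z x 0 \<le> 0"
    and t: "t \<in> {0..T}"
  shows "z x t \<le> 0"
proof -
  define E where "E = (\<lambda>t. exp (- (Q + 1) * t))"
  have Epos: "E t > 0" for t by (simp add: E_def)
  have E': "(E has_real_derivative - (Q + 1) * E t) (at t within S)" for t S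
    unfolding E_def by (auto intro!: derivative_eq_intros)
  let ?K = "{0..2*pi} \<times> {0..T}"
  have "continuous_on ?K (\<lambda>p. E (snd p) * (\<lambda>(x, t). z x t) p)"
    using continuous_on_subset[OF cont, of ?K] by (auto simp: E_def intro!: continuous_intros)
  moreover have "compact ?K" by (intro compact_Times compact_Icc)
  moreover have "?K \<noteq> {}" using T by simp
  ultimately have "\<exists>p\<in>?K. \<forall>r\<in>?K. E (snd r) * (\<lambda>(x, t). z x t) r \<le> E (snd p) * (\<lambda>(x, t). z x t) p"
    by (intro continuous_attains_sup)
  then obtain p where p: "p \<in> ?K"
    "\<And>r. r \<in> ?K \<Longrightarrow> E (snd r) * (\<lambda>(x, t). z x t) r \<le> E (snd p) * (\<lambda>(x, t). z x t) p"
    by blast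
  obtain x1 t1 where p12: "p = (x1, t1)" by (cases p)
  have x1: "x1 \<in> {0..2*pi}" and t1: "t1 \<in> {0..T}" using p(1) p12 by auto
  have mx: "E s * z y s \<le> E t1 * z x1 t1" if s: "s \<in> {0..T}" for y s
  proof -
    obtain y' where "y' \<in> {0..2*pi}" "z y' s = z y s"
      using periodic_2pi_reduce[OF per[OF s], of y] by metis
    then show ?thesis using p(2)[of "(y', s)"] s p12 by auto
  qed
  have "z x1 t1 \<le> 0"
  proof (rule ccontr)
    assume pos: "\<not> z x1 t1 \<le> 0"
    then have t1': "0 < t1" using init[of x1] t1 by (cases "t1 = 0") auto
    have mxx: "z y t1 \<le> z x1 t1" for y using mx[OF t1, of y] Epos[of t1] by simp
    have d: "zx x1 t1 = 0" "zxx x1 t1 \<le> 0"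
      using second_derivative_at_max[of "\<lambda>y. z y t1" "\<lambda>y. zx y t1" _ x1, OF zx[OF t1] zxx[OF t1] mxx]
      by auto
    have dE: "((\<lambda>s. E s * z x1 s) has_real_derivative
        - (Q + 1) * E t1 * z x1 t1 + zt x1 t1 * E t1) (at t1 within {0..T})"
      by (rule DERIV_mult[OF E' zt[OF t1]])
    have "0 \<le> - (Q + 1) * E t1 * z x1 t1 + zt x1 t1 * E t1"
    proof (rule ccontr)
      assume "\<not> ?thesis"
      then obtain d where d: "d > 0"
        "\<And>h. 0 < h \<Longrightarrow> t1 - h \<in> {0..T} \<Longrightarrow> h < d \<Longrightarrow> E t1 * z x1 t1 < E (t1 - h) * z x1 (t1 - h)"
        using has_real_derivative_neg_dec_left[OF dE] by auto
      define h where "h = min (d/2) t1"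
      have "0 < h" "h < d" "t1 - h \<in> {0..T}" using d(1) t1' t1 by (auto simp: h_def)
      then show False using d(2)[of h] mx[of "t1 - h" x1] by auto
    qed
    then have "0 \<le> E t1 * (zt x1 t1 - (Q + 1) * z x1 t1)" by (simp add: algebra_simps)
    then have "(Q + 1) * z x1 t1 \<le> zt x1 t1" using Epos[of t1] by (simp add: zero_le_mult_iff)
    also have "\<dots> \<le> q x1 t1 * z x1 t1"
      using ineq[OF x1 t1] d mult_nonneg_nonpos[OF nu d(2)] by simp
    also have "\<dots> \<le> Q * z x1 t1" using q[OF x1 t1] pos by (intro mult_right_mono) auto
    finally show False using pos by (simp add: algebra_simps)
  qed
  then have "E t * z x t \<le> 0"
    using mx[OF t, of x] mult_nonneg_nonpos[of "E t1" "z x1 t1"] Epos[of t1] by linarith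
  then show ?thesis using Epos[of t] by (simp add: mult_le_0_iff)
qed

section \<open>The linear evolution of the modes\<close>

text \<open>Only the modes of index at most 3 of the potential are nonzero, whence the summation range.\<close>

definition pot_conv :: "(int \<Rightarrow> complex) \<Rightarrow> (int \<Rightarrow> complex) \<Rightarrow> int \<Rightarrow> complex" where
  "pot_conv V y k = (\<Sum>j\<in>{-3..3}. V j * y (k - j))"

definition pot_norm :: "(int \<Rightarrow> complex) \<Rightarrow> real" where
  "pot_norm V = (\<Sum>j\<in>{-3..3}. cmod (V j))"

definition symbol :: "real \<Rightarrow> real \<Rightarrow> int \<Rightarrow> complex" where
  "symbol \<nu> c k = of_real (\<nu> * (of_int k)\<^sup>2) + \<i> * of_real (c * of_int k)"

lemma pot_norm_nonneg: "0 \<le> pot_norm V"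
  by (simp add: pot_norm_def sum_nonneg)

lemma norm_pot_conv_le:
  assumes "\<And>j. j \<in> {-3..3} \<Longrightarrow> cmod (y (k - j)) \<le> D"
  shows "cmod (pot_conv V y k) \<le> pot_norm V * D"
proof -
  have "cmod (pot_conv V y k) \<le> (\<Sum>j\<in>{-3..3}. cmod (V j) * D)"
    unfolding pot_conv_def
    by (intro sum_norm_le) (simp add: norm_mult mult_left_mono assms)
  then show ?thesis by (simp add: pot_norm_def sum_distrib_right)
qed

lemma pot_conv_diff: "pot_conv V (\<lambda>k. x k - y k) k = pot_conv V x k - pot_conv V y k"
  by (simp add: pot_conv_def right_diff_distrib sum_subtractf)

lemma pot_conv_mult: "pot_conv V (\<lambda>k. a * y k) k = a * pot_conv V y k"
  by (simp add: pot_conv_def sum_distrib_left mult.left_commute)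

lemma weight_shift:
  fixes k j :: int
  assumes "j \<in> {-3..3}"
  shows "1 + \<bar>real_of_int k\<bar> \<le> 4 * (1 + \<bar>real_of_int (k - j)\<bar>)"
proof -
  have "\<bar>k\<bar> \<le> \<bar>k - j\<bar> + 3" using assms by auto
  then have "\<bar>real_of_int k\<bar> \<le> \<bar>real_of_int (k - j)\<bar> + 3" by linarith
  then show ?thesis by (smt (verit))
qed

lemma decays_pot_conv:
  assumes "decays p B y"
  shows "decays p (pot_norm V * (4 ^ p * B)) (pot_conv V y)"
  unfolding decays_def
proof
  fix k
  define w where "w = (1 + \<bar>real_of_int k\<bar>) ^ p"
  have w: "0 < w" by (simp add: w_def add_pos_nonneg)
  have "cmod (pot_conv V y k) \<le> pot_norm V * (4 ^ p * B / w)"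
  proof (rule norm_pot_conv_le)
    fix j :: int assume "j \<in> {-3..3}"
    then have "w \<le> (4 * (1 + \<bar>real_of_int (k - j)\<bar>)) ^ p"
      unfolding w_def by (intro power_mono weight_shift) auto
    then have "cmod (y (k - j)) * w \<le> cmod (y (k - j)) * (4 ^ p * (1 + \<bar>real_of_int (k - j)\<bar>) ^ p)"
      unfolding power_mult_distrib by (rule mult_left_mono) simp
    also have "\<dots> = 4 ^ p * (cmod (y (k - j)) * (1 + \<bar>real_of_int (k - j)\<bar>) ^ p)" by simp
    also have "\<dots> \<le> 4 ^ p * B" by (rule mult_left_mono[OF decaysD[OF assms]]) simp
    finally show "cmod (y (k - j)) \<le> 4 ^ p * B / w" using w by (simp add: pos_le_divide_eq)
  qed
  then show "cmod (pot_conv V y k) * (1 + \<bar>real_of_int k\<bar>) ^ p \<le> pot_norm V * (4 ^ p * B)"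
    using w by (simp add: w_def[symmetric] pos_le_divide_eq)
qed

lemma sup_contraction_fixpoint:
  fixes F :: "('a \<Rightarrow> 'b::banach) \<Rightarrow> 'a \<Rightarrow> 'b"
  assumes q: "0 \<le> q" "q < 1" and P0: "P init" and PF: "\<And>f. P f \<Longrightarrow> P (F f)"
    and closed: "\<And>f g. (\<And>n. P (f n)) \<Longrightarrow> uniform_limit UNIV f g sequentially \<Longrightarrow> P g"
    and contr: "\<And>f g D x. P f \<Longrightarrow> P g \<Longrightarrow> (\<And>x. norm (f x - g x) \<le> D) \<Longrightarrow> norm (F f x - F g x) \<le> q * D"
    and C: "\<And>x. norm (F init x - init x) \<le> C"
  obtains f where "P f" "F f = f"
proof -
  define f where "f n = (F ^^ n) init" for n
  have f_0: "f 0 = init" by (simp add: f_def)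
  have Pf: "P (f n)" for n by (induction n) (auto simp: f_def P0 PF)
  have step: "norm (f (Suc n) x - f n x) \<le> q ^ n * C" for n x
  proof (induction n arbitrary: x)
    case (Suc n)
    have "norm (F (f (Suc n)) x - F (f n) x) \<le> q * (q ^ n * C)" by (rule contr[OF Pf Pf Suc.IH])
    then show ?case by (simp add: f_def mult.assoc)
  qed (simp add: f_def C)
  have tele: "init x + (\<Sum>i<n. f (Suc i) x - f i x) = f n x" for n x
    using sum_lessThan_telescope[of "\<lambda>i. f i x" n] by (simp add: f_0)
  define g where "g x = init x + (\<Sum>i. f (Suc i) x - f i x)" for x
  have "uniform_limit UNIV (\<lambda>n x. \<Sum>i<n. f (Suc i) x - f i x) (\<lambda>x. \<Sum>i. f (Suc i) x - f i x) sequentially"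
    by (rule Weierstrass_m_test[OF step]) (use q in \<open>auto intro!: summable_mult2 summable_geometric\<close>)
  from uniform_limit_add[OF uniform_limit_const[of init] this]
  have lim: "uniform_limit UNIV f g sequentially" by (simp only: tele g_def[abs_def])
  have Pg: "P g" by (rule closed[OF Pf lim])
  have "norm (F g x - g x) \<le> e" if "e > 0" for e x
  proof -
    have "e / 2 > 0" using that by simp
    from uniform_limitD[OF lim this] obtain N where N: "\<And>n x. n \<ge> N \<Longrightarrow> dist (f n x) (g x) < e/2"
      by (auto simp: eventually_sequentially)
    have "norm (F g x - F (f N) x) \<le> q * (e/2)"
    proof (rule contr[OF Pg Pf])
      show "norm (g x - f N x) \<le> e/2" for x using N[of N x] by (simp add: dist_norm norm_minus_commute)
    qed
    also have "\<dots> \<le> 1 * (e/2)" using q that by (intro mult_right_mono) auto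
    finally have "norm (F g x - f (Suc N) x) \<le> e/2" by (simp add: f_def)
    moreover have "norm (f (Suc N) x - g x) \<le> e/2" using N[of "Suc N" x] by (simp add: dist_norm)
    ultimately show ?thesis
      using norm_triangle_ineq[of "F g x - f (Suc N) x" "f (Suc N) x - g x"] by simp
  qed
  then have "norm (F g x - g x) \<le> 0" for x by (rule field_le_epsilon) simp
  then have "F g = g" by (simp add: fun_eq_iff)
  then show ?thesis using Pg that by blast
qed

definition duhamel :: "complex \<Rightarrow> complex \<Rightarrow> (real \<Rightarrow> complex) \<Rightarrow> real \<Rightarrow> complex" where
  "duhamel \<mu> z0 g t = exp (- \<mu> * of_real t) * (z0 + integral {0..t} (\<lambda>s. exp (\<mu> * of_real s) * g s))"

lemma duhamel_0: "duhamel \<mu> z0 g 0 = z0"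
  by (simp add: duhamel_def)

lemma duhamel_has_vector_derivative:
  assumes g: "continuous_on UNIV g" and t: "0 \<le> t"
  shows "(duhamel \<mu> z0 g has_vector_derivative g t - \<mu> * duhamel \<mu> z0 g t) (at t within {0..b})"
proof (cases "t \<le> b")
  case True
  have "continuous_on {0..b} (\<lambda>s. exp (\<mu> * of_real s) * g s)"
    by (intro continuous_intros continuous_on_subset[OF g]) auto
  from integral_has_vector_derivative[OF this, of t]
  have 1: "((\<lambda>u. z0 + integral {0..u} (\<lambda>s. exp (\<mu> * of_real s) * g s)) has_vector_derivative
      exp (\<mu> * of_real t) * g t) (at t within {0..b})"
    using t True has_vector_derivative_add[OF has_vector_derivative_const] by fastforce
  have 2: "((\<lambda>t. exp (- \<mu> * of_real t)) has_vector_derivative - \<mu> * exp (- \<mu> * of_real t)) (at t within {0..b})"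
    using exp_has_vector_derivative[of "- \<mu>" 0] by simp
  have "exp (- (\<mu> * of_real t)) * (exp (\<mu> * of_real t) * g t) = g t"
    by (simp add: exp_minus)
  then show ?thesis
    using has_vector_derivative_mult[OF 2 1] unfolding duhamel_def[abs_def]
    by (simp only: mult_minus_left mult.assoc) (simp only: diff_conv_add_uminus mult_minus_left)
next
  case False
  then have "at t within {0..b} = bot" by (intro not_in_closure_trivial_limitI) auto
  then show ?thesis by (simp add: has_vector_derivative_def has_derivative_def bounded_linear_scaleR_left)
qed

lemma norm_duhamel_le:
  assumes "continuous_on UNIV g" "0 \<le> t" "0 < Re \<mu>" "\<And>s. 0 \<le> s \<Longrightarrow> cmod (g s) \<le> G"
  shows "cmod (duhamel \<mu> z0 g t) \<le> cmod z0 + G / Re \<mu>"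
proof -
  have "cmod (duhamel \<mu> z0 g t) \<le> exp (- Re \<mu> * (t - 0)) * cmod (duhamel \<mu> z0 g 0) + G / Re \<mu>"
    by (rule damped_ode_bound[where g = g])
      (use assms in \<open>auto intro: duhamel_has_vector_derivative\<close>)
  also have "exp (- Re \<mu> * (t - 0)) * cmod (duhamel \<mu> z0 g 0) \<le> 1 * cmod z0"
    using assms by (intro mult_mono) (auto simp: duhamel_0)
  finally show ?thesis by simp
qed

lemma duhamel_diff:
  assumes "continuous_on UNIV g" "continuous_on UNIV h"
  shows "duhamel \<mu> z0 g t - duhamel \<mu> z0 h t = duhamel \<mu> 0 (\<lambda>s. g s - h s) t"
proof -
  have "integral {0..t} (\<lambda>s. exp (\<mu> * of_real s) * (g s - h s))
      = integral {0..t} (\<lambda>s. exp (\<mu> * of_real s) * g s) - integral {0..t} (\<lambda>s. exp (\<mu> * of_real s) * h s)"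
    unfolding right_diff_distrib
    by (intro integral_diff integrable_continuous_interval continuous_intros continuous_on_subset[OF assms(1)]
        continuous_on_subset[OF assms(2)]) auto
  then show ?thesis unfolding duhamel_def by (simp only:) (simp add: algebra_simps)
qed

text \<open>Existence is a fixed point of Duhamel's formula for the modes weighted by \<open>(1 + \<bar>k\<bar>)\<^sup>5\<close>. Damping
  the equation by a large \<open>K\<close>, which does not affect the Cole-Hopf quotient, makes the map a contraction
  for the supremum over all modes and all times at once.\<close>

lemma linear_evolution_exists:
  assumes nu: "0 \<le> \<nu>" and init: "decays 5 B y0" and K: "0 < K" "2 * 4 ^ 5 * pot_norm V \<le> K"
  obtains y N where "y 0 = y0" "\<And>t. 0 \<le> t \<Longrightarrow> decays 5 N (y t)"
    "\<And>k t. 0 \<le> t \<Longrightarrow> ((\<lambda>s. y s k) has_vector_derivative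
        pot_conv V (y t) k - (symbol \<nu> c k + of_real K) * y t k) (at t within {0..})"
proof -
  define W where "W k = (1 + \<bar>real_of_int k\<bar>) ^ 5" for k :: int
  have Wpos: "0 < W k" for k by (simp add: W_def add_pos_nonneg)
  have Wratio: "W k / W (k - j) \<le> 4 ^ 5" if "j \<in> {-3..3}" for k j
  proof -
    have "W k \<le> (4 * (1 + \<bar>real_of_int (k - j)\<bar>)) ^ 5"
      unfolding W_def by (rule power_mono[OF weight_shift[OF that]]) simp
    also have "\<dots> = 4 ^ 5 * W (k - j)" unfolding W_def by (rule power_mult_distrib)
    finally show ?thesis using Wpos[of "k - j"] by (simp only: pos_divide_le_eq)
  qed
  define A where "A = 4 ^ 5 * pot_norm V"
  have A0: "0 \<le> A" by (simp add: A_def pot_norm_nonneg)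
  have AK: "A / K \<le> 1/2" using K by (simp add: A_def field_simps)
  define \<mu> where "\<mu> k = symbol \<nu> c k + of_real K" for k
  have mu: "K \<le> Re (\<mu> k)" for k using nu by (simp add: \<mu>_def symbol_def)
  have mupos: "0 < Re (\<mu> k)" for k using mu[of k] K by linarith
  define g where "g \<eta> k s = (\<Sum>j\<in>{-3..3}. V j * of_real (W k / W (k - j)) * \<eta> (k - j, s))"
    for \<eta> :: "int \<times> real \<Rightarrow> complex" and k s
  define P where "P \<eta> \<longleftrightarrow> (\<forall>k. continuous_on UNIV (\<lambda>s. \<eta> (k, s))) \<and> bounded (range \<eta>)"
    for \<eta> :: "int \<times> real \<Rightarrow> complex"
  have gc: "continuous_on UNIV (g \<eta> k)" if "P \<eta>" for \<eta> k
    using that unfolding g_def[abs_def] P_def by (intro continuous_intros) auto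
  have gb: "cmod (g \<eta> k s - g \<theta> k s) \<le> A * D" if "\<And>p. cmod (\<eta> p - \<theta> p) \<le> D" for \<eta> \<theta> k s D
  proof -
    have D: "0 \<le> D" using order_trans[OF norm_ge_zero that] .
    have "cmod (g \<eta> k s - g \<theta> k s) = cmod (\<Sum>j\<in>{-3..3}. V j * of_real (W k / W (k - j)) *
        (\<eta> (k - j, s) - \<theta> (k - j, s)))"
      by (simp add: g_def sum_subtractf right_diff_distrib)
    also have "\<dots> \<le> (\<Sum>j\<in>{-3..3}. cmod (V j) * 4 ^ 5 * D)"
    proof (rule sum_norm_le)
      fix j :: int assume j: "j \<in> {-3..3}"
      have "cmod (of_real (W k / W (k - j))) \<le> 4 ^ 5"
        using Wratio[OF j, of k] Wpos[of k] Wpos[of "k - j"] by (simp only: norm_of_real) simp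
      then show "cmod (V j * of_real (W k / W (k - j)) * (\<eta> (k - j, s) - \<theta> (k - j, s)))
          \<le> cmod (V j) * 4 ^ 5 * D"
        unfolding norm_mult using that D by (intro mult_mono) auto
    qed
    also have "\<dots> = A * D" by (simp add: A_def pot_norm_def sum_distrib_right sum_distrib_left mult_ac)
    finally show ?thesis .
  qed
  have gb0: "cmod (g \<eta> k s) \<le> A * D" if "\<And>p. cmod (\<eta> p) \<le> D" for \<eta> k s D
    using gb[of \<eta> "\<lambda>_. 0" D k s] that by (simp add: g_def)
  define F where "F \<eta> = (\<lambda>(k, t). duhamel (\<mu> k) (of_real (W k) * y0 k) (g \<eta> k) (max 0 t))" for \<eta>
  have Fb: "cmod (F \<eta> p) \<le> B + A * D / K" if D: "\<And>p. cmod (\<eta> p) \<le> D" and "P \<eta>" for \<eta> D p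
  proof -
    obtain k t where p: "p = (k, t)" by (cases p)
    have D0: "0 \<le> A * D" using A0 order_trans[OF norm_ge_zero D] by simp
    have "cmod (F \<eta> p) \<le> cmod (of_real (W k) * y0 k) + A * D / Re (\<mu> k)"
      unfolding F_def p prod.case by (rule norm_duhamel_le[OF gc[OF that(2)] _ mupos gb0[OF D]]) simp
    also have "cmod (of_real (W k) * y0 k) \<le> B"
      using decaysD[OF init, of k] Wpos[of k] by (simp add: norm_mult W_def[symmetric] mult.commute)
    also have "A * D / Re (\<mu> k) \<le> A * D / K"
      using mu[of k] K D0 by (intro divide_left_mono) auto
    finally show ?thesis by simp
  qed
  have PF: "P (F \<eta>)" if P\<eta>: "P \<eta>" for \<eta>
  proof -
    obtain D where "\<forall>z\<in>range \<eta>. cmod z \<le> D"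
      using P\<eta> unfolding P_def bounded_iff by blast
    then have "cmod (\<eta> p) \<le> D" for p by blast
    from Fb[OF this P\<eta>] have "bounded (range (F \<eta>))" by (auto simp: bounded_iff)
    moreover have "continuous_on UNIV (\<lambda>t. F \<eta> (k, t))" for k
    proof -
      have "continuous_on {0..} (duhamel (\<mu> k) (of_real (W k) * y0 k) (g \<eta> k))"
        unfolding continuous_on_eq_continuous_within
      proof
        fix t :: real assume t: "t \<in> {0..}"
        have at: "at t within {0..} = at t within {0..t + 1}"
          by (rule at_within_nhd[of _ "{..<t+1}"]) auto
        show "continuous (at t within {0..}) (duhamel (\<mu> k) (of_real (W k) * y0 k) (g \<eta> k))"
          unfolding at using t
          by (intro has_vector_derivative_continuous[OF duhamel_has_vector_derivative[OF gc[OF that]]]) auto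
      qed
      then show ?thesis
        unfolding F_def prod.case by (rule continuous_on_compose2) (auto intro!: continuous_intros)
    qed
    ultimately show ?thesis by (simp add: P_def)
  qed
  obtain \<eta> where P\<eta>: "P \<eta>" and \<eta>: "F \<eta> = \<eta>"
  proof (rule sup_contraction_fixpoint[where q = "1/2" and P = P and F = F and init = "\<lambda>_. 0" and C = B])
    show "P (\<lambda>_. 0)" by (auto simp: P_def)
    show "P g" if "\<And>n. P (f n)" "uniform_limit UNIV f g sequentially" for f g
    proof -
      have "continuous_on UNIV (\<lambda>t. g (k, t))" for k
      proof (rule uniform_limit_theorem[OF _ _ sequentially_bot])
        show "uniform_limit UNIV (\<lambda>n t. f n (k, t)) (\<lambda>t. g (k, t)) sequentially"
          using that(2) by (auto simp: uniform_limit_iff elim!: eventually_mono)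
      qed (use that(1) in \<open>simp add: P_def\<close>)
      moreover have "bounded (g ` UNIV)"
        by (rule uniform_limit_bounded[OF that(2)]) (use that(1) in \<open>auto simp: P_def\<close>)
      ultimately show ?thesis by (simp add: P_def)
    qed
    show "cmod (F (\<lambda>_. 0) p - 0) \<le> B" for p
      using Fb[of "\<lambda>_. 0" 0 p] by (simp add: P_def)
    show "cmod (F \<eta> p - F \<theta> p) \<le> 1/2 * D" if "P \<eta>" "P \<theta>" and D: "\<And>p. cmod (\<eta> p - \<theta> p) \<le> D" for \<eta> \<theta> D p
    proof -
      have D0: "0 \<le> D" using order_trans[OF norm_ge_zero D] .
      obtain k t where p: "p = (k, t)" by (cases p)
      have "cmod (F \<eta> p - F \<theta> p) = cmod (duhamel (\<mu> k) 0 (\<lambda>s. g \<eta> k s - g \<theta> k s) (max 0 t))"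
        using that by (simp add: p F_def duhamel_diff[OF gc gc])
      also have "\<dots> \<le> cmod 0 + A * D / Re (\<mu> k)"
        using that by (intro norm_duhamel_le[OF _ _ mupos gb] continuous_on_diff gc D) auto
      also have "\<dots> \<le> A * D / K"
        using mu[of k] K A0 D0 by (auto intro!: divide_left_mono)
      also have "\<dots> = (A / K) * D" by simp
      also have "\<dots> \<le> 1/2 * D" by (rule mult_right_mono[OF AK D0])
      finally show ?thesis .
    qed
  qed (auto intro: PF)
  obtain N where "\<forall>z\<in>range \<eta>. cmod z \<le> N"
    using P\<eta> unfolding P_def bounded_iff by blast
  then have N: "cmod (\<eta> p) \<le> N" for p by blast
  define y where "y t k = \<eta> (k, t) / of_real (W k)" for t k
  have ya: "\<eta> (k, t) = of_real (W k) * y t k" for k t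
    using Wpos[of k] by (simp add: y_def)
  show ?thesis
  proof
    show "y 0 = y0"
    proof
      fix k
      have "y 0 k = F \<eta> (k, 0) / of_real (W k)" by (simp add: y_def \<eta>)
      then show "y 0 k = y0 k" using Wpos[of k] by (simp add: F_def duhamel_0)
    qed
    show "decays 5 N (y t)" if "0 \<le> t" for t
      unfolding decays_def
    proof
      fix k
      show "cmod (y t k) * (1 + \<bar>real_of_int k\<bar>) ^ 5 \<le> N"
        using N[of "(k, t)"] Wpos[of k] by (simp add: ya norm_mult W_def[symmetric] mult.commute)
    qed
    fix k t assume t: "(0::real) \<le> t"
    let ?d = "duhamel (\<mu> k) (of_real (W k) * y0 k) (g \<eta> k)"
    have yd: "y s k = ?d s / of_real (W k)" if "0 \<le> s" for s
    proof -
      have "y s k = F \<eta> (k, s) / of_real (W k)" by (simp add: y_def \<eta>)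
      then show ?thesis using that by (simp add: F_def)
    qed
    have gy: "g \<eta> k t = of_real (W k) * pot_conv V (y t) k"
      unfolding g_def pot_conv_def sum_distrib_left
      by (intro sum.cong) (use Wpos in \<open>simp_all add: ya less_imp_neq[symmetric]\<close>)
    have at: "at t within {0..} = at t within {0..t + 1}"
      by (rule at_within_nhd[of _ "{..<t+1}"]) auto
    have "(?d has_vector_derivative g \<eta> k t - \<mu> k * ?d t) (at t within {0..})"
      unfolding at by (rule duhamel_has_vector_derivative[OF gc[OF P\<eta>] t])
    then have "((\<lambda>s. ?d s / of_real (W k)) has_vector_derivative (g \<eta> k t - \<mu> k * ?d t) / of_real (W k)) (at t within {0..})"
      by (rule has_vector_derivative_divide)
    moreover have "(g \<eta> k t - \<mu> k * ?d t) / of_real (W k) = pot_conv V (y t) k - \<mu> k * y t k"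
      using Wpos[of k] by (simp add: gy yd[OF t] diff_divide_distrib)
    ultimately have "((\<lambda>s. ?d s / of_real (W k)) has_vector_derivative pot_conv V (y t) k - \<mu> k * y t k) (at t within {0..})"
      by simp
    then have "((\<lambda>s. y s k) has_vector_derivative pot_conv V (y t) k - \<mu> k * y t k) (at t within {0..})"
      by (rule has_vector_derivative_transform[rotated 2]) (use t yd in auto)
    then show "((\<lambda>s. y s k) has_vector_derivative
        pot_conv V (y t) k - (symbol \<nu> c k + of_real K) * y t k) (at t within {0..})"
      by (simp only: \<mu>_def)
  qed
qed

section \<open>The stationary modes\<close>

lemma Re_symbol: "Re (symbol \<nu> c k) = \<nu> * (of_int k)\<^sup>2"
  by (simp add: symbol_def)

lemma symbol_0 [simp]: "symbol \<nu> c 0 = 0"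
  by (simp add: symbol_def)

lemma symbol_uminus: "symbol \<nu> c (- k) = cnj (symbol \<nu> c k)"
  by (simp add: symbol_def)

lemma pot_conv_uminus:
  assumes "\<And>j. V (- j) = cnj (V j)" "\<And>k. y (- k) = cnj (y k)"
  shows "pot_conv V y (- k) = cnj (pot_conv V y k)"
proof -
  have "pot_conv V y (- k) = (\<Sum>j\<in>{-3..3}. V (- j) * y (- k - (- j)))"
    unfolding pot_conv_def by (rule sum.reindex_bij_witness[where i = uminus and j = uminus]) auto
  also have "\<dots> = (\<Sum>j\<in>{-3..3}. cnj (V j * y (k - j)))"
    using assms(2)[of "k - _"] by (intro sum.cong refl) (simp add: assms(1) algebra_simps)
  finally show ?thesis by (simp add: pot_conv_def cnj_sum)
qed

lemma square_ge_1:
  fixes k :: int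
  assumes "k \<noteq> 0"
  shows "1 \<le> (real_of_int k)\<^sup>2"
proof -
  have "1 \<le> \<bar>k\<bar>" using assms by simp
  then have "1 \<le> \<bar>real_of_int k\<bar>" by linarith
  then show ?thesis by (metis one_le_power power2_abs)
qed

lemma Re_symbol_ge:
  assumes "2 \<le> \<nu>" "k \<noteq> 0"
  shows "2 \<le> Re (symbol \<nu> c k)"
  using mult_mono[OF assms(1) square_ge_1[OF assms(2)]] assms(1) by (simp add: Re_symbol)

lemma Re_symbol_weight:
  assumes "2 \<le> \<nu>" "k \<noteq> 0"
  shows "(1 + \<bar>real_of_int k\<bar>)\<^sup>2 \<le> 2 * Re (symbol \<nu> c k)"
proof -
  have "1 \<le> \<bar>k\<bar>" using assms by simp
  then have "1 \<le> \<bar>real_of_int k\<bar>" by linarith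
  then have "(1 + \<bar>real_of_int k\<bar>)\<^sup>2 \<le> (2 * \<bar>real_of_int k\<bar>)\<^sup>2" by (intro power_mono) auto
  also have "\<dots> = 2 * (2 * (real_of_int k)\<^sup>2)" by (simp add: power_mult_distrib)
  also have "\<dots> \<le> 2 * (\<nu> * (real_of_int k)\<^sup>2)" using assms by (intro mult_left_mono mult_right_mono) auto
  finally show ?thesis by (simp only: Re_symbol)
qed

text \<open>The right-hand side of the equation for the modes divided by the mode of index 0.\<close>

definition riccati :: "(int \<Rightarrow> complex) \<Rightarrow> (int \<Rightarrow> complex) \<Rightarrow> int \<Rightarrow> complex" where
  "riccati V y k = pot_conv V y k - pot_conv V y 0 * y k"

lemma norm_riccati_diff_le:
  assumes "\<And>k. cmod (x k) \<le> 1" "\<And>k. cmod (y k) \<le> 1" and D: "\<And>k. cmod (x k - y k) \<le> D"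
  shows "cmod (riccati V x k - riccati V y k) \<le> 3 * pot_norm V * D"
proof -
  have "riccati V x k - riccati V y k
      = pot_conv V (\<lambda>k. x k - y k) k - pot_conv V x 0 * (x k - y k) - pot_conv V (\<lambda>k. x k - y k) 0 * y k"
    by (simp add: riccati_def pot_conv_diff algebra_simps)
  also have "cmod \<dots> \<le> cmod (pot_conv V (\<lambda>k. x k - y k) k) + cmod (pot_conv V x 0 * (x k - y k))
      + cmod (pot_conv V (\<lambda>k. x k - y k) 0 * y k)"
    by (meson add_mono norm_triangle_ineq4 order_refl order_trans)
  also have "\<dots> \<le> pot_norm V * D + (pot_norm V * 1) * D + (pot_norm V * D) * 1"
    using order_trans[OF norm_ge_zero D] pot_norm_nonneg[of V]
    unfolding norm_mult by (intro add_mono mult_mono norm_pot_conv_le assms) auto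
  finally show ?thesis by (simp add: mult_ac)
qed

lemma norm_riccati_le:
  assumes dec: "decays p B y" and y1: "\<And>k. cmod (y k) \<le> 1"
  shows "cmod (riccati V y k) * (1 + \<bar>real_of_int k\<bar>) ^ p \<le> 2 * 4 ^ p * pot_norm V * B"
proof -
  let ?w = "(1 + \<bar>real_of_int k\<bar>) ^ p"
  have B: "0 \<le> B" by (rule decays_nonneg[OF dec])
  have "cmod (pot_conv V y 0 * y k) * ?w = cmod (pot_conv V y 0) * (cmod (y k) * ?w)"
    by (simp add: norm_mult)
  also have "\<dots> \<le> (pot_norm V * 1) * B"
    using pot_norm_nonneg[of V] by (intro mult_mono norm_pot_conv_le y1 decaysD[OF dec]) auto
  also have "\<dots> \<le> pot_norm V * (4 ^ p * B)"
    using B pot_norm_nonneg[of V] mult_right_mono[of 1 "4 ^ p" B] by (simp add: mult_left_mono)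
  finally have 2: "cmod (pot_conv V y 0 * y k) * ?w \<le> pot_norm V * (4 ^ p * B)" .
  have "cmod (riccati V y k) * ?w \<le> (cmod (pot_conv V y k) + cmod (pot_conv V y 0 * y k)) * ?w"
    unfolding riccati_def by (intro mult_right_mono norm_triangle_ineq4) simp
  also have "\<dots> \<le> pot_norm V * (4 ^ p * B) + pot_norm V * (4 ^ p * B)"
    unfolding distrib_right by (intro add_mono decaysD[OF decays_pot_conv[OF dec]] 2)
  finally show ?thesis by (simp add: mult_ac)
qed

lemma stationary_modes_exist:
  assumes nu: "2 \<le> \<nu>" and V: "pot_norm V \<le> 2/5" "\<And>j. V (- j) = cnj (V j)"
  obtains y where "y 0 = 1" "\<And>k. cmod (y k) \<le> 1" "\<And>k. y (- k) = cnj (y k)"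
    "\<And>k. symbol \<nu> c k * y k = riccati V y k"
proof -
  define P where "P y \<longleftrightarrow> y 0 = 1 \<and> (\<forall>k. cmod (y k) \<le> 1) \<and> (\<forall>k. y (- k) = cnj (y k))" for y :: "int \<Rightarrow> complex"
  define F where "F y k = (if k = 0 then 1 else riccati V y k / symbol \<nu> c k)" for y k
  have sym: "2 \<le> cmod (symbol \<nu> c k)" if "k \<noteq> 0" for k
    using Re_symbol_ge[OF nu that, of c] complex_Re_le_cmod[of "symbol \<nu> c k"] by linarith
  have PF: "P (F y)" if y: "P y" for y
  proof -
    have "cmod (F y k) \<le> 1" for k
    proof (cases "k = 0")
      case False
      have "decays 0 1 y" using y by (simp add: decays_def P_def)
      from norm_riccati_le[OF this, of V k] have "cmod (riccati V y k) \<le> 1"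
        using y V(1) by (simp add: P_def)
      then show ?thesis using False sym[OF False]
        by (simp add: F_def norm_divide divide_le_eq_1)
    qed (simp add: F_def)
    moreover have "F y (- k) = cnj (F y k)" for k
      using y pot_conv_uminus[of V y, OF V(2)] pot_conv_uminus[of V y 0, OF V(2)]
      by (simp add: F_def riccati_def P_def symbol_uminus)
    ultimately show ?thesis by (simp add: P_def F_def)
  qed
  obtain y where y: "P y" "F y = y"
  proof (rule sup_contraction_fixpoint[where q = "3/5" and P = P and F = F and init = "\<lambda>k. if k = 0 then 1 else 0" and C = 2])
    show "P (\<lambda>k. if k = 0 then 1 else 0)" by (simp add: P_def)
    show "P g" if Pf: "\<And>n. P (f n)" and "uniform_limit UNIV f g sequentially" for f g
    proof -
      have lim: "(\<lambda>n. f n k) \<longlonglongrightarrow> g k" for k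
        by (rule tendsto_uniform_limitI[OF that(2)]) simp
      have "g 0 = 1"
        using LIMSEQ_unique[OF lim[of 0]] Pf by (simp add: P_def)
      moreover have "cmod (g k) \<le> 1" for k
        using tendsto_upperbound[OF tendsto_norm[OF lim[of k]], of 1] Pf by (simp add: P_def)
      moreover have "g (- k) = cnj (g k)" for k
        using LIMSEQ_unique[OF lim[of "- k"]] tendsto_cnj[OF lim[of k]] Pf by (simp add: P_def)
      ultimately show ?thesis by (simp add: P_def)
    qed
    show "cmod (F x k - F y k) \<le> 3/5 * D" if "P x" "P y" and D: "\<And>k. cmod (x k - y k) \<le> D" for x y D k
    proof -
      have D0: "0 \<le> D" using order_trans[OF norm_ge_zero D] .
      show ?thesis
      proof (cases "k = 0")
        case False
        have "cmod (riccati V x k - riccati V y k) \<le> 3 * pot_norm V * D"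
          by (rule norm_riccati_diff_le) (use that in \<open>auto simp: P_def\<close>)
        also have "\<dots> \<le> 6/5 * D" using V(1) D0 by (intro mult_right_mono) auto
        also have "\<dots> = (3/5 * D) * 2" by simp
        also have "\<dots> \<le> (3/5 * D) * cmod (symbol \<nu> c k)" using D0 sym[OF False] by (intro mult_left_mono) auto
        finally have "cmod (riccati V x k - riccati V y k) / cmod (symbol \<nu> c k) \<le> 3/5 * D"
          using sym[OF False] by (subst pos_divide_le_eq) auto
        then show ?thesis using False by (simp add: F_def diff_divide_distrib[symmetric] norm_divide)
      qed (use D0 in \<open>simp add: F_def\<close>)
    qed
    show "cmod (F (\<lambda>k. if k = 0 then 1 else 0) k - (if k = 0 then 1 else 0)) \<le> 2" for k
    proof -
      have "P (F (\<lambda>k. if k = 0 then 1 else 0))" by (rule PF) (simp add: P_def)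
      then have "cmod (F (\<lambda>k. if k = 0 then 1 else 0) k) \<le> 1" by (simp add: P_def)
      then show ?thesis
        using norm_triangle_ineq4[of "F (\<lambda>k. if k = 0 then 1 else 0) k" "if k = 0 then 1 else 0"]
        by (auto split: if_splits)
    qed
  qed (auto intro: PF)
  have "symbol \<nu> c k * y k = riccati V y k" for k
  proof (cases "k = 0")
    case True
    then show ?thesis using y(1) by (simp add: riccati_def P_def)
  next
    case False
    have "y k = riccati V y k / symbol \<nu> c k" using y(2) False by (metis F_def)
    moreover have "symbol \<nu> c k \<noteq> 0" using sym[OF False] by auto
    ultimately show ?thesis by simp
  qed
  then show ?thesis using y(1) by (intro that[of y]) (auto simp: P_def)
qed

lemma stationary_modes_decay:
  assumes nu: "2 \<le> \<nu>" and y: "\<And>k. cmod (y k) \<le> 1" "\<And>k. symbol \<nu> c k * y k = riccati V y k"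
  shows "\<exists>B. decays (2 * n) B y"
proof (induction n)
  case 0
  show ?case using y(1) by (auto simp: decays_def)
next
  case (Suc n)
  then obtain B where B: "decays (2 * n) B y" by blast
  define C where "C = 2 * 4 ^ (2 * n) * pot_norm V * B"
  have C: "0 \<le> C" using decays_nonneg[OF B] pot_norm_nonneg[of V] by (simp add: C_def)
  have "decays (2 * n + 2) (1 + 2 * C) y"
    unfolding decays_def
  proof
    fix k
    show "cmod (y k) * (1 + \<bar>real_of_int k\<bar>) ^ (2 * n + 2) \<le> 1 + 2 * C"
    proof (cases "k = 0")
      case True
      then show ?thesis using y(1)[of 0] C by simp
    next
      case False
      let ?w = "1 + \<bar>real_of_int k\<bar>"
      have "cmod (y k) * ?w ^ (2 * n + 2) = (cmod (y k) * ?w ^ (2 * n)) * ?w\<^sup>2"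
        by (simp only: power_add mult.assoc)
      also have "\<dots> \<le> (cmod (y k) * ?w ^ (2 * n)) * (2 * cmod (symbol \<nu> c k))"
        using Re_symbol_weight[OF nu False, of c] complex_Re_le_cmod[of "symbol \<nu> c k"]
        by (intro mult_left_mono) auto
      also have "\<dots> = 2 * (cmod (riccati V y k) * ?w ^ (2 * n))"
        by (simp add: y(2)[symmetric] norm_mult)
      also have "\<dots> \<le> 2 * C"
        unfolding C_def by (intro mult_left_mono norm_riccati_le B y(1)) simp
      finally show ?thesis by simp
    qed
  qed
  then show ?case by auto
qed

lemma stationary_modes_sum:
  assumes nu: "2 \<le> \<nu>" and V: "pot_norm V \<le> 2/5" and y: "y 0 = 1" "\<And>k. cmod (y k) \<le> 1"
    "\<And>k. symbol \<nu> c k * y k = riccati V y k" and sm: "(\<lambda>k. cmod (y k)) summable_on UNIV"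
  shows "(\<Sum>\<^sub>\<infinity>k. cmod (y k)) \<le> 5/3"
proof -
  define s where "s = (\<Sum>\<^sub>\<infinity>k. cmod (y k))"
  have s: "((\<lambda>k. cmod (y k)) has_sum s) UNIV" unfolding s_def by (rule has_sum_infsum[OF sm])
  have s0: "0 \<le> s" by (rule has_sum_nonneg[OF s]) simp
  have sj: "((\<lambda>k. cmod (y (k - j))) has_sum s) UNIV" for j :: int
  proof -
    have "bij_betw (\<lambda>k. k - j) UNIV (UNIV :: int set)"
      by (rule bij_betw_byWitness[where f' = "\<lambda>k. k + j"]) auto
    from has_sum_reindex_bij_betw[OF this, of "\<lambda>k. cmod (y k)" s] s show ?thesis by simp
  qed
  have r: "((\<lambda>k. (\<Sum>j\<in>{-3..3}. cmod (V j) * cmod (y (k - j))) + pot_norm V * cmod (y k) + (if k = 0 then 2 else 0))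
      has_sum (\<Sum>j\<in>{-3..3}. cmod (V j) * s) + pot_norm V * s + 2) UNIV"
  proof (intro has_sum_add has_sum_finite_sum has_sum_cmult_right sj s)
    show "((\<lambda>k::int. if k = 0 then 2 else 0) has_sum (2::real)) UNIV"
      using has_sum_finite_neutralI[of "{0::int}" UNIV "\<lambda>k. if k = 0 then 2 else 0" "2::real"] by simp
  qed simp
  have "2 * s \<le> (\<Sum>j\<in>{-3..3}. cmod (V j) * s) + pot_norm V * s + 2"
  proof (rule has_sum_mono[OF has_sum_cmult_right[OF s] r])
    fix k
    show "2 * cmod (y k) \<le> (\<Sum>j\<in>{-3..3}. cmod (V j) * cmod (y (k - j))) + pot_norm V * cmod (y k) + (if k = 0 then 2 else 0)"
    proof (cases "k = 0")
      case True
      then show ?thesis using y pot_norm_nonneg[of V] by (simp add: sum_nonneg)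
    next
      case False
      have "2 * cmod (y k) \<le> cmod (symbol \<nu> c k) * cmod (y k)"
        using Re_symbol_ge[OF nu False, of c] complex_Re_le_cmod[of "symbol \<nu> c k"]
        by (intro mult_right_mono) auto
      also have "\<dots> = cmod (riccati V y k)" by (simp add: y(3)[symmetric] norm_mult)
      also have "\<dots> \<le> cmod (pot_conv V y k) + cmod (pot_conv V y 0 * y k)"
        unfolding riccati_def by (rule norm_triangle_ineq4)
      also have "cmod (pot_conv V y k) \<le> (\<Sum>j\<in>{-3..3}. cmod (V j) * cmod (y (k - j)))"
        unfolding pot_conv_def norm_mult[symmetric] by (rule norm_sum)
      also have "cmod (pot_conv V y 0 * y k) \<le> (pot_norm V * 1) * cmod (y k)"
        unfolding norm_mult by (intro mult_right_mono norm_pot_conv_le y) auto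
      finally show ?thesis using False by simp
    qed
  qed
  also have "\<dots> = 2 * pot_norm V * s + 2" by (simp add: pot_norm_def sum_distrib_right)
  also have "\<dots> \<le> 4/5 * s + 2" using V s0 mult_right_mono[of "2 * pot_norm V" "4/5" s] by simp
  finally show ?thesis by (simp add: s_def)
qed

text \<open>Dissipation gains two powers of decay, uniformly in time.\<close>

lemma normalised_modes_decay_step:
  assumes nu: "2 \<le> \<nu>"
    and y1: "\<And>t k. 0 \<le> t \<Longrightarrow> cmod (y t k) \<le> 1"
    and ode: "\<And>t k. 0 \<le> t \<Longrightarrow> ((\<lambda>s. y s k) has_vector_derivative riccati V (y t) k - symbol \<nu> c k * y t k)
        (at t within {0..})"
    and B: "\<And>t. 0 \<le> t \<Longrightarrow> decays p B (y t)" and B0: "decays (p + 2) B0 (y 0)"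
  shows "\<exists>B. \<forall>t\<ge>0. decays (p + 2) B (y t)"
proof -
  define C where "C = 2 * 4 ^ p * pot_norm V * B"
  have C: "0 \<le> C" using decays_nonneg[OF B[of 0]] pot_norm_nonneg[of V] by (simp add: C_def)
  have "decays (p + 2) (1 + B0 + 2 * C) (y t)" if t: "0 \<le> t" for t
    unfolding decays_def
  proof
    fix k
    let ?w = "1 + \<bar>real_of_int k\<bar>"
    have B0': "0 \<le> B0" by (rule decays_nonneg[OF B0])
    show "cmod (y t k) * ?w ^ (p + 2) \<le> 1 + B0 + 2 * C"
    proof (cases "k = 0")
      case True
      then show ?thesis using y1[OF t, of 0] C B0' by simp
    next
      case False
      define R where "R = Re (symbol \<nu> c k)"
      have R: "0 < R" "?w\<^sup>2 \<le> 2 * R"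
        using Re_symbol_ge[OF nu False, of c] Re_symbol_weight[OF nu False, of c] by (auto simp: R_def)
      have w: "0 < ?w ^ p" by (simp add: add_pos_nonneg)
      have "cmod (y t k) \<le> exp (- Re (symbol \<nu> c k) * (t - 0)) * cmod (y 0 k) + C / ?w ^ p / Re (symbol \<nu> c k)"
      proof (rule damped_ode_bound[where g = "\<lambda>s. riccati V (y s) k"])
        show "((\<lambda>s. y s k) has_vector_derivative riccati V (y s) k - symbol \<nu> c k * y s k) (at s within {0..t})"
          if "s \<in> {0..t}" for s
          using ode[of s k] that by (auto elim: has_vector_derivative_within_subset)
        show "cmod (riccati V (y s) k) \<le> C / ?w ^ p" if "s \<in> {0..t}" for s
          using norm_riccati_le[OF B[of s] y1[of s], of V k] that w by (simp add: pos_le_divide_eq C_def)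
      qed (use t R in \<open>auto simp: R_def\<close>)
      also have "\<dots> \<le> 1 * cmod (y 0 k) + C / ?w ^ p / R"
        unfolding R_def[symmetric] using R t by (intro add_mono mult_right_mono) auto
      finally have "cmod (y t k) * ?w ^ (p + 2) \<le> (1 * cmod (y 0 k) + C / ?w ^ p / R) * ?w ^ (p + 2)"
        by (rule mult_right_mono) simp
      also have "\<dots> = cmod (y 0 k) * ?w ^ (p + 2) + C * (?w\<^sup>2 / R)"
      proof -
        have "(a + C / b / R) * (b * q) = a * (b * q) + C * (q / R)" if "0 < b" for a b q
          using that by (simp add: field_simps)
        from this[OF w] show ?thesis by (simp only: power_add mult_1)
      qed
      also have "\<dots> \<le> B0 + C * 2"
        using R C by (intro add_mono mult_left_mono decaysD[OF B0]) (auto simp: pos_divide_le_eq)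
      finally show ?thesis by simp
    qed
  qed
  then show ?thesis by blast
qed

text \<open>The forcing of the difference is at most \<open>3 (2/5)\<close> times its supremum, against a dissipation rate of
  at least 2: waiting one unit of time shrinks the supremum by the factor \<open>1/5 + 3/5\<close>.\<close>

lemma normalised_modes_converge:
  assumes nu: "2 \<le> \<nu>" and V: "pot_norm V \<le> 2/5"
    and y1: "\<And>t k. 0 \<le> t \<Longrightarrow> cmod (y t k) \<le> 1" and y0: "\<And>t. 0 \<le> t \<Longrightarrow> y t 0 = 1"
    and ode: "\<And>t k. 0 \<le> t \<Longrightarrow> ((\<lambda>s. y s k) has_vector_derivative riccati V (y t) k - symbol \<nu> c k * y t k)
        (at t within {0..})"
    and z: "z 0 = 1" "\<And>k. cmod (z k) \<le> 1" "\<And>k. symbol \<nu> c k * z k = riccati V z k"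
  shows "((\<lambda>t. y t k) \<longlongrightarrow> z k) at_top"
proof -
  have bound: "cmod (y t k - z k) \<le> 2 * (4/5) ^ n" if "real n \<le> t" for n t k
    using that
  proof (induction n arbitrary: t k)
    case 0
    then show ?case using norm_triangle_ineq4[of "y t k" "z k"] y1[of t k] z(2)[of k] by simp
  next
    case (Suc n)
    define D :: real where "D = 2 * (4/5) ^ n"
    have D0: "0 \<le> D" by (simp add: D_def)
    have t0: "0 \<le> t" "real n \<le> t" using Suc.prems by auto
    show ?case
    proof (cases "k = 0")
      case False
      define R where "R = Re (symbol \<nu> c k)"
      have R: "2 \<le> R" using Re_symbol_ge[OF nu False, of c] by (auto simp: R_def)
      have "cmod (y t k - z k) \<le> exp (- Re (symbol \<nu> c k) * (t - real n)) * cmod (y (real n) k - z k)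
          + 6/5 * D / Re (symbol \<nu> c k)"
      proof (rule damped_ode_bound[where z = "\<lambda>s. y s k - z k" and g = "\<lambda>s. riccati V (y s) k - riccati V z k"])
        fix s assume s: "s \<in> {real n..t}"
        then have s0: "0 \<le> s" by simp
        have "((\<lambda>s. y s k - z k) has_vector_derivative (riccati V (y s) k - symbol \<nu> c k * y s k) - 0) (at s within {real n..t})"
          using s by (intro has_vector_derivative_diff has_vector_derivative_const
              has_vector_derivative_within_subset[OF ode[OF s0]]) auto
        then show "((\<lambda>s. y s k - z k) has_vector_derivative
            riccati V (y s) k - riccati V z k - symbol \<nu> c k * (y s k - z k)) (at s within {real n..t})"
          by (simp add: right_diff_distrib z(3))
        have "cmod (riccati V (y s) k - riccati V z k) \<le> 3 * pot_norm V * D"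
          by (rule norm_riccati_diff_le[OF y1[OF s0] z(2)]) (use Suc.IH s in \<open>auto simp: D_def\<close>)
        also have "\<dots> \<le> 6/5 * D" using V D0 by (intro mult_right_mono) auto
        finally show "cmod (riccati V (y s) k - riccati V z k) \<le> 6/5 * D" .
      qed (use t0 R in \<open>auto simp: R_def\<close>)
      also have "\<dots> \<le> (1/5) * D + (3/5) * D"
      proof (intro add_mono mult_mono)
        have "5 \<le> exp (2::real)" using exp_lower_Taylor_quadratic[of "2::real"] by simp
        moreover have "2 * 1 \<le> R * (t - real n)" using R Suc.prems by (intro mult_mono) auto
        then have "exp (2::real) \<le> exp (R * (t - real n))" by simp
        ultimately have "5 \<le> exp (R * (t - real n))" by linarith
        then show "exp (- Re (symbol \<nu> c k) * (t - real n)) \<le> 1/5"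
          unfolding R_def[symmetric] by (simp only: mult_minus_left exp_minus) (simp add: inverse_eq_divide divide_le_eq)
        show "cmod (y (real n) k - z k) \<le> D" using Suc.IH[of "real n" k] by (simp add: D_def)
        have "6/5 * D \<le> 3/5 * D * R" using D0 R mult_left_mono[OF R, of "3/5 * D"] by simp
        then show "6/5 * D / Re (symbol \<nu> c k) \<le> 3/5 * D"
          using R by (simp add: R_def[symmetric] pos_divide_le_eq)
      qed auto
      finally show ?thesis by (simp add: D_def)
    qed (simp add: y0[OF t0(1)] z(1))
  qed
  have "((\<lambda>t. y t k - z k) \<longlongrightarrow> 0) at_top"
  proof (rule tendstoI)
    fix e :: real assume "0 < e"
    have "(\<lambda>n. 2 * (4/5) ^ n :: real) \<longlonglongrightarrow> 2 * 0"
      by (intro tendsto_intros LIMSEQ_realpow_zero) auto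
    then have "\<forall>\<^sub>F n in sequentially. 2 * (4/5) ^ n < e"
      by (rule order_tendstoD(2)) (use \<open>0 < e\<close> in simp)
    then obtain n where n: "2 * (4/5) ^ n < e" by (auto simp: eventually_sequentially)
    have "\<forall>\<^sub>F t in at_top. real n \<le> t" by (rule eventually_ge_at_top)
    then show "\<forall>\<^sub>F t in at_top. dist (y t k - z k) 0 < e"
      by eventually_elim (use bound n in \<open>auto intro: le_less_trans\<close>)
  qed
  then show ?thesis by (simp add: LIM_zero_iff)
qed

section \<open>The Cole-Hopf transformation\<close>

lemma cole_hopf_solution:
  fixes T :: ereal and \<phi> \<phi>x \<phi>xx \<phi>xxx \<phi>t \<phi>xt :: "real \<Rightarrow> real \<Rightarrow> real"
  defines "I \<equiv> {t. 0 \<le> t \<and> ereal t < T}"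
  assumes nz: "\<And>x t. t \<in> I \<Longrightarrow> \<phi> x t \<noteq> 0"
    and per: "\<And>t. t \<in> I \<Longrightarrow> periodic_2pi (\<lambda>x. \<phi> x t)" "\<And>t. t \<in> I \<Longrightarrow> periodic_2pi (\<lambda>x. \<phi>x x t)"
    and c0: "continuous_on (UNIV \<times> I) (\<lambda>(x, t). \<phi> x t)"
    and c1: "continuous_on (UNIV \<times> I) (\<lambda>(x, t). \<phi>x x t)"
    and c2: "continuous_on (UNIV \<times> I) (\<lambda>(x, t). \<phi>xx x t)"
    and c3: "continuous_on (UNIV \<times> I) (\<lambda>(x, t). \<phi>xxx x t)"
    and ct: "continuous_on (UNIV \<times> I) (\<lambda>(x, t). \<phi>t x t)"
    and cxt: "continuous_on (UNIV \<times> I) (\<lambda>(x, t). \<phi>xt x t)"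
    and d0: "\<And>x t. t \<in> I \<Longrightarrow> ((\<lambda>y. \<phi> y t) has_real_derivative \<phi>x x t) (at x)"
    and d1: "\<And>x t. t \<in> I \<Longrightarrow> ((\<lambda>y. \<phi>x y t) has_real_derivative \<phi>xx x t) (at x)"
    and d2: "\<And>x t. t \<in> I \<Longrightarrow> ((\<lambda>y. \<phi>xx y t) has_real_derivative \<phi>xxx x t) (at x)"
    and dt: "\<And>x t. t \<in> I \<Longrightarrow> ((\<lambda>s. \<phi> x s) has_real_derivative \<phi>t x t) (at t within I)"
    and dxt: "\<And>x t. t \<in> I \<Longrightarrow> ((\<lambda>s. \<phi>x x s) has_real_derivative \<phi>xt x t) (at t within I)"
    and dtx: "\<And>x t. t \<in> I \<Longrightarrow> ((\<lambda>y. \<phi>t y t) has_real_derivative \<phi>xt x t) (at x)"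
    and eq: "\<And>x t. t \<in> I \<Longrightarrow> \<phi>t x t = \<nu> * \<phi>xx x t - c * \<phi>x x t + W x * \<phi> x t"
    and W: "\<And>x. (W has_real_derivative W' x) (at x)" and f: "\<And>x. f x = - 2 * \<nu> * W' x"
  shows "burgers_solution \<nu> f T (\<lambda>x t. c - 2 * \<nu> * (\<phi>x x t / \<phi> x t))"
proof -
  define p where "p x t = \<phi>x x t / \<phi> x t" for x t
  define P2 where "P2 x t = \<phi>xx x t / \<phi> x t" for x t
  define P3 where "P3 x t = \<phi>xxx x t / \<phi> x t" for x t
  define ux where "ux x t = - 2 * \<nu> * (P2 x t - (p x t)\<^sup>2)" for x t
  define uxx where "uxx x t = - 2 * \<nu> * (P3 x t - 3 * p x t * P2 x t + 2 * (p x t)^3)" for x t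
  define pt where "pt x t = \<phi>t x t / \<phi> x t" for x t
  define pxt where "pxt x t = \<phi>xt x t / \<phi> x t" for x t
  define ut where "ut x t = - 2 * \<nu> * (pxt x t - p x t * pt x t)" for x t
  have dp: "((\<lambda>y. p y t) has_real_derivative P2 x t - (p x t)\<^sup>2) (at x)" if "t \<in> I" for x t
    unfolding p_def P2_def using nz[OF that]
    by (auto intro!: derivative_eq_intros d0[OF that] d1[OF that] simp: field_simps power2_eq_square)
  have dP2: "((\<lambda>y. P2 y t) has_real_derivative P3 x t - P2 x t * p x t) (at x)" if "t \<in> I" for x t
    unfolding p_def P2_def P3_def using nz[OF that]
    by (auto intro!: derivative_eq_intros d0[OF that] d2[OF that] simp: field_simps)
  have dpt: "((\<lambda>s. p x s) has_real_derivative pxt x t - p x t * pt x t) (at t within I)"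
    if "t \<in> I" for x t
    unfolding p_def pt_def pxt_def using nz[OF that]
    by (auto intro!: derivative_eq_intros dt[OF that] dxt[OF that] simp: field_simps)
  have xt: "\<phi>xt x t = \<nu> * \<phi>xxx x t - c * \<phi>xx x t + (W' x * \<phi> x t + W x * \<phi>x x t)" if "t \<in> I" for x t
  proof (rule DERIV_unique[OF dtx[OF that]])
    have "((\<lambda>y. \<nu> * \<phi>xx y t - c * \<phi>x y t + W y * \<phi> y t) has_real_derivative
        \<nu> * \<phi>xxx x t - c * \<phi>xx x t + (W' x * \<phi> x t + W x * \<phi>x x t)) (at x)"
      by (auto intro!: derivative_eq_intros d0[OF that] d1[OF that] d2[OF that] W)
    then show "((\<lambda>y. \<phi>t y t) has_real_derivative
        \<nu> * \<phi>xxx x t - c * \<phi>xx x t + (W' x * \<phi> x t + W x * \<phi>x x t)) (at x)"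
      by (simp only: eq[OF that])
  qed
  have pc: "continuous_on (UNIV \<times> I) (\<lambda>(x, t). p x t)"
    using nz c0 c1 unfolding p_def by (auto simp: case_prod_unfold intro!: continuous_on_divide)
  have P2c: "continuous_on (UNIV \<times> I) (\<lambda>(x, t). P2 x t)"
    using nz c0 c2 unfolding P2_def by (auto simp: case_prod_unfold intro!: continuous_on_divide)
  have P3c: "continuous_on (UNIV \<times> I) (\<lambda>(x, t). P3 x t)"
    using nz c0 c3 unfolding P3_def by (auto simp: case_prod_unfold intro!: continuous_on_divide)
  have tc: "continuous_on (UNIV \<times> I) (\<lambda>(x, t). pt x t)"
    using nz c0 ct unfolding pt_def by (auto simp: case_prod_unfold intro!: continuous_on_divide)
  have xtc: "continuous_on (UNIV \<times> I) (\<lambda>(x, t). pxt x t)"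
    using nz c0 cxt unfolding pxt_def by (auto simp: case_prod_unfold intro!: continuous_on_divide)
  have "continuous_on (UNIV \<times> I) (\<lambda>(x, t). ut x t)"
    using pc tc xtc unfolding ut_def case_prod_unfold by (intro continuous_intros)
  moreover have "continuous_on (UNIV \<times> I) (\<lambda>(x, t). ux x t)"
    using pc P2c unfolding ux_def case_prod_unfold by (intro continuous_intros)
  moreover have "continuous_on (UNIV \<times> I) (\<lambda>(x, t). uxx x t)"
    using pc P2c P3c unfolding uxx_def case_prod_unfold by (intro continuous_intros)
  moreover have "((\<lambda>s. c - 2 * \<nu> * p x s) has_real_derivative ut x t) (at t within I)" if "t \<in> I" for x t
    unfolding ut_def by (auto intro!: derivative_eq_intros dpt[OF that])
  moreover have "((\<lambda>y. c - 2 * \<nu> * p y t) has_real_derivative ux x t) (at x)" if "t \<in> I" for x t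
    unfolding ux_def by (auto intro!: derivative_eq_intros dp[OF that])
  moreover have "((\<lambda>y. ux y t) has_real_derivative uxx x t) (at x)" if "t \<in> I" for x t
    unfolding ux_def uxx_def
    by (auto intro!: derivative_eq_intros dp[OF that] dP2[OF that] simp: power2_eq_square power3_eq_cube algebra_simps)
  moreover have "ut x t + (c - 2 * \<nu> * p x t) * ux x t - \<nu> * uxx x t = f x" if "t \<in> I" for x t
  proof -
    have 1: "pt x t = \<nu> * P2 x t - c * p x t + W x"
      using nz[OF that, of x] by (simp add: eq[OF that] pt_def P2_def p_def field_simps)
    have 2: "pxt x t = \<nu> * P3 x t - c * P2 x t + W' x + W x * p x t"
      using nz[OF that, of x] by (simp add: xt[OF that] pxt_def P2_def P3_def p_def field_simps)
    show ?thesis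
      unfolding ut_def ux_def uxx_def 1 2 f by (simp add: algebra_simps power2_eq_square power3_eq_cube)
  qed
  moreover have "periodic_2pi (\<lambda>x. c - 2 * \<nu> * p x t)" if "t \<in> I" for t
    using per[OF that] by (simp add: periodic_2pi_def p_def)
  ultimately show ?thesis
    unfolding burgers_solution_def Let_def I_def[symmetric] p_def[symmetric]
    by (intro conjI ballI allI exI[of _ ut] exI[of _ ux] exI[of _ uxx]) auto
qed

lemma decays_symbol_mult:
  assumes y: "decays (p + 2) B y" and "0 \<le> \<nu>"
  shows "decays p ((\<nu> + \<bar>c\<bar> + \<bar>q\<bar>) * B) (\<lambda>k. - (symbol \<nu> c k + of_real q) * y k)"
  unfolding decays_def
proof
  fix k
  let ?w = "1 + \<bar>real_of_int k\<bar>"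
  have w: "1 \<le> ?w\<^sup>2" "(real_of_int k)\<^sup>2 \<le> ?w\<^sup>2" "\<bar>real_of_int k\<bar> \<le> ?w\<^sup>2"
    by (auto simp: power2_eq_square algebra_simps)
  have "cmod (symbol \<nu> c k + of_real q) \<le> \<nu> * (real_of_int k)\<^sup>2 + \<bar>c\<bar> * \<bar>real_of_int k\<bar> + \<bar>q\<bar> * 1"
  proof -
    have "cmod (symbol \<nu> c k + of_real q) \<le> cmod (of_real (\<nu> * (real_of_int k)\<^sup>2)) + cmod (\<i> * of_real (c * of_int k)) + cmod (of_real q)"
      unfolding symbol_def by (meson add_mono norm_triangle_ineq order_refl order_trans)
    also have "\<dots> = \<nu> * (real_of_int k)\<^sup>2 + \<bar>c\<bar> * \<bar>real_of_int k\<bar> + \<bar>q\<bar> * 1"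
      unfolding norm_mult norm_of_real using \<open>0 \<le> \<nu>\<close> by (simp add: abs_mult)
    finally show ?thesis .
  qed
  also have "\<dots> \<le> \<nu> * ?w\<^sup>2 + \<bar>c\<bar> * ?w\<^sup>2 + \<bar>q\<bar> * ?w\<^sup>2"
    using w \<open>0 \<le> \<nu>\<close> by (intro add_mono mult_left_mono) auto
  finally have s: "cmod (symbol \<nu> c k + of_real q) \<le> (\<nu> + \<bar>c\<bar> + \<bar>q\<bar>) * ?w\<^sup>2" by (simp add: algebra_simps)
  have "cmod (- (symbol \<nu> c k + of_real q) * y k) * ?w ^ p = cmod (symbol \<nu> c k + of_real q) * (cmod (y k) * ?w ^ p)"
    by (simp only: norm_mult norm_minus_cancel mult.assoc)
  also have "\<dots> \<le> (\<nu> + \<bar>c\<bar> + \<bar>q\<bar>) * ?w\<^sup>2 * (cmod (y k) * ?w ^ p)"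
    by (rule mult_right_mono[OF s]) simp
  also have "\<dots> = (\<nu> + \<bar>c\<bar> + \<bar>q\<bar>) * (cmod (y k) * ?w ^ (p + 2))" by (simp only: power_add mult_ac)
  also have "\<dots> \<le> (\<nu> + \<bar>c\<bar> + \<bar>q\<bar>) * B"
    using \<open>0 \<le> \<nu>\<close> by (intro mult_left_mono decaysD[OF y]) auto
  finally show "cmod (- (symbol \<nu> c k + of_real q) * y k) * ?w ^ p \<le> (\<nu> + \<bar>c\<bar> + \<bar>q\<bar>) * B" .
qed

locale mode_flow =
  fixes \<nu> c q N :: real and V :: "int \<Rightarrow> complex" and y :: "real \<Rightarrow> int \<Rightarrow> complex"
    and pot f :: "real \<Rightarrow> real"
  assumes nu: "0 < \<nu>"
    and dec: "\<And>t. 0 \<le> t \<Longrightarrow> decays 5 N (y t)"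
    and ode: "\<And>t k. 0 \<le> t \<Longrightarrow> ((\<lambda>s. y s k) has_vector_derivative
          pot_conv V (y t) k - (symbol \<nu> c k + of_real q) * y t k) (at t within {0..})"
    and pot: "\<And>x. complex_of_real (pot x) = (\<Sum>j\<in>{-3..3}. V j * cis (of_int j * x))"
    and pot': "\<And>x. (pot has_real_derivative - f x / (2 * \<nu>)) (at x)"
begin

definition Y :: "nat \<Rightarrow> real \<Rightarrow> int \<Rightarrow> complex" where
  "Y m t k = (\<i> * of_int k) ^ m * y t k"

definition Yt :: "nat \<Rightarrow> real \<Rightarrow> int \<Rightarrow> complex" where
  "Yt m t k = (\<i> * of_int k) ^ m * (pot_conv V (y t) k - (symbol \<nu> c k + of_real q) * y t k)"

definition S :: "nat \<Rightarrow> real \<Rightarrow> real \<Rightarrow> real" where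
  "S m x t = Re (trig_series (Y m t) x)"

definition St :: "nat \<Rightarrow> real \<Rightarrow> real \<Rightarrow> real" where
  "St m x t = Re (trig_series (Yt m t) x)"

definition Nt :: real where
  "Nt = pot_norm V * (4 ^ 3 * N) + (\<nu> + \<bar>c\<bar> + \<bar>q\<bar>) * N"

lemma Y_Suc: "Y (Suc m) t = (\<lambda>k. \<i> * of_int k * Y m t k)"
  by (simp add: Y_def fun_eq_iff mult.assoc)

lemma Yt_Suc: "Yt (Suc m) t = (\<lambda>k. \<i> * of_int k * Yt m t k)"
  by (simp add: Yt_def fun_eq_iff mult.assoc)

lemma decays_Y: "0 \<le> t \<Longrightarrow> m \<le> 5 \<Longrightarrow> decays (5 - m) N (Y m t)"
proof (induction m)
  case 0
  then show ?case using dec[of t] by (simp add: Y_def[abs_def])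
next
  case (Suc m)
  then have "decays (5 - m) N (Y m t)" by simp
  moreover have "5 - m = Suc (5 - Suc m)" using Suc.prems by simp
  ultimately have "decays (Suc (5 - Suc m)) N (Y m t)" by (simp only:)
  then show ?case unfolding Y_Suc by (rule decays_deriv)
qed

lemma decays_Yt_0: "0 \<le> t \<Longrightarrow> decays 3 Nt (Yt 0 t)"
proof -
  assume t: "0 \<le> t"
  have "decays 3 Nt (\<lambda>k. pot_conv V (y t) k + - (symbol \<nu> c k + of_real q) * y t k)"
    unfolding Nt_def using dec[OF t] nu
    by (intro decays_add decays_pot_conv decays_symbol_mult) (auto intro: decays_mono)
  moreover have "(\<lambda>k. pot_conv V (y t) k + - (symbol \<nu> c k + of_real q) * y t k) = Yt 0 t"
    by (simp add: Yt_def fun_eq_iff algebra_simps)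
  ultimately show ?thesis by simp
qed

lemma decays_Yt: "0 \<le> t \<Longrightarrow> m \<le> 1 \<Longrightarrow> decays 2 Nt (Yt m t)"
  using decays_mono[OF decays_Yt_0[of t], of 2] decays_deriv[of 2 Nt "Yt 0 t"] decays_Yt_0[of t]
  by (cases m) (auto simp: Yt_Suc numeral_3_eq_3 numeral_2_eq_2)

lemma Y_has_vector_derivative:
  "0 \<le> t \<Longrightarrow> ((\<lambda>s. Y m s k) has_vector_derivative Yt m t k) (at t within {0..})"
  unfolding Y_def Yt_def by (rule has_vector_derivative_mult_right[OF ode])

lemma continuous_on_Y: "continuous_on {0..} (\<lambda>t. Y m t k)"
  unfolding continuous_on_eq_continuous_within
  using has_vector_derivative_continuous[OF Y_has_vector_derivative] by auto

lemma continuous_on_Yt: "continuous_on {0..} (\<lambda>t. Yt m t k)"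
proof -
  have "continuous_on {0..} (\<lambda>t. y t k)" for k
    using continuous_on_Y[of 0 k] by (simp add: Y_def)
  then show ?thesis unfolding Yt_def pot_conv_def by (intro continuous_intros)
qed

lemma continuous_on_S: "m \<le> 3 \<Longrightarrow> continuous_on (UNIV \<times> {0..}) (\<lambda>(x, t). S m x t)"
  using continuous_on_Re[OF continuous_on_trig_series[of "{0..}" "Y m" N, OF continuous_on_Y]]
    decays_mono[OF decays_Y[of _ m], of _ 2]
  by (auto simp: S_def case_prod_unfold)

lemma continuous_on_St: "m \<le> 1 \<Longrightarrow> continuous_on (UNIV \<times> {0..}) (\<lambda>(x, t). St m x t)"
  using continuous_on_Re[OF continuous_on_trig_series[of "{0..}" "Yt m" Nt, OF continuous_on_Yt]]
    decays_Yt
  by (auto simp: St_def case_prod_unfold)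

lemma Re_has_real_derivative:
  "(g has_vector_derivative g') F \<Longrightarrow> ((\<lambda>x. Re (g x)) has_real_derivative Re g') F"
  unfolding has_real_derivative_iff_has_vector_derivative
  by (rule bounded_linear.has_vector_derivative[OF bounded_linear_Re])

lemma S_deriv: "0 \<le> t \<Longrightarrow> m \<le> 2 \<Longrightarrow> ((\<lambda>x. S m x t) has_real_derivative S (Suc m) x t) (at x)"
  unfolding S_def Y_Suc
  by (rule Re_has_real_derivative, rule trig_series_has_vector_derivative[of N], rule decays_mono[OF decays_Y]) auto

lemma St_deriv: "0 \<le> t \<Longrightarrow> ((\<lambda>x. St 0 x t) has_real_derivative St (Suc 0) x t) (at x)"
  unfolding St_def Yt_Suc
  by (rule Re_has_real_derivative, rule trig_series_has_vector_derivative[of Nt], rule decays_Yt_0)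

lemma S_time_deriv:
  assumes "0 \<le> t" "m \<le> 1"
  shows "((\<lambda>s. S m x s) has_real_derivative St m x t) (at t within {0..})"
  unfolding S_def St_def
proof (intro Re_has_real_derivative trig_series_has_time_derivative)
  show "decays 2 N (Y m t)" if "t \<in> {0..}" for t
    using decays_mono[OF decays_Y[of t m], of 2] that assms by auto
  show "decays 2 Nt (Yt m t)" if "t \<in> {0..}" for t using decays_Yt[of t m] that assms by auto
qed (use assms Y_has_vector_derivative in auto)

lemma S_equation:
  assumes "0 \<le> t"
  shows "St 0 x t = \<nu> * S 2 x t - c * S 1 x t + (pot x - q) * S 0 x t"
proof -
  have s: "(\<lambda>k. cmod (Y m t k)) summable_on UNIV" if "m \<le> 3" for m
    using decays_abs_summable(3)[OF decays_mono[OF decays_Y[OF assms, of m], of 2]] that by auto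
  have sm: "(\<lambda>k. cmod (a * Y m t k)) summable_on UNIV" if "m \<le> 3" for m a
    using summable_on_cmult_right[OF s[OF that], of "cmod a"] by (simp add: norm_mult)
  have y0: "Y 0 t = y t" by (simp add: Y_def[abs_def])
  have conv: "(\<lambda>k. cmod (pot_conv V (Y 0 t) k)) summable_on UNIV"
    "trig_series (pot_conv V (Y 0 t)) x = of_real (pot x) * trig_series (Y 0 t) x"
    using trig_series_convolution[of "{-3..3}" "Y 0 t" V] s[of 0] pot[of x]
    by (auto simp: pot_conv_def[abs_def])
  have "Yt 0 t = (\<lambda>k. (pot_conv V (Y 0 t) k - of_real q * Y 0 t k) + (of_real \<nu> * Y 2 t k - of_real c * Y 1 t k))"
    unfolding y0 by (rule ext) (simp add: Yt_def Y_def symbol_def power2_eq_square algebra_simps)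
  moreover have "(\<lambda>k. cmod (pot_conv V (Y 0 t) k - of_real q * Y 0 t k)) summable_on UNIV"
    by (rule Infinite_Sum.abs_summable_on_comparison_test'[OF summable_on_add[OF conv(1) sm[of 0 "of_real q"]]])
      (auto intro: norm_triangle_ineq4)
  moreover have "(\<lambda>k. cmod (of_real \<nu> * Y 2 t k - of_real c * Y 1 t k)) summable_on UNIV"
    by (rule Infinite_Sum.abs_summable_on_comparison_test'[OF summable_on_add[OF sm[of 2 "of_real \<nu>"] sm[of 1 "of_real c"]]])
      (auto intro: norm_triangle_ineq4)
  ultimately have "trig_series (Yt 0 t) x = (trig_series (pot_conv V (Y 0 t)) x - trig_series (\<lambda>k. of_real q * Y 0 t k) x)
      + (trig_series (\<lambda>k. of_real \<nu> * Y 2 t k) x - trig_series (\<lambda>k. of_real c * Y 1 t k) x)"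
    by (simp add: trig_series_add trig_series_diff conv(1) sm)
  then have "Re (trig_series (Yt 0 t) x) = Re ((of_real (pot x) * trig_series (Y 0 t) x - of_real q * trig_series (Y 0 t) x)
      + (of_real \<nu> * trig_series (Y 2 t) x - of_real c * trig_series (Y 1 t) x))"
    by (simp only: trig_series_mult conv(2))
  then show ?thesis by (simp add: St_def S_def algebra_simps)
qed

lemma periodic_S: "periodic_2pi (\<lambda>x. S m x t)"
  by (simp add: periodic_2pi_def S_def periodic_trig_series)

lemma interval_inf: "{t. 0 \<le> t \<and> ereal t < \<infinity>} = {0..}" by auto

lemma burgers_solution_cole_hopf:
  assumes "\<And>x t. 0 \<le> t \<Longrightarrow> S 0 x t \<noteq> 0"
  shows "burgers_solution \<nu> f \<infinity> (\<lambda>x t. c - 2 * \<nu> * (S 1 x t / S 0 x t))"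
proof (rule cole_hopf_solution[where \<phi>xx = "S 2" and \<phi>xxx = "S 3" and \<phi>t = "St 0" and \<phi>xt = "St 1"
      and W = "\<lambda>x. pot x - q" and W' = "\<lambda>x. - f x / (2 * \<nu>)"], unfold interval_inf)
  show "((\<lambda>x. pot x - q) has_real_derivative - f x / (2 * \<nu>)) (at x)" for x
    using DERIV_diff[OF pot' DERIV_const] by simp
qed (use assms nu periodic_S continuous_on_S continuous_on_St S_equation S_deriv[of _ 0] S_deriv[of _ 1] S_deriv[of _ 2]
    St_deriv S_time_deriv[of _ 0] S_time_deriv[of _ 1] in \<open>auto simp: numeral_2_eq_2 numeral_3_eq_3\<close>)

lemma S_positive:
  assumes init: "\<And>x. 0 < S 0 x 0" and t: "0 \<le> t"
  shows "0 < S 0 x t"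
proof -
  have S0c: "continuous_on (UNIV \<times> {0..}) (\<lambda>(x, t). S 0 x t)" by (rule continuous_on_S) simp
  have "continuous_on UNIV (\<lambda>x. S 0 x 0)"
    by (rule has_real_derivative_continuous_on[OF S_deriv]) auto
  then obtain x0 where m: "\<And>x. S 0 x0 0 \<le> S 0 x 0"
    using continuous_periodic_attains_inf[OF _ periodic_S] by metis
  define m where "m = S 0 x0 0"
  have m0: "0 < m" using init by (simp add: m_def)
  have "continuous_on {0..2*pi} (\<lambda>x. \<bar>pot x - q\<bar>)"
    using has_real_derivative_continuous_on[OF pot'] by (intro continuous_intros) auto
  then have "\<exists>x1\<in>{0..2*pi}. \<forall>x\<in>{0..2*pi}. \<bar>pot x - q\<bar> \<le> \<bar>pot x1 - q\<bar>"
    by (intro continuous_attains_sup) auto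
  then obtain x1 where L: "\<And>x. x \<in> {0..2*pi} \<Longrightarrow> \<bar>pot x - q\<bar> \<le> \<bar>pot x1 - q\<bar>"
    by blast
  define L where "L = \<bar>pot x1 - q\<bar>"
  have "m * exp (- L * t) - S 0 x t \<le> 0"
  proof (rule periodic_max_principle[where T = t and \<nu> = \<nu> and z = "\<lambda>x t. m * exp (- L * t) - S 0 x t"
        and zt = "\<lambda>x t. - L * m * exp (- L * t) - St 0 x t" and zx = "\<lambda>x t. - S 1 x t" and zxx = "\<lambda>x t. - S 2 x t"
        and b = "\<lambda>x t. - c" and q = "\<lambda>x t. pot x - q" and Q = L])
    show "continuous_on (UNIV \<times> {0..t}) (\<lambda>(x, t). m * exp (- L * t) - S 0 x t)"
    proof -
      have "continuous_on (UNIV \<times> {0..t}) (\<lambda>(x, t). S 0 x t)" by (rule continuous_on_subset[OF S0c]) auto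
      then show ?thesis unfolding case_prod_unfold by (intro continuous_intros)
    qed
    show "periodic_2pi (\<lambda>x. m * exp (- L * t) - S 0 x t)" for t
      using periodic_S[of 0 t] by (simp add: periodic_2pi_def)
    show "((\<lambda>s. m * exp (- L * s) - S 0 x s) has_real_derivative - L * m * exp (- L * s) - St 0 x s) (at s within {0..t})"
      if "s \<in> {0..t}" for x s
      using that by (auto intro!: derivative_eq_intros DERIV_subset[OF S_time_deriv[of s 0 x]])
    show "((\<lambda>y. m * exp (- L * s) - S 0 y s) has_real_derivative - S 1 x s) (at x)" if "s \<in> {0..t}" for x s
      using that S_deriv[of s 0 x] by (auto intro!: derivative_eq_intros)
    show "((\<lambda>y. - S 1 y s) has_real_derivative - S 2 x s) (at x)" if "s \<in> {0..t}" for x s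
      using that S_deriv[of s 1 x] by (auto intro!: derivative_eq_intros simp: numeral_2_eq_2)
    show "- L * m * exp (- L * s) - St 0 x s \<le> \<nu> * - S 2 x s + - c * - S 1 x s + (pot x - q) * (m * exp (- L * s) - S 0 x s)"
      if "x \<in> {0..2*pi}" "s \<in> {0..t}" for x s
    proof -
      have "- L * (m * exp (- L * s)) \<le> (pot x - q) * (m * exp (- L * s))"
        using L[OF that(1)] m0 by (intro mult_right_mono) (auto simp: L_def)
      then show ?thesis using S_equation[of s x] that by (simp add: algebra_simps)
    qed
    show "pot x - q \<le> L" if "x \<in> {0..2*pi}" for x using L[OF that] by (simp add: L_def)
  qed (use t nu m in \<open>auto simp: m_def\<close>)
  moreover have "0 < m * exp (- L * t)" using m0 by simp
  ultimately show ?thesis by linarith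
qed

end

section \<open>Uniqueness for the Burgers equation\<close>

lemma jointly_continuous_from_partials:
  fixes u :: "real \<Rightarrow> real \<Rightarrow> real"
  assumes ut: "\<And>x t. t \<in> I \<Longrightarrow> ((\<lambda>s. u x s) has_real_derivative ut x t) (at t within I)"
    and ux: "\<And>x t. t \<in> I \<Longrightarrow> ((\<lambda>y. u y t) has_real_derivative ux x t) (at x)"
    and uxc: "continuous_on (UNIV \<times> I) (\<lambda>(x, t). ux x t)"
  shows "continuous_on (UNIV \<times> I) (\<lambda>(x, t). u x t)"
proof -
  have swap: "continuous_on (I \<times> UNIV) (\<lambda>(t, x). ux x t)"
    using continuous_on_compose2[OF uxc continuous_on_swap, of "I \<times> UNIV"]
    by (simp add: case_prod_unfold prod.swap_def image_subset_iff)
  have "continuous_on (I \<times> UNIV) (\<lambda>(t, x). u x t)"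
    unfolding continuous_on_eq_continuous_within
  proof
    fix p assume "p \<in> I \<times> (UNIV :: real set)"
    then obtain t x where p: "p = (t, x)" and t: "t \<in> I" by auto
    have "((\<lambda>(t, x). u x t) has_derivative (\<lambda>(dt, dx). ut x t * dt + blinfun_apply (blinfun_scaleR_left (ux x t)) dx))
        (at (t, x) within I \<times> UNIV)"
    proof (rule has_derivative_partialsI)
      show "((\<lambda>t. u x t) has_derivative (\<lambda>dt. ut x t * dt)) (at t within I)"
        using ut[OF t] by (simp add: has_field_derivative_def)
      show "((\<lambda>x. u x t) has_derivative blinfun_apply (blinfun_scaleR_left (ux x t))) (at x within UNIV)"
        if "t \<in> I" for t x
        using ux[OF that, of x] by (simp add: has_field_derivative_def mult_commute_abs)
      have "continuous_on (I \<times> UNIV) (\<lambda>(t, x). blinfun_scaleR_left (ux x t))"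
        using bounded_linear.continuous_on[OF bounded_linear_blinfun_scaleR_left swap]
        by (simp add: case_prod_unfold)
      then show "continuous (at (t, x) within I \<times> UNIV) (\<lambda>(t, x). blinfun_scaleR_left (ux x t))"
        using t by (simp add: continuous_on_eq_continuous_within)
    qed auto
    then show "continuous (at p within I \<times> UNIV) (\<lambda>(t, x). u x t)"
      unfolding p by (rule has_derivative_continuous)
  qed
  then show ?thesis
    using continuous_on_compose2[OF _ continuous_on_swap, of "I \<times> UNIV" "\<lambda>(t, x). u x t" "UNIV \<times> I"]
    by (simp add: case_prod_unfold prod.swap_def image_subset_iff)
qed

lemma burgers_solution_on_interval:
  assumes "burgers_solution \<nu> f T u" and "ereal \<tau> < T"
  obtains ut ux uxx where
    "\<And>t. t \<in> {0..\<tau>} \<Longrightarrow> periodic_2pi (\<lambda>x. u x t)"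
    "continuous_on (UNIV \<times> {0..\<tau>}) (\<lambda>(x, t). u x t)"
    "continuous_on (UNIV \<times> {0..\<tau>}) (\<lambda>(x, t). ux x t)"
    "\<And>x t. t \<in> {0..\<tau>} \<Longrightarrow> ((\<lambda>s. u x s) has_real_derivative ut x t) (at t within {0..\<tau>})"
    "\<And>x t. t \<in> {0..\<tau>} \<Longrightarrow> ((\<lambda>y. u y t) has_real_derivative ux x t) (at x)"
    "\<And>x t. t \<in> {0..\<tau>} \<Longrightarrow> ((\<lambda>y. ux y t) has_real_derivative uxx x t) (at x)"
    "\<And>x t. t \<in> {0..\<tau>} \<Longrightarrow> ut x t + u x t * ux x t - \<nu> * uxx x t = f x"
proof -
  define I where "I = {t. 0 \<le> t \<and> ereal t < T}"
  have sub: "{0..\<tau>} \<subseteq> I"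
    using assms(2) by (auto simp: I_def intro: le_less_trans[of "ereal _" "ereal \<tau>"])
  obtain ut ux uxx where *:
    "continuous_on (UNIV \<times> I) (\<lambda>(x, t). ux x t)"
    "\<forall>x. \<forall>t\<in>I.
       ((\<lambda>s. u x s) has_real_derivative ut x t) (at t within I) \<and>
       ((\<lambda>y. u y t) has_real_derivative ux x t) (at x) \<and>
       ((\<lambda>y. ux y t) has_real_derivative uxx x t) (at x) \<and>
       ut x t + u x t * ux x t - \<nu> * uxx x t = f x"
    and per: "\<forall>t\<in>I. periodic_2pi (\<lambda>x. u x t)"
    using assms(1) unfolding burgers_solution_def Let_def I_def[symmetric] by auto
  have c: "continuous_on (UNIV \<times> I) (\<lambda>(x, t). u x t)"
    by (rule jointly_continuous_from_partials[OF _ _ *(1)]) (use *(2) in auto)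
  have sub': "UNIV \<times> {0..\<tau>} \<subseteq> UNIV \<times> I" using sub by auto
  show ?thesis
  proof (rule that)
    show "\<And>t. t \<in> {0..\<tau>} \<Longrightarrow> periodic_2pi (\<lambda>x. u x t)" using per sub by blast
    show "continuous_on (UNIV \<times> {0..\<tau>}) (\<lambda>(x, t). u x t)" by (rule continuous_on_subset[OF c sub'])
    show "continuous_on (UNIV \<times> {0..\<tau>}) (\<lambda>(x, t). ux x t)" by (rule continuous_on_subset[OF *(1) sub'])
    show "\<And>x t. t \<in> {0..\<tau>} \<Longrightarrow> ((\<lambda>s. u x s) has_real_derivative ut x t) (at t within {0..\<tau>})"
      using *(2) sub by (blast intro: DERIV_subset)
    show "\<And>x t. t \<in> {0..\<tau>} \<Longrightarrow> ((\<lambda>y. u y t) has_real_derivative ux x t) (at x)" using *(2) sub by blast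
    show "\<And>x t. t \<in> {0..\<tau>} \<Longrightarrow> ((\<lambda>y. ux y t) has_real_derivative uxx x t) (at x)" using *(2) sub by blast
    show "\<And>x t. t \<in> {0..\<tau>} \<Longrightarrow> ut x t + u x t * ux x t - \<nu> * uxx x t = f x" using *(2) sub by blast
  qed
qed

lemma burgers_comparison:
  assumes u: "burgers_solution \<nu> f T u" and w: "burgers_solution \<nu> f T' w" and nu: "0 \<le> \<nu>"
    and init: "\<And>x. u x 0 \<le> w x 0" and t: "0 \<le> t" "ereal t < T" "ereal t < T'"
  shows "u x t \<le> w x t"
proof -
  obtain ut ux uxx where u:
    "\<And>s. s \<in> {0..t} \<Longrightarrow> periodic_2pi (\<lambda>x. u x s)"
    "continuous_on (UNIV \<times> {0..t}) (\<lambda>(x, t). u x t)"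
    "continuous_on (UNIV \<times> {0..t}) (\<lambda>(x, t). ux x t)"
    "\<And>x s. s \<in> {0..t} \<Longrightarrow> ((\<lambda>s. u x s) has_real_derivative ut x s) (at s within {0..t})"
    "\<And>x s. s \<in> {0..t} \<Longrightarrow> ((\<lambda>y. u y s) has_real_derivative ux x s) (at x)"
    "\<And>x s. s \<in> {0..t} \<Longrightarrow> ((\<lambda>y. ux y s) has_real_derivative uxx x s) (at x)"
    "\<And>x s. s \<in> {0..t} \<Longrightarrow> ut x s + u x s * ux x s - \<nu> * uxx x s = f x"
    by (rule burgers_solution_on_interval[OF u t(2)]) (rule that)
  obtain wt wx wxx where w:
    "\<And>s. s \<in> {0..t} \<Longrightarrow> periodic_2pi (\<lambda>x. w x s)"
    "continuous_on (UNIV \<times> {0..t}) (\<lambda>(x, t). w x t)"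
    "continuous_on (UNIV \<times> {0..t}) (\<lambda>(x, t). wx x t)"
    "\<And>x s. s \<in> {0..t} \<Longrightarrow> ((\<lambda>s. w x s) has_real_derivative wt x s) (at s within {0..t})"
    "\<And>x s. s \<in> {0..t} \<Longrightarrow> ((\<lambda>y. w y s) has_real_derivative wx x s) (at x)"
    "\<And>x s. s \<in> {0..t} \<Longrightarrow> ((\<lambda>y. wx y s) has_real_derivative wxx x s) (at x)"
    "\<And>x s. s \<in> {0..t} \<Longrightarrow> wt x s + w x s * wx x s - \<nu> * wxx x s = f x"
    by (rule burgers_solution_on_interval[OF w t(3)]) (rule that)
  have "continuous_on ({0..2*pi} \<times> {0..t}) (\<lambda>(x, t). ux x t)"
    by (rule continuous_on_subset[OF u(3)]) auto
  then have "bounded ((\<lambda>(x, t). ux x t) ` ({0..2*pi} \<times> {0..t}))"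
    by (intro compact_imp_bounded compact_continuous_image compact_Times compact_Icc)
  then obtain Q where "\<forall>y \<in> (\<lambda>(x, t). ux x t) ` ({0..2*pi} \<times> {0..t}). \<bar>y\<bar> \<le> Q"
    unfolding bounded_real by blast
  then have Q: "\<bar>ux x s\<bar> \<le> Q" if "x \<in> {0..2*pi}" "s \<in> {0..t}" for x s
    using that by (metis (no_types, lifting) SigmaI case_prod_conv imageI)
  have "u x t - w x t \<le> 0"
  proof (rule periodic_max_principle[where T = t and \<nu> = \<nu> and z = "\<lambda>x t. u x t - w x t"
        and zt = "\<lambda>x t. ut x t - wt x t" and zx = "\<lambda>x t. ux x t - wx x t" and zxx = "\<lambda>x t. uxx x t - wxx x t"
        and b = "\<lambda>x t. - w x t" and q = "\<lambda>x t. - ux x t" and Q = Q])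
    show "continuous_on (UNIV \<times> {0..t}) (\<lambda>(x, t). u x t - w x t)"
      using u(2) w(2) unfolding case_prod_unfold by (rule continuous_on_diff)
    show "periodic_2pi (\<lambda>x. u x s - w x s)" if "s \<in> {0..t}" for s
      using u(1)[OF that] w(1)[OF that] by (simp add: periodic_2pi_def)
    show "((\<lambda>s. u x s - w x s) has_real_derivative ut x s - wt x s) (at s within {0..t})" if "s \<in> {0..t}" for x s
      by (rule DERIV_diff[OF u(4)[OF that] w(4)[OF that]])
    show "((\<lambda>y. u y s - w y s) has_real_derivative ux x s - wx x s) (at x)" if "s \<in> {0..t}" for x s
      by (rule DERIV_diff[OF u(5)[OF that] w(5)[OF that]])
    show "((\<lambda>y. ux y s - wx y s) has_real_derivative uxx x s - wxx x s) (at x)" if "s \<in> {0..t}" for x s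
      by (rule DERIV_diff[OF u(6)[OF that] w(6)[OF that]])
    show "ut x s - wt x s \<le> \<nu> * (uxx x s - wxx x s) + - w x s * (ux x s - wx x s) + - ux x s * (u x s - w x s)"
      if "s \<in> {0..t}" for x s
      using u(7)[OF that, of x] w(7)[OF that, of x] by (simp add: algebra_simps)
    show "- ux x s \<le> Q" if "x \<in> {0..2*pi}" "s \<in> {0..t}" for x s using Q[OF that] by simp
  qed (use t nu init in auto)
  then show ?thesis by simp
qed

lemma burgers_ivp_unique:
  assumes "burgers_ivp_solution \<nu> f u0 T u" "burgers_ivp_solution \<nu> f u0 T' w" "0 \<le> \<nu>"
    "0 \<le> t" "ereal t < T" "ereal t < T'"
  shows "u x t = w x t"
  using assms burgers_comparison[of \<nu> f T u T' w t x] burgers_comparison[of \<nu> f T' w T u t x]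
  unfolding burgers_ivp_solution_def by (auto intro: antisym)

lemma burgers_steady_state_derivs:
  assumes "burgers_steady_state \<nu> f v"
  obtains v' v'' where "periodic_2pi v" "\<And>x. (v has_real_derivative v' x) (at x)"
    "\<And>x. (v' has_real_derivative v'' x) (at x)" "continuous_on UNIV v''" "\<And>x. v x * v' x - \<nu> * v'' x = f x"
proof -
  have I: "{t. 0 \<le> t \<and> ereal t < \<infinity>} = {0..}" by auto
  obtain ut ux uxx where *:
    "continuous_on (UNIV \<times> {0..}) (\<lambda>(x, t). uxx x t)"
    "\<forall>x. \<forall>t\<in>{0..}.
       ((\<lambda>s. v x) has_real_derivative ut x t) (at t within {0..}) \<and>
       ((\<lambda>y. v y) has_real_derivative ux x t) (at x) \<and>
       ((\<lambda>y. ux y t) has_real_derivative uxx x t) (at x) \<and>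
       ut x t + v x * ux x t - \<nu> * uxx x t = f x"
    and per: "\<forall>t\<in>{0::real..}. periodic_2pi (\<lambda>x. v x)"
    using assms unfolding burgers_steady_state_def burgers_solution_def Let_def I by auto
  have ut: "ut x 1 = 0" for x
  proof -
    have "((\<lambda>s. v x) has_real_derivative ut x 1) (at 1 within {0..})" using *(2) by auto
    then have "((\<lambda>s. v x) has_real_derivative ut x 1) (at 1)"
      using at_within_interior[of "1::real" "{0..}"] by simp
    then show ?thesis using DERIV_unique[OF _ DERIV_const] by blast
  qed
  have "continuous_on UNIV (\<lambda>x. uxx x 1)"
    using continuous_on_compose2[OF *(1), of UNIV "\<lambda>x. (x, 1)"]
    by (simp add: image_subset_iff continuous_on_Pair continuous_on_id continuous_on_const)
  moreover note 1 = bspec[OF spec[OF *(2)], of 1, simplified]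
  moreover have "periodic_2pi v" using bspec[OF per, of 1] by simp
  ultimately show ?thesis
    using ut that[of "\<lambda>x. ux x 1" "\<lambda>x. uxx x 1"] by (simp add: 1)
qed

lemma burgers_steady_state_C_4:
  assumes v: "burgers_steady_state \<nu> f v" and f: "times_differentiable 2 f" and nu: "0 < \<nu>"
  shows "C_k 4 v"
proof -
  obtain v' v'' where v: "\<And>x. (v has_real_derivative v' x) (at x)"
    "\<And>x. (v' has_real_derivative v'' x) (at x)" "continuous_on UNIV v''" "\<And>x. v x * v' x - \<nu> * v'' x = f x"
    using burgers_steady_state_derivs[OF v] by metis
  have v'': "v'' = (\<lambda>x. (1 / \<nu>) * (v x * v' x + (- 1) * f x))"
  proof
    fix x show "v'' x = (1 / \<nu>) * (v x * v' x + (- 1) * f x)"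
      using v(4)[of x] nu by (simp add: field_simps)
  qed
  have step: "times_differentiable (Suc n) v'' \<and> times_differentiable (Suc (Suc n)) v' \<and> times_differentiable (Suc (Suc (Suc n))) v"
    if "times_differentiable (Suc n) v'" "times_differentiable (Suc n) v" "Suc n \<le> 2" for n
  proof -
    have 2: "times_differentiable (Suc n) v''"
      unfolding v''
      by (rule times_differentiable_mult[OF times_differentiable_const times_differentiable_add[OF
          times_differentiable_mult[OF that(2,1)]
          times_differentiable_mult[OF times_differentiable_const times_differentiable_mono[OF f that(3)]]]])
    then have 1: "times_differentiable (Suc (Suc n)) v'"
      using v(2) unfolding times_differentiable.simps(2)[of "Suc n"] by blast
    then show ?thesis
      using 2 v(1) unfolding times_differentiable.simps(2)[of "Suc (Suc n)"] by blast
  qed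
  have 0: "times_differentiable (Suc 0) v'" using v(2,3) by auto
  then have "times_differentiable (Suc (Suc 0)) v"
    using v(1) unfolding times_differentiable.simps(2)[of "Suc 0"] by blast
  then have "times_differentiable (Suc 0) v" by (rule times_differentiable_SucD)
  from step[OF 0 this] have "times_differentiable (Suc (Suc 0)) v'" "times_differentiable (Suc (Suc (Suc 0))) v"
    by (simp_all only:)
  from step[OF this(1) times_differentiable_SucD[OF this(2)]] have "times_differentiable (Suc (Suc (Suc (Suc 0)))) v" by (simp only:)
  then show ?thesis by (simp add: C_k_iff_times_differentiable eval_nat_numeral)
qed

section \<open>The global attractor\<close>

lemma linear_evolution_exists_real:
  assumes nu: "0 \<le> \<nu>" and init: "decays 5 B y0" and K: "0 < K" "2 * 4 ^ 5 * pot_norm V \<le> K"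
    and V: "\<And>j. V (- j) = cnj (V j)" and y0: "\<And>k. y0 (- k) = cnj (y0 k)"
  obtains y N where "y 0 = y0" "\<And>t. 0 \<le> t \<Longrightarrow> decays 5 N (y t)" "\<And>t k. y t (- k) = cnj (y t k)"
    "\<And>k t. 0 \<le> t \<Longrightarrow> ((\<lambda>s. y s k) has_vector_derivative
        pot_conv V (y t) k - (symbol \<nu> c k + of_real K) * y t k) (at t within {0..})"
proof -
  obtain x N where x: "x 0 = y0" "\<And>t. 0 \<le> t \<Longrightarrow> decays 5 N (x t)"
    "\<And>k t. 0 \<le> t \<Longrightarrow> ((\<lambda>s. x s k) has_vector_derivative
        pot_conv V (x t) k - (symbol \<nu> c k + of_real K) * x t k) (at t within {0..})"
    using linear_evolution_exists[OF nu init K] by metis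
  define y where "y t k = (x t k + cnj (x t (- k))) / 2" for t k
  show ?thesis
  proof
    show "y 0 = y0" using y0 by (simp add: y_def fun_eq_iff x(1))
    show "y t (- k) = cnj (y t k)" for t k by (simp add: y_def add.commute)
    show "decays 5 N (y t)" if "0 \<le> t" for t
      unfolding decays_def
    proof
      fix k
      have "cmod (y t k) \<le> (cmod (x t k) + cmod (x t (- k))) / 2"
        using norm_triangle_ineq[of "x t k" "cnj (x t (- k))"] by (simp add: y_def norm_divide)
      then have "cmod (y t k) * (1 + \<bar>real_of_int k\<bar>) ^ 5 \<le> ((cmod (x t k) + cmod (x t (- k))) / 2) * (1 + \<bar>real_of_int k\<bar>) ^ 5"
        by (rule mult_right_mono) simp
      also have "\<dots> \<le> N"
        using decaysD[OF x(2)[OF that], of k] decaysD[OF x(2)[OF that], of "- k"] by (simp add: distrib_right)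
      finally show "cmod (y t k) * (1 + \<bar>real_of_int k\<bar>) ^ 5 \<le> N" .
    qed
    fix k t assume t: "(0::real) \<le> t"
    have "cnj (pot_conv V (x t) (- k)) = pot_conv V (\<lambda>k. cnj (x t (- k))) k"
    proof -
      have "pot_conv V (x t) (- k) = (\<Sum>j\<in>{-3..3}. V (- j) * x t (- k - (- j)))"
        unfolding pot_conv_def by (rule sum.reindex_bij_witness[where i = uminus and j = uminus]) auto
      then show ?thesis by (simp add: pot_conv_def V algebra_simps)
    qed
    then have r: "cnj (pot_conv V (x t) (- k) - (symbol \<nu> c (- k) + of_real K) * x t (- k))
        = pot_conv V (\<lambda>k. cnj (x t (- k))) k - (symbol \<nu> c k + of_real K) * cnj (x t (- k))"
      by (simp add: symbol_uminus)
    have p: "pot_conv V (y t) k = (1/2) * (pot_conv V (x t) k + pot_conv V (\<lambda>k. cnj (x t (- k))) k)"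
      by (simp add: pot_conv_def y_def sum.distrib[symmetric] sum_divide_distrib distrib_left add_divide_distrib)
    have half: "1/2 * (A - m * a + (B - m * b)) = 1/2 * (A + B) - m * (1/2 * (a + b))" for A B m a b :: complex
      by (simp add: field_simps)
    have "((\<lambda>s. cnj (x s (- k))) has_vector_derivative
        cnj (pot_conv V (x t) (- k) - (symbol \<nu> c (- k) + of_real K) * x t (- k))) (at t within {0..})"
      by (rule bounded_linear.has_vector_derivative[OF bounded_linear_cnj x(3)[OF t]])
    from has_vector_derivative_mult_right[OF has_vector_derivative_add[OF x(3)[OF t, of k] this], of "1/2"]
    have "((\<lambda>s. 1/2 * (x s k + cnj (x s (- k)))) has_vector_derivative
        pot_conv V (y t) k - (symbol \<nu> c k + of_real K) * (1/2 * (x t k + cnj (x t (- k))))) (at t within {0..})"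
      unfolding r p half .
    then show "((\<lambda>s. y s k) has_vector_derivative
        pot_conv V (y t) k - (symbol \<nu> c k + of_real K) * y t k) (at t within {0..})"
      by (simp add: y_def)
  qed
qed

lemma periodic_2piI:
  assumes "\<And>x. g (x + 2 * pi) = g x"
  shows "periodic_2pi g"
proof -
  have n: "g (x + 2 * of_nat n * pi) = g x" for x n
  proof (induction n)
    case (Suc n)
    have "g (x + 2 * of_nat (Suc n) * pi) = g ((x + 2 * of_nat n * pi) + 2 * pi)" by (simp add: algebra_simps)
    then show ?case using assms Suc.IH by simp
  qed simp
  have "g (x + 2 * of_int k * pi) = g x" for x k
  proof (cases k rule: int_cases2)
    case (nonneg n)
    then show ?thesis using n[of x n] by simp
  next
    case (nonpos n)
    then show ?thesis using n[of "x + 2 * of_int k * pi" n] by simp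
  qed
  then show ?thesis by (simp add: periodic_2pi_def)
qed

lemma cole_hopf_initial:
  assumes u0: "times_differentiable 4 u0" "periodic_2pi u0" "integral {0..2*pi} u0 = 2 * pi * c"
  obtains \<phi> where "times_differentiable 5 \<phi>" "periodic_2pi \<phi>" "\<And>x. 0 < \<phi> x"
    "\<And>x. (\<phi> has_real_derivative - ((u0 x - c) / (2 * \<nu>)) * \<phi> x) (at x)"
proof -
  have u0c: "continuous_on UNIV u0" using times_differentiable_mono[OF u0(1), of 0] by simp
  then have ic: "isCont (\<lambda>x. u0 x - c) x" for x
    by (intro continuous_intros) (simp add: continuous_on_eq_continuous_at)
  have "\<exists>U. \<forall>x::real. -\<infinity> < ereal x \<longrightarrow> ereal x < \<infinity> \<longrightarrow> (U has_vector_derivative u0 x - c) (at x)"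
    by (rule einterval_antiderivative) (auto intro: ic)
  then obtain U where U: "\<And>x. (U has_real_derivative u0 x - c) (at x)"
    by (auto simp: has_real_derivative_iff_has_vector_derivative)
  have "((\<lambda>x. u0 x - c) has_integral U (2*pi) - U 0) {0..2*pi}"
    by (rule fundamental_theorem_of_calculus)
      (use U in \<open>auto simp: has_real_derivative_iff_has_vector_derivative intro: has_vector_derivative_at_within\<close>)
  moreover have "((\<lambda>x. u0 x - c) has_integral integral {0..2*pi} u0 - 2 * pi * c) {0..2*pi}"
  proof -
    have "u0 integrable_on {0..2*pi}"
      by (intro integrable_continuous_interval continuous_on_subset[OF u0c]) auto
    from has_integral_diff[OF integrable_integral[OF this] has_integral_const_real[of c 0 "2*pi"]]
    show ?thesis by simp
  qed
  ultimately have "U (2*pi) - U 0 = integral {0..2*pi} u0 - 2 * pi * c" by (rule has_integral_unique)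
  then have U2: "U (2*pi) = U 0" using u0(3) by simp
  have Uper: "U (x + 2*pi) = U x" for x
  proof -
    have "((\<lambda>x. U (x + 2*pi) - U x) has_real_derivative 0) (at x)" for x
    proof -
      have "((\<lambda>x. U (x + 2*pi)) has_real_derivative u0 (x + 2*pi) - c) (at x)"
        using U[of "x + 2*pi"] by (subst (asm) DERIV_shift)
      from DERIV_diff[OF this U[of x]] show ?thesis using periodic_2piD[OF u0(2), of x 1] by simp
    qed
    from DERIV_isconst_all[OF allI[OF this], of x 0] show ?thesis using U2 by simp
  qed
  define \<phi> where "\<phi> x = exp (- 1 / (2 * \<nu>) * U x)" for x
  have d: "(\<phi> has_real_derivative - ((u0 x - c) / (2 * \<nu>)) * \<phi> x) (at x)" for x
    unfolding \<phi>_def using DERIV_fun_exp[OF DERIV_cmult[OF U[of x], of "- 1 / (2 * \<nu>)"]] by (simp add: mult.commute)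
  have w: "times_differentiable 4 (\<lambda>x. - ((u0 x - c) / (2 * \<nu>)))"
    using times_differentiable_mult[OF times_differentiable_const[of 4 "- 1 / (2 * \<nu>)"]
        times_differentiable_add[OF u0(1) times_differentiable_const[of 4 "- c"]]]
    by simp
  show ?thesis
  proof
    show "times_differentiable 5 \<phi>"
    proof -
      have five: "(5::nat) = Suc 4" by simp
      show ?thesis unfolding five by (rule times_differentiable_linear_ode[OF d w])
    qed
    show "periodic_2pi \<phi>" by (rule periodic_2piI) (simp add: \<phi>_def Uper)
  qed (use d in \<open>auto simp: \<phi>_def\<close>)
qed

lemma norm_trig_series_ge:
  assumes "y 0 = 1" "(\<lambda>k. cmod (y k)) summable_on UNIV" "(\<Sum>\<^sub>\<infinity>k. cmod (y k)) \<le> s"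
  shows "2 - s \<le> Re (trig_series y x)"
proof -
  define e where "e k = (if k = 0 then 1 else 0 :: complex)" for k :: int
  have e: "((\<lambda>k. cmod (e k)) has_sum 1) UNIV" "((\<lambda>k. e k * cis (of_int k * x)) has_sum 1) UNIV"
    using has_sum_finite_neutralI[of "{0::int}" UNIV "\<lambda>k. cmod (e k)" 1]
      has_sum_finite_neutralI[of "{0::int}" UNIV "\<lambda>k. e k * cis (of_int k * x)" 1]
    by (auto simp: e_def)
  have "((\<lambda>k. cmod (y k) - cmod (e k)) has_sum (\<Sum>\<^sub>\<infinity>k. cmod (y k)) - 1) UNIV"
    by (rule has_sum_minus[OF has_sum_infsum[OF assms(2)] e(1)])
  moreover have "cmod (y k) - cmod (e k) = cmod (y k - e k)" for k
    using assms(1) by (simp add: e_def)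
  ultimately have ye: "((\<lambda>k. cmod (y k - e k)) has_sum (\<Sum>\<^sub>\<infinity>k. cmod (y k)) - 1) UNIV" by simp
  have "cmod (trig_series (\<lambda>k. y k - e k) x) \<le> (\<Sum>\<^sub>\<infinity>k. cmod (y k)) - 1"
    using norm_trig_series_le[OF has_sum_imp_summable[OF ye]] infsumI[OF ye] by simp
  also have "trig_series (\<lambda>k. y k - e k) x = trig_series y x - trig_series e x"
    by (rule trig_series_diff[OF assms(2) has_sum_imp_summable[OF e(1)]])
  also have "trig_series e x = 1" unfolding trig_series_def by (rule infsumI[OF e(2)])
  finally have "cmod (trig_series y x - 1) \<le> s - 1" using assms(3) by simp
  then show ?thesis using abs_Re_le_cmod[of "trig_series y x - 1"] by simp
qed

lemma quotient_difference_bound: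
  fixes a b p q :: real
  assumes E: "\<bar>a - p\<bar> \<le> E" "\<bar>b - q\<bar> \<le> E" "E \<le> 1/6" and p: "1/3 \<le> p" and q: "\<bar>q\<bar> \<le> M"
  shows "\<bar>b / a - q / p\<bar> \<le> (6 + 18 * M) * E"
proof -
  have a: "1/6 \<le> a" using E p by linarith
  have E0: "0 \<le> E" using E(1) by linarith
  have "b / a - q / p = (b - q) / a + q * (p - a) / (a * p)"
    using a p by (simp add: field_simps)
  also have "\<bar>\<dots>\<bar> \<le> \<bar>(b - q) / a\<bar> + \<bar>q * (p - a) / (a * p)\<bar>" by (rule abs_triangle_ineq)
  also have "\<bar>(b - q) / a\<bar> \<le> E / (1/6)"
    unfolding abs_divide using a E E0 by (intro frac_le) auto
  also have "\<bar>q * (p - a) / (a * p)\<bar> \<le> M * E / ((1/6) * (1/3))"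
    unfolding abs_divide abs_mult using a p E E0 q by (intro frac_le mult_mono) auto
  finally show ?thesis by (simp add: algebra_simps)
qed

lemma norm_SUP_le:
  fixes g :: "'a \<Rightarrow> real"
  assumes "\<And>k. 0 \<le> g k" "\<And>k. g k \<le> b"
  shows "norm (SUP k. g k) \<le> b"
proof -
  have "bdd_above (range g)" using assms(2) by (intro bdd_aboveI2) auto
  then have "g k \<le> (SUP k. g k)" for k by (rule cSUP_upper[OF UNIV_I])
  then have "0 \<le> (SUP k. g k)" using assms(1) order_trans by blast
  moreover have "(SUP k. g k) \<le> b" by (rule cSUP_least) (use assms(2) in auto)
  ultimately show ?thesis by simp
qed

locale real_mode_flow = mode_flow +
  assumes V: "\<And>j. V (- j) = cnj (V j)" and sym: "\<And>t k. 0 \<le> t \<Longrightarrow> y t (- k) = cnj (y t k)"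
    and pos: "\<And>x t. 0 \<le> t \<Longrightarrow> 0 < S 0 x t"
begin

definition A :: "real \<Rightarrow> real" where "A t = Re (y t 0)"

definition R :: "real \<Rightarrow> int \<Rightarrow> complex" where "R t k = inverse (A t) *\<^sub>R y t k"

lemma Y_0: "Y 0 t = y t"
  by (simp add: Y_def[abs_def])

lemma y_summable: "0 \<le> t \<Longrightarrow> (\<lambda>k. cmod (y t k)) summable_on UNIV"
  using decays_abs_summable(3)[OF decays_mono[OF dec[of t], of 2]] by simp

lemma fourier_mode_S: "0 \<le> t \<Longrightarrow> fourier_mode (\<lambda>x. S 0 x t) k = y t k"
  by (rule fourier_mode_trig_series[OF y_summable])
    (use trig_series_cnj[of "y t"] sym[of t] in \<open>simp_all add: S_def Y_0 complex_eq_iff\<close>)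

text \<open>Positivity of the function bounds every mode by the one of index 0.\<close>

lemma norm_y_le: "0 \<le> t \<Longrightarrow> cmod (y t k) \<le> A t"
proof -
  assume t: "0 \<le> t"
  have "continuous_on {0..2*pi} (\<lambda>x. S 0 x t)"
    by (rule has_real_derivative_continuous_on[OF S_deriv[OF t]]) simp
  from norm_fourier_mode_le_mode_0[OF this less_imp_le[OF pos[OF t]]]
  show ?thesis by (simp only: A_def fourier_mode_S[OF t])
qed

lemma A_pos: "0 \<le> t \<Longrightarrow> 0 < A t"
proof (rule ccontr)
  assume t: "0 \<le> t" and "\<not> 0 < A t"
  then have "cmod (y t k) \<le> 0" for k using norm_y_le[OF t, of k] by linarith
  then have "y t k = 0" for k by simp
  then have "S 0 x t = 0" for x by (simp add: S_def Y_0 trig_series_def)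
  then show False using pos[OF t, of 0] by simp
qed

lemma y_0_real: "0 \<le> t \<Longrightarrow> y t 0 = of_real (A t)"
  using sym[of t 0] by (simp add: A_def complex_eq_iff)

lemma R_0: "0 \<le> t \<Longrightarrow> R t 0 = 1"
  using A_pos[of t] by (simp add: R_def y_0_real scaleR_conv_of_real)

lemma norm_R_le: "0 \<le> t \<Longrightarrow> cmod (R t k) \<le> 1"
  using A_pos[of t] norm_y_le[of t k] by (simp add: R_def field_simps)

lemma pot_conv_0_real: "0 \<le> t \<Longrightarrow> of_real (Re (pot_conv V (y t) 0)) = pot_conv V (y t) 0"
  using pot_conv_uminus[of V "y t" 0, OF V sym] by (simp add: complex_eq_iff)

lemma R_ode:
  assumes t: "0 \<le> t"
  shows "((\<lambda>s. R s k) has_vector_derivative riccati V (R t) k - symbol \<nu> c k * R t k) (at t within {0..})"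
proof -
  define a' where "a' = Re (pot_conv V (y t) 0) - q * A t"
  have "(A has_real_derivative Re (pot_conv V (y t) 0 - (symbol \<nu> c 0 + of_real q) * y t 0)) (at t within {0..})"
    unfolding A_def by (rule Re_has_real_derivative[OF ode[OF t]])
  then have A': "(A has_real_derivative a') (at t within {0..})"
    by (simp add: a'_def A_def)
  have "((\<lambda>s. inverse (A s)) has_real_derivative - (inverse (A t) * a' * inverse (A t))) (at t within {0..})"
    using DERIV_inverse'[OF A'] A_pos[OF t] by simp
  from has_vector_derivative_scaleR[OF this ode[OF t, of k]]
  have "((\<lambda>s. R s k) has_vector_derivative inverse (A t) *\<^sub>R (pot_conv V (y t) k - (symbol \<nu> c k + of_real q) * y t k)
      + - (inverse (A t) * a' * inverse (A t)) *\<^sub>R y t k) (at t within {0..})"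
    unfolding R_def .
  moreover have "inverse (A t) *\<^sub>R (pot_conv V (y t) k - (symbol \<nu> c k + of_real q) * y t k)
      + - (inverse (A t) * a' * inverse (A t)) *\<^sub>R y t k = riccati V (R t) k - symbol \<nu> c k * R t k"
  proof -
    define i where "i = complex_of_real (inverse (A t))"
    have i: "i * of_real (A t) = 1" using A_pos[OF t] by (simp add: i_def)
    have Ri: "R t k = i * y t k" for k by (simp add: R_def i_def scaleR_conv_of_real)
    have pc: "pot_conv V (R t) k = i * pot_conv V (y t) k" for k
      using pot_conv_mult[of V i "y t" k] by (simp add: Ri[abs_def])
    have ia: "i * of_real a' = i * pot_conv V (y t) 0 - of_real q"
      using i by (simp add: a'_def pot_conv_0_real[OF t] right_diff_distrib mult.left_commute)
    have "inverse (A t) *\<^sub>R (pot_conv V (y t) k - (symbol \<nu> c k + of_real q) * y t k)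
      + - (inverse (A t) * a' * inverse (A t)) *\<^sub>R y t k
      = i * pot_conv V (y t) k - (symbol \<nu> c k + of_real q) * (i * y t k) - (i * of_real a') * (i * y t k)"
      by (simp add: scaleR_conv_of_real i_def algebra_simps)
    also have "\<dots> = riccati V (R t) k - symbol \<nu> c k * R t k"
      unfolding ia riccati_def pc Ri by (simp add: algebra_simps)
    finally show ?thesis .
  qed
  ultimately show ?thesis by simp
qed

lemma R_decays:
  assumes nu2: "2 \<le> \<nu>"
  obtains B where "\<And>t. 0 \<le> t \<Longrightarrow> decays 4 B (R t)"
proof -
  have A0: "0 < A 0" by (rule A_pos) simp
  have d5: "decays 5 (inverse (A 0) * N) (R 0)"
    unfolding decays_def
  proof
    fix k
    show "cmod (R 0 k) * (1 + \<bar>real_of_int k\<bar>) ^ 5 \<le> inverse (A 0) * N"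
      using mult_left_mono[OF decaysD[OF dec[of 0], of k], of "inverse (A 0)"] A0
      by (simp add: R_def mult.assoc)
  qed
  have 0: "decays 0 1 (R t)" if "0 \<le> t" for t using norm_R_le[OF that] by (simp add: decays_def)
  obtain B2 where B2: "\<forall>t\<ge>0. decays (0 + 2) B2 (R t)"
    using normalised_modes_decay_step[OF nu2 norm_R_le R_ode 0 decays_mono[OF d5]] by auto
  have 2: "decays 2 B2 (R t)" if "0 \<le> t" for t using B2 that by (simp add: numeral_2_eq_2)
  obtain B4 where "\<forall>t\<ge>0. decays (2 + 2) B4 (R t)"
    using normalised_modes_decay_step[OF nu2 norm_R_le R_ode 2 decays_mono[OF d5]] by auto
  then show ?thesis using that[of B4] by simp
qed

lemma converges_to_stationary:
  assumes nu2: "2 \<le> \<nu>" and small: "pot_norm V \<le> 2/5"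
    and z: "z 0 = 1" "\<And>k. cmod (z k) \<le> 1" "\<And>k. symbol \<nu> c k * z k = riccati V z k"
    and zd: "decays 4 Bz z" and zpos: "\<And>x. 1/3 \<le> Re (trig_series z x)"
  shows "converges_in_modes (\<lambda>x t. c - 2 * \<nu> * (S 1 x t / S 0 x t))
    (\<lambda>x. c - 2 * \<nu> * (Re (trig_series (\<lambda>k. \<i> * of_int k * z k) x) / Re (trig_series z x)))"
    (is "converges_in_modes ?u ?v")
proof -
  obtain B where B: "\<And>t. 0 \<le> t \<Longrightarrow> decays 4 B (R t)" using R_decays[OF nu2] by blast
  have lim: "((\<lambda>t. R t k) \<longlongrightarrow> z k) at_top" for k
    by (rule normalised_modes_converge[OF nu2 small norm_R_le R_0 R_ode z])
  define e where "e k t = (1 + \<bar>real_of_int k\<bar>) * cmod (R t k - z k)" for k t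
  define E where "E t = (\<Sum>\<^sub>\<infinity>k. e k t)" for t
  define W where "W k = (B + Bz) * (1 / (1 + \<bar>real_of_int k\<bar>) ^ 2)" for k
  have W: "W summable_on UNIV"
    unfolding W_def by (intro summable_on_cmult_right summable_on_int_weight)
  have eb: "norm (e k t) \<le> W k" if "0 \<le> t" for k t
  proof -
    let ?w = "1 + \<bar>real_of_int k\<bar>"
    have "e k t * ?w ^ 2 = cmod (R t k - z k) * ?w ^ 3"
      by (simp add: e_def power2_eq_square power3_eq_cube mult_ac)
    also have "\<dots> \<le> (cmod (R t k) + cmod (z k)) * ?w ^ 3"
      by (intro mult_right_mono norm_triangle_ineq4) simp
    also have "\<dots> \<le> B + Bz"
      unfolding distrib_right
      by (intro add_mono decaysD decays_mono[OF B[OF that]] decays_mono[OF zd]) auto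
    finally have "e k t \<le> (B + Bz) / ?w ^ 2" by (simp add: pos_le_divide_eq)
    then show ?thesis by (simp add: W_def e_def)
  qed
  have es: "(\<lambda>k. e k t) summable_on UNIV" if "0 \<le> t" for t
    by (rule abs_summable_summable[OF Infinite_Sum.abs_summable_on_comparison_test'[OF W eb[OF that]]])
  have "((\<lambda>t. \<Sum>\<^sub>\<infinity>k. e k t) \<longlongrightarrow> (\<Sum>\<^sub>\<infinity>k::int. 0::real)) at_top"
  proof (rule tendsto_infsum_dominated[OF _ _ W])
    show "(e k \<longlongrightarrow> 0) at_top" for k
    proof -
      have "((\<lambda>t. (1 + \<bar>real_of_int k\<bar>) * cmod (R t k - z k)) \<longlongrightarrow> (1 + \<bar>real_of_int k\<bar>) * cmod (z k - z k)) at_top"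
        by (intro tendsto_intros lim)
      then show ?thesis by (simp add: e_def[abs_def])
    qed
    show "\<forall>\<^sub>F t in at_top. \<forall>k. norm (e k t) \<le> W k"
      using eventually_ge_at_top[of "0::real"] by eventually_elim (use eb in auto)
  qed
  then have E0: "(E \<longlongrightarrow> 0) at_top" by (simp add: E_def[abs_def])
  have zs: "(\<lambda>k. cmod (z k)) summable_on UNIV"
    by (rule decays_abs_summable(3)[OF decays_mono[OF zd]]) simp
  have zd1: "decays 3 Bz (\<lambda>k. \<i> * of_int k * z k)"
    by (rule decays_deriv) (use zd in simp)
  have zs1: "(\<lambda>k. cmod (\<i> * of_int k * z k)) summable_on UNIV"
    by (rule decays_abs_summable(3)[OF decays_mono[OF zd1]]) simp
  define M where "M = (\<Sum>\<^sub>\<infinity>k. cmod (\<i> * of_int k * z k))"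
  have M: "\<bar>Re (trig_series (\<lambda>k. \<i> * of_int k * z k) x)\<bar> \<le> M" for x
    using norm_trig_series_le[OF zs1, of x] abs_Re_le_cmod[of "trig_series (\<lambda>k. \<i> * of_int k * z k) x"]
    unfolding M_def by linarith
  have close: "\<bar>Re (trig_series d x) - Re (trig_series d' x)\<bar> \<le> E t"
    if "0 \<le> t" and s: "(\<lambda>k. cmod (d k)) summable_on UNIV" "(\<lambda>k. cmod (d' k)) summable_on UNIV"
      and le: "\<And>k. cmod (d k - d' k) \<le> e k t" for d d' x t
  proof -
    have sd: "(\<lambda>k. cmod (d k - d' k)) summable_on UNIV"
      by (rule Infinite_Sum.abs_summable_on_comparison_test'[OF es[OF that(1)] le])
    moreover have "(\<Sum>\<^sub>\<infinity>k. cmod (d k - d' k)) \<le> E t"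
      unfolding E_def by (rule infsum_mono[OF sd es[OF that(1)] le])
    ultimately have "cmod (trig_series (\<lambda>k. d k - d' k) x) \<le> E t"
      using norm_trig_series_le[of "\<lambda>k. d k - d' k" x] by (meson order_trans)
    then have "cmod (trig_series d x - trig_series d' x) \<le> E t" by (simp only: trig_series_diff[OF s])
    then show ?thesis using abs_Re_le_cmod[of "trig_series d x - trig_series d' x"] by simp
  qed
  define C where "C = 2 * \<nu> * (6 + 18 * M)"
  have bound: "\<bar>?u x t - ?v x\<bar> \<le> C * E t" if t: "0 \<le> t" and Et: "E t \<le> 1/6" for x t
  proof -
    define i where "i = inverse (A t)"
    have i: "i \<noteq> 0" using A_pos[OF t] by (simp add: i_def)
    have Ri: "R t = (\<lambda>k. of_real i * y t k)" by (simp add: R_def[abs_def] i_def scaleR_conv_of_real)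
    have R1i: "(\<lambda>k. \<i> * of_int k * R t k) = (\<lambda>k. of_real i * Y 1 t k)"
      by (simp add: Ri Y_def mult_ac)
    have S0: "Re (trig_series (R t) x) = i * S 0 x t"
      unfolding Ri trig_series_mult by (simp add: S_def Y_0)
    have S1: "Re (trig_series (\<lambda>k. \<i> * of_int k * R t k) x) = i * S 1 x t"
      unfolding R1i trig_series_mult by (simp add: S_def)
    have Rs: "(\<lambda>k. cmod (R t k)) summable_on UNIV"
      by (rule decays_abs_summable(3)[OF decays_mono[OF B[OF t]]]) simp
    have Rd1: "decays 3 B (\<lambda>k. \<i> * of_int k * R t k)"
      by (rule decays_deriv) (use B[OF t] in simp)
    have Rs1: "(\<lambda>k. cmod (\<i> * of_int k * R t k)) summable_on UNIV"
      by (rule decays_abs_summable(3)[OF decays_mono[OF Rd1]]) simp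
    have "\<bar>i * S 1 x t / (i * S 0 x t) - Re (trig_series (\<lambda>k. \<i> * of_int k * z k) x) / Re (trig_series z x)\<bar> \<le> (6 + 18 * M) * E t"
    proof (rule quotient_difference_bound[OF _ _ Et zpos M])
      show "\<bar>i * S 0 x t - Re (trig_series z x)\<bar> \<le> E t"
        unfolding S0[symmetric] by (rule close[OF t Rs zs]) (simp add: e_def distrib_right)
      show "\<bar>i * S 1 x t - Re (trig_series (\<lambda>k. \<i> * of_int k * z k) x)\<bar> \<le> E t"
        unfolding S1[symmetric]
      proof (rule close[OF t Rs1 zs1])
        fix k
        have "cmod (\<i> * of_int k * R t k - \<i> * of_int k * z k) = \<bar>real_of_int k\<bar> * cmod (R t k - z k)"
          by (simp add: right_diff_distrib[symmetric] norm_mult)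
        then show "cmod (\<i> * of_int k * R t k - \<i> * of_int k * z k) \<le> e k t"
          by (simp add: e_def distrib_right)
      qed
    qed
    then have *: "\<bar>S 1 x t / S 0 x t - Re (trig_series (\<lambda>k. \<i> * of_int k * z k) x) / Re (trig_series z x)\<bar> \<le> (6 + 18 * M) * E t"
      using i by simp
    have "\<bar>?u x t - ?v x\<bar> = 2 * \<nu> * \<bar>S 1 x t / S 0 x t - Re (trig_series (\<lambda>k. \<i> * of_int k * z k) x) / Re (trig_series z x)\<bar>"
    proof -
      have "?u x t - ?v x = - (2 * \<nu>) * (S 1 x t / S 0 x t - Re (trig_series (\<lambda>k. \<i> * of_int k * z k) x) / Re (trig_series z x))"
        by (simp only: right_diff_distrib)
      then show ?thesis using nu by (simp add: abs_mult)
    qed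
    also have "\<dots> \<le> 2 * \<nu> * ((6 + 18 * M) * E t)" using nu by (intro mult_left_mono *) auto
    finally show ?thesis by (simp add: C_def)
  qed
  have uc: "continuous_on {0..2*pi} (\<lambda>x. ?u x t)" if "0 \<le> t" for t
  proof -
    have "continuous_on {0..2*pi} (\<lambda>x. S 0 x t)" "continuous_on {0..2*pi} (\<lambda>x. S 1 x t)"
      by (rule has_real_derivative_continuous_on[OF S_deriv], use that in simp, simp)+
    then show ?thesis using pos[OF that] by (intro continuous_intros) (auto simp: less_imp_neq[symmetric])
  qed
  have vc: "continuous_on {0..2*pi} ?v"
  proof -
    have "continuous_on UNIV (trig_series z)" "continuous_on UNIV (trig_series (\<lambda>k. \<i> * of_int k * z k))"
      by (rule continuous_on_trig_series_space[OF decays_mono[OF zd]], simp)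
        (rule continuous_on_trig_series_space[OF decays_mono[OF zd1]], simp)
    then have "continuous_on {0..2*pi} (trig_series z)" "continuous_on {0..2*pi} (trig_series (\<lambda>k. \<i> * of_int k * z k))"
      using continuous_on_subset by blast+
    moreover have "Re (trig_series z x) \<noteq> 0" for x using zpos[of x] by linarith
    ultimately show ?thesis by (intro continuous_intros) auto
  qed
  have sup: "norm (SUP k. cmod (fourier_mode (\<lambda>x. ?u x t) k - fourier_mode ?v k)) \<le> C * E t"
    if t: "0 \<le> t" and Et: "E t \<le> 1/6" for t
  proof -
    have le: "cmod (fourier_mode (\<lambda>x. ?u x t) k - fourier_mode ?v k) \<le> C * E t" for k
      unfolding fourier_mode_diff[OF uc[OF t] vc, symmetric]
      by (rule norm_fourier_mode_le[OF continuous_on_diff[OF uc[OF t] vc] bound[OF t Et]])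
    show ?thesis by (rule norm_SUP_le[OF norm_ge_zero le])
  qed
  show ?thesis
    unfolding converges_in_modes_def
  proof (rule Lim_null_comparison)
    have "\<forall>\<^sub>F t in at_top. E t < 1/6" using order_tendstoD(2)[OF E0, of "1/6"] by simp
    with eventually_ge_at_top[of "0::real"]
    show "\<forall>\<^sub>F t in at_top. norm (SUP k. cmod (fourier_mode (\<lambda>x. ?u x t) k - fourier_mode ?v k)) \<le> C * E t"
      by eventually_elim (rule sup, simp_all)
    show "((\<lambda>t. C * E t) \<longlongrightarrow> 0) at_top" by (rule tendsto_mult_right_zero[OF E0])
  qed
qed

end

lemma cole_hopf_attracted:
  assumes nu2: "2 \<le> \<nu>" and small: "pot_norm V \<le> 2/5" and V: "\<And>j. V (- j) = cnj (V j)"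
    and pot: "\<And>x. complex_of_real (pot x) = (\<Sum>j\<in>{-3..3}. V j * cis (of_int j * x))"
    and pot': "\<And>x. (pot has_real_derivative - f x / (2 * \<nu>)) (at x)"
    and z: "z 0 = 1" "\<And>k. cmod (z k) \<le> 1" "\<And>k. symbol \<nu> c k * z k = riccati V z k"
    and zd: "decays 4 Bz z" and zpos: "\<And>x. 1/3 \<le> Re (trig_series z x)"
    and u0: "times_differentiable 4 u0" "periodic_2pi u0" "integral {0..2*pi} u0 = 2 * pi * c"
  shows "attracts \<nu> f (\<lambda>x. c - 2 * \<nu> * (Re (trig_series (\<lambda>k. \<i> * of_int k * z k) x) / Re (trig_series z x))) u0"
proof -
  obtain \<phi> where \<phi>: "times_differentiable 5 \<phi>" "periodic_2pi \<phi>" "\<And>x. 0 < \<phi> x"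
    "\<And>x. (\<phi> has_real_derivative - ((u0 x - c) / (2 * \<nu>)) * \<phi> x) (at x)"
    using cole_hopf_initial[OF u0] by metis
  obtain B where B: "decays 5 B (fourier_mode \<phi>)" using times_differentiable_decays[OF \<phi>(1,2)] by blast
  have \<phi>c: "continuous_on {0..2*pi} \<phi>"
    by (rule has_real_derivative_continuous_on[OF \<phi>(4)])
  define K where "K = 1 + 2 * 4 ^ 5 * pot_norm V"
  have K: "0 < K" "2 * 4 ^ 5 * pot_norm V \<le> K" using pot_norm_nonneg[of V] by (auto simp: K_def)
  have nu0: "0 \<le> \<nu>" using nu2 by simp
  obtain y N where y: "y 0 = fourier_mode \<phi>" "\<And>t. 0 \<le> t \<Longrightarrow> decays 5 N (y t)" "\<And>t k. y t (- k) = cnj (y t k)"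
    "\<And>k t. 0 \<le> t \<Longrightarrow> ((\<lambda>s. y s k) has_vector_derivative
        pot_conv V (y t) k - (symbol \<nu> c k + of_real K) * y t k) (at t within {0..})"
    using linear_evolution_exists_real[OF nu0 B K V fourier_mode_uminus[OF \<phi>c], where c = c] by metis
  interpret mode_flow \<nu> c K N V y pot f
    by unfold_locales (use nu2 y pot pot' in auto)
  have S0: "S 0 x 0 = \<phi> x" for x
  proof -
    have "complex_of_real (\<phi> x) = trig_series (Y 0 0) x"
      using fourier_expansion[OF times_differentiable_mono[OF \<phi>(1)] \<phi>(2)] by (simp add: Y_def[abs_def] y(1))
    then show ?thesis by (simp add: S_def complex_eq_iff)
  qed
  have pos: "0 < S 0 x t" if "0 \<le> t" for x t
    by (rule S_positive[OF _ that]) (simp add: S0 \<phi>(3))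
  interpret real_mode_flow \<nu> c K N V y pot f
    by unfold_locales (use V y(3) pos in auto)
  define u where "u x t = c - 2 * \<nu> * (S 1 x t / S 0 x t)" for x t
  have "u x 0 = u0 x" for x
  proof -
    have "((\<lambda>x. S 0 x 0) has_real_derivative S 1 x 0) (at x)" using S_deriv[of 0 0 x] by simp
    then have "S 1 x 0 = - ((u0 x - c) / (2 * \<nu>)) * \<phi> x"
      unfolding S0 by (rule DERIV_unique[OF _ \<phi>(4)])
    then show ?thesis using \<phi>(3)[of x] nu2 by (simp add: u_def S0 field_simps)
  qed
  moreover have "burgers_solution \<nu> f \<infinity> u"
    unfolding u_def using pos by (intro burgers_solution_cole_hopf) (metis less_irrefl)
  ultimately have sol: "burgers_ivp_solution \<nu> f u0 \<infinity> u" by (simp add: burgers_ivp_solution_def)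
  moreover have "w x t = u x t" if "burgers_ivp_solution \<nu> f u0 T w" "0 \<le> t" "ereal t < T" for T w x t
    by (rule burgers_ivp_unique[OF that(1) sol nu0 that(2,3)]) simp
  moreover have "converges_in_modes u
      (\<lambda>x. c - 2 * \<nu> * (Re (trig_series (\<lambda>k. \<i> * of_int k * z k) x) / Re (trig_series z x)))"
    unfolding u_def by (rule converges_to_stationary[OF nu2 small z zd zpos])
  ultimately show ?thesis unfolding attracts_def by blast
qed

lemma burgers_global_attractor:
  assumes nu2: "2 \<le> \<nu>" and small: "pot_norm V \<le> 2/5" and V: "\<And>j. V (- j) = cnj (V j)"
    and pot: "\<And>x. complex_of_real (pot x) = (\<Sum>j\<in>{-3..3}. V j * cis (of_int j * x))"
    and pot': "\<And>x. (pot has_real_derivative - f x / (2 * \<nu>)) (at x)" and f: "times_differentiable 2 f"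
  shows "\<exists>ubar. burgers_steady_state \<nu> f ubar \<and> integral {0..2*pi} ubar = 2 * pi * c \<and>
    (\<forall>v. burgers_steady_state \<nu> f v \<and> integral {0..2*pi} v = 2 * pi * c \<longrightarrow> v = ubar) \<and>
    (\<forall>u0. periodic_2pi u0 \<and> C_k 4 u0 \<and> integral {0..2*pi} u0 = 2 * pi * c \<longrightarrow> attracts \<nu> f ubar u0)"
proof -
  obtain z where z: "z 0 = 1" "\<And>k. cmod (z k) \<le> 1" "\<And>k. z (- k) = cnj (z k)"
    "\<And>k. symbol \<nu> c k * z k = riccati V z k"
    using stationary_modes_exist[OF nu2 small V, where c = c] by metis
  obtain Bz where "decays (2 * 3) Bz z" using stationary_modes_decay[OF nu2 z(2,4), of 3] by blast
  then have z5: "decays 5 Bz z" and z4: "decays 4 Bz z" by (auto intro: decays_mono)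
  have zs: "(\<lambda>k. cmod (z k)) summable_on UNIV" by (rule decays_abs_summable(3)[OF decays_mono[OF z4]]) simp
  have zpos: "1/3 \<le> Re (trig_series z x)" for x
    using norm_trig_series_ge[OF z(1) zs stationary_modes_sum[OF nu2 small z(1,2,4) zs], of x] by simp
  define q where "q = Re (pot_conv V z 0)"
  have q: "of_real q = pot_conv V z 0"
    using pot_conv_uminus[of V z 0, OF V z(3)] by (simp add: q_def complex_eq_iff)
  interpret mode_flow \<nu> c q Bz V "\<lambda>t. z" pot f
  proof
    show "((\<lambda>s. z k) has_vector_derivative pot_conv V z k - (symbol \<nu> c k + of_real q) * z k) (at t within {0..})" for t k
      using z(4)[of k] by (simp add: riccati_def q algebra_simps)
  qed (use nu2 z5 pot pot' in auto)
  have S0: "S 0 x t = Re (trig_series z x)" for x t by (simp add: S_def Y_def[abs_def])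
  have S1: "S 1 x t = Re (trig_series (\<lambda>k. \<i> * of_int k * z k) x)" for x t by (simp add: S_def Y_def[abs_def])
  have S0nz: "S 0 x t \<noteq> 0" for x t unfolding S0 using zpos[of x] by linarith
  define ubar where "ubar x = c - 2 * \<nu> * (Re (trig_series (\<lambda>k. \<i> * of_int k * z k) x) / Re (trig_series z x))" for x
  have steady: "burgers_steady_state \<nu> f ubar"
    using burgers_solution_cole_hopf[OF S0nz]
    unfolding burgers_steady_state_def ubar_def S0 S1 .
  have S0c: "continuous_on UNIV (\<lambda>x. S 0 x 0)" "continuous_on UNIV (\<lambda>x. S 1 x 0)"
    by (rule has_real_derivative_continuous_on[OF S_deriv], simp, simp)+
  have ubarS: "ubar = (\<lambda>x. c - 2 * \<nu> * (S 1 x 0 / S 0 x 0))" by (rule ext) (simp only: ubar_def S0 S1)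
  have ubar_cont: "continuous_on UNIV ubar"
    unfolding ubarS using S0nz by (intro continuous_intros S0c) auto
  have int: "integral {0..2*pi} ubar = 2 * pi * c"
  proof -
    have "((\<lambda>x. S 1 x 0 / S 0 x 0) has_integral ln (S 0 (2*pi) 0) - ln (S 0 0 0)) {0..2*pi}"
    proof (rule fundamental_theorem_of_calculus)
      fix x
      have "0 < S 0 x 0" unfolding S0 using zpos[of x] by linarith
      then have "((\<lambda>x. ln (S 0 x 0)) has_real_derivative S 1 x 0 / S 0 x 0) (at x)"
        using S_deriv[of 0 0 x] by (auto intro!: derivative_eq_intros simp: field_simps)
      then show "((\<lambda>x. ln (S 0 x 0)) has_vector_derivative S 1 x 0 / S 0 x 0) (at x within {0..2*pi})"
        unfolding has_real_derivative_iff_has_vector_derivative by (rule has_vector_derivative_at_within)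
    qed simp
    moreover have "S 0 (2*pi) 0 = S 0 0 0" using periodic_2piD[OF periodic_S[of 0 0], of 0 1] by simp
    ultimately have "((\<lambda>x. S 1 x 0 / S 0 x 0) has_integral 0) {0..2*pi}" by simp
    from has_integral_diff[OF has_integral_const_real[of c 0 "2*pi"] has_integral_mult_right[OF this, of "2 * \<nu>"]]
    show ?thesis unfolding ubarS by (auto dest: integral_unique)
  qed
  have attr: "attracts \<nu> f ubar u0"
    if "periodic_2pi u0" "C_k 4 u0" "integral {0..2*pi} u0 = 2 * pi * c" for u0
    unfolding ubar_def
    by (rule cole_hopf_attracted[OF nu2 small V pot pot' z(1,2,4) z4 zpos])
      (use that in \<open>auto simp: C_k_iff_times_differentiable\<close>)
  have uniq: "v = ubar" if v: "burgers_steady_state \<nu> f v" "integral {0..2*pi} v = 2 * pi * c" for v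
  proof -
    have nu0: "0 < \<nu>" using nu2 by simp
    obtain v' where vper: "periodic_2pi v" and v': "\<And>x. (v has_real_derivative v' x) (at x)"
      using burgers_steady_state_derivs[OF v(1)] by metis
    have vc: "continuous_on S v" for S by (rule has_real_derivative_continuous_on[OF v'])
    have "attracts \<nu> f ubar v"
      by (rule attr[OF vper burgers_steady_state_C_4[OF v(1) f nu0] v(2)])
    then obtain u where u: "\<forall>T w. 0 < T \<longrightarrow> burgers_ivp_solution \<nu> f v T w \<longrightarrow>
        (\<forall>x t. 0 \<le> t \<longrightarrow> ereal t < T \<longrightarrow> w x t = u x t)" "converges_in_modes u ubar"
      unfolding attracts_def by blast
    have "burgers_ivp_solution \<nu> f v \<infinity> (\<lambda>x t. v x)"
      using v(1) by (simp add: burgers_ivp_solution_def burgers_steady_state_def)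
    then have uv: "u x t = v x" if "0 \<le> t" for x t using u(1) that by fastforce
    have ubarc: "continuous_on {0..2*pi} ubar" using ubar_cont continuous_on_subset by blast
    define s where "s = (SUP k. cmod (fourier_mode v k - fourier_mode ubar k))"
    have "((\<lambda>t::real. s) \<longlongrightarrow> 0) at_top"
    proof (rule Lim_transform_eventually[OF u(2)[unfolded converges_in_modes_def]])
      show "\<forall>\<^sub>F t in at_top. (SUP k. cmod (fourier_mode (\<lambda>x. u x t) k - fourier_mode ubar k)) = s"
        using eventually_ge_at_top[of "0::real"] by eventually_elim (simp add: uv s_def)
    qed
    then have s0: "s = 0" by (simp add: tendsto_const_iff)
    define g where "g x = v x - ubar x" for x
    have gper: "periodic_2pi g"
      using vper periodic_S[of 0 0] periodic_S[of 1 0] by (simp add: periodic_2pi_def g_def ubarS)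
    have gc: "continuous_on UNIV g" unfolding g_def by (intro continuous_on_diff vc ubar_cont)
    have gc': "continuous_on {0..2*pi} g" using gc continuous_on_subset by blast
    obtain M where M: "\<And>x. \<bar>g x\<bar> \<le> M" using continuous_periodic_bounded[OF gc gper] by blast
    have gm: "fourier_mode g k = fourier_mode v k - fourier_mode ubar k" for k
      unfolding g_def by (rule fourier_mode_diff[OF vc ubarc])
    have "cmod (fourier_mode g k) \<le> s" for k
      unfolding s_def gm[symmetric]
      by (rule cSUP_upper) (use norm_fourier_mode_le[OF gc' M] in \<open>auto intro!: bdd_aboveI2\<close>)
    then have "fourier_mode g k = 0" for k using s0 by simp
    then have "g x = 0" for x by (rule fourier_mode_unique[OF gc gper])
    then show ?thesis by (simp add: g_def fun_eq_iff)
  qed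
  show ?thesis using steady int attr uniq by blast
qed

lemma times_differentiable_trig: "times_differentiable n (\<lambda>x. a * sin (k * x) + b * cos (k * x))"
proof (induction n arbitrary: a b)
  case 0
  show ?case by (auto intro!: continuous_intros)
next
  case (Suc n)
  have "((\<lambda>x. a * sin (k * x) + b * cos (k * x)) has_real_derivative (- (b * k)) * sin (k * x) + (a * k) * cos (k * x)) (at x)" for x
    by (auto intro!: derivative_eq_intros)
  then show ?case
    unfolding times_differentiable.simps
    by (intro exI[of _ "\<lambda>x. (- (b * k)) * sin (k * x) + (a * k) * cos (k * x)"] conjI allI Suc.IH)
qed

lemma trigonometric_forcing_attractor:
  fixes s g :: "nat \<Rightarrow> real"
  assumes nu: "2 \<le> \<nu>" and f: "\<And>x. f x = (\<Sum>k = 1..3. s k * sin (real k * x) + g k * cos (real k * x))"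
    and small: "(\<Sum>k = 1..3. (\<bar>s k\<bar> + \<bar>g k\<bar>) / real k) \<le> 8/5"
  shows "\<exists>ubar. burgers_steady_state \<nu> f ubar \<and> integral {0..2*pi} ubar = 2 * pi * c \<and>
    (\<forall>v. burgers_steady_state \<nu> f v \<and> integral {0..2*pi} v = 2 * pi * c \<longrightarrow> v = ubar) \<and>
    (\<forall>u0. periodic_2pi u0 \<and> C_k 4 u0 \<and> integral {0..2*pi} u0 = 2 * pi * c \<longrightarrow> attracts \<nu> f ubar u0)"
proof -
  define P where "P k = s k / (real k * (2 * \<nu>))" for k
  define Q where "Q k = - g k / (real k * (2 * \<nu>))" for k
  define pot where "pot x = (\<Sum>k = 1..3. P k * cos (real k * x) + Q k * sin (real k * x))" for x
  define V where "V j = (if j = 0 \<or> 3 < \<bar>j\<bar> then 0 else Complex (P (nat \<bar>j\<bar>) / 2) (- of_int (sgn j) * Q (nat \<bar>j\<bar>) / 2))" for j :: int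
  have J: "{-3..3::int} = {-3, -2, -1, 0, 1, 2, 3}" by auto
  have J0: "{-3..3::int} - {0} = {-3, -2, -1, 1, 2, 3}" by auto
  have K: "{1..3::nat} = {1, 2, 3}" by auto
  show ?thesis
  proof (rule burgers_global_attractor[OF nu, where V = V and pot = pot])
    show "V (- j) = cnj (V j)" for j by (simp add: V_def complex_eq_iff)
    show "complex_of_real (pot x) = (\<Sum>j\<in>{-3..3}. V j * cis (of_int j * x))" for x
      unfolding J pot_def K by (simp add: V_def complex_eq_iff)
    have n: "cmod (V j) \<le> (\<bar>P (nat \<bar>j\<bar>)\<bar> + \<bar>Q (nat \<bar>j\<bar>)\<bar>) / 2" for j
    proof -
      have "cmod (V j) \<le> \<bar>Re (V j)\<bar> + \<bar>Im (V j)\<bar>" by (rule cmod_le)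
      also have "\<dots> \<le> (\<bar>P (nat \<bar>j\<bar>)\<bar> + \<bar>Q (nat \<bar>j\<bar>)\<bar>) / 2"
        by (auto simp: V_def sgn_if)
      finally show ?thesis .
    qed
    have "pot_norm V \<le> (\<Sum>j\<in>{-3..3} - {0}. (\<bar>P (nat \<bar>j\<bar>)\<bar> + \<bar>Q (nat \<bar>j\<bar>)\<bar>) / 2)"
      unfolding pot_norm_def using n
      by (subst sum.remove[of _ 0]) (auto simp: V_def[of 0] intro!: sum_mono)
    also have "\<dots> = (\<Sum>k = 1..3. \<bar>P k\<bar> + \<bar>Q k\<bar>)"
      unfolding J0 K by simp
    also have "\<dots> = (\<Sum>k = 1..3. (\<bar>s k\<bar> + \<bar>g k\<bar>) / real k) / (2 * \<nu>)"
      unfolding sum_divide_distrib P_def Q_def using nu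
      by (intro sum.cong refl) (simp add: abs_mult add_divide_distrib)
    also have "\<dots> \<le> (8/5) / (2 * 2)"
      using small nu by (intro frac_le) auto
    finally show "pot_norm V \<le> 2/5" by simp
    show "(pot has_real_derivative - f x / (2 * \<nu>)) (at x)" for x
    proof -
      have "(pot has_real_derivative (\<Sum>k = 1..3. - (P k * real k) * sin (real k * x) + Q k * real k * cos (real k * x))) (at x)"
        unfolding pot_def by (auto intro!: derivative_eq_intros sum.cong)
      also have "(\<Sum>k = 1..3. - (P k * real k) * sin (real k * x) + Q k * real k * cos (real k * x))
          = (\<Sum>k = 1..3. - (s k * sin (real k * x) + g k * cos (real k * x)) / (2 * \<nu>))"
        using nu by (intro sum.cong refl) (simp add: P_def Q_def field_simps)
      also have "\<dots> = - f x / (2 * \<nu>)" by (simp only: f sum_divide_distrib[symmetric] sum_negf)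
      finally show ?thesis .
    qed
    have "f = (\<lambda>x. (s 1 * sin (real 1 * x) + g 1 * cos (real 1 * x)) + ((s 2 * sin (real 2 * x) + g 2 * cos (real 2 * x))
        + (s 3 * sin (real 3 * x) + g 3 * cos (real 3 * x))))"
      unfolding f[abs_def] K by simp
    moreover have "times_differentiable 2 \<dots>"
      by (intro times_differentiable_add times_differentiable_trig)
    ultimately show "times_differentiable 2 f" by simp
  qed
qed

theorem theorem1p1:
  fixes \<nu> :: real and f :: "real \<Rightarrow> real" and \<beta> \<gamma> :: "nat \<Rightarrow> real"
  assumes "\<nu> \<in> {2..2.1}"
    and "\<And>k. k \<in> {1..3} \<Longrightarrow> \<beta> k \<in> {-0.03..0.03}"
    and "\<And>k. k \<in> {1..3} \<Longrightarrow> \<gamma> k \<in> {-0.03..0.03}"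
    and "\<And>x. f x = 1.6 * cos (2 * x) - 2 * sin (3 * x)
                 + (\<Sum>k = 1..3. \<beta> k * sin (real k * x) + \<gamma> k * cos (real k * x))"
  shows "\<exists>ubar :: real \<Rightarrow> real.
           burgers_steady_state \<nu> f ubar \<and>
           integral {0..2 * pi} ubar = pi \<and>
           (\<forall>v. burgers_steady_state \<nu> f v \<and> integral {0..2 * pi} v = pi \<longrightarrow> v = ubar) \<and>
           (\<forall>u0. periodic_2pi u0 \<and> C_k 4 u0 \<and> integral {0..2 * pi} u0 = pi \<longrightarrow>
                 attracts \<nu> f ubar u0)"
proof -
  define s where "s k = \<beta> k + (if k = 3 then -2 else 0)" for k
  define g where "g k = \<gamma> k + (if k = 2 then 1.6 else 0)" for k
  have K: "{1..3::nat} = {1, 2, 3}" by auto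
  have f: "f x = (\<Sum>k = 1..3. s k * sin (real k * x) + g k * cos (real k * x))" for x
    unfolding assms(4) K by (simp add: s_def g_def algebra_simps)
  have sum_le: "a1 + b1 + (a2 + b2) / 2 + (a3 + b3) / 3 \<le> 8/5"
    if "a1 \<le> 3/100" "a2 \<le> 3/100" "a3 \<le> 203/100" "b1 \<le> 3/100" "b2 \<le> 163/100" "b3 \<le> 3/100"
    for a1 a2 a3 b1 b2 b3 :: real
  proof -
    have "a1 + b1 + (a2 + b2) / 2 + (a3 + b3) / 3 \<le> 6/100 + 83/100 + 206/300"
      by (intro add_mono) (use that in simp_all)
    also have "\<dots> \<le> 8/5" by simp
    finally show ?thesis .
  qed
  have "\<bar>s 1\<bar> \<le> 3/100" "\<bar>s 2\<bar> \<le> 3/100" "\<bar>s 3\<bar> \<le> 203/100"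
    "\<bar>g 1\<bar> \<le> 3/100" "\<bar>g 2\<bar> \<le> 163/100" "\<bar>g 3\<bar> \<le> 3/100"
    using assms(2)[of 1] assms(2)[of 2] assms(2)[of 3] assms(3)[of 1] assms(3)[of 2] assms(3)[of 3]
    by (auto simp: s_def g_def)
  from sum_le[OF this] have "(\<Sum>k = 1..3. (\<bar>s k\<bar> + \<bar>g k\<bar>) / real k) \<le> 8/5"
    unfolding K by simp
  from trigonometric_forcing_attractor[OF _ f this, of \<nu> "1/2"] assms(1) show ?thesis by simp
qed

end
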